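(* Let $G$ be a locally compact Hausdorff second countable groupoid with a left Haar system. For $F\in C_c(G)$, define $R_F:C_c(G)\to C_c(G)$ by right convolution: $R_Ff=f*F$. Then $R_F$ extends to an element of $\mathfrak L(E^2)$ whose norm is $\le\|F\|_I$, and the map $F\mapsto R_F$ is a $*$-antirepresentation of $C_c(G)$, the closure of whose image in $\mathfrak L(E^2)$ is canonically isomorphic to $C^*_{red}(G)$.
   Context: $G$ has unit space $G^0$, range and source maps $r,s$, $G^u=r^{-1}(\{u\})$, $G_u=s^{-1}(\{u\})$, left Haar system $\{\lambda^u\}$ with $\lambda^u$ on $G^u$, and $\lambda_u$ the image of $\lambda^u$ under inversion (a measure on $G_u$). For $f,g\in C_c(G)$: $(f*g)(x)=\int f(t)g(t^{-1}x)\,d\lambda^{r(x)}(t)$, $f^*(x)=\overline{f(x^{-1})}$. $\|f\|_I=\max\{\sup_u\int_{G^u}|f|\,d\lambda^u,\ \sup_u\int_{G_u}|f|\,d\lambda_u\}$. $\|F\|_{red}=\sup_u\|\pi_u(F)\|$, where $\pi_u(F)$ acts on $L^2(G_u,\lambda_u)$ by $\pi_u(F)\xi(x)=\int F(t)\xi(t^{-1}x)\,d\lambda^{r(x)}(t)$; $C^*_{red}(G)$ is the completion of $(C_c(G),\|\cdot\|_{red})$. $D=C_0(G^0)$. $L^2(G)=\{L^2(G^u,\lambda^u)\}_{u}$ is the continuous field of Hilbert spaces over $G^0$ whose continuous sections are determined by $C_c(G)$ via $f\mapsto(u\mapsto f|_{G^u})$. $E^2$ is the space of its continuous sections vanishing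 at infinity, with sup norm; $C_c(G)$ is dense in it, and it is a Hilbert $D$-module with $(\xi b)(t)=\xi(t)b(r(t))$, $\langle\xi,\eta\rangle(u)=(\xi^u,\eta^u)$, inner products being conjugate linear in the first variable. $\mathfrak L(E^2)$ is the $C^*$-algebra of adjointable operators on $E^2$. *)

theory Defs
  imports "HOL-Analysis.Analysis"
begin

section \<open>Groupoids with a left Haar system\<close>

text \<open>The groupoid is the whole type \<open>'g\<close>; its unit space is a subset of it. The product
  is a total function, of which only the values at composable pairs matter. The topology on
  \<open>'g\<close> is the one given by its type class.\<close>

record 'g groupoid_data =
  units :: "'g set"
  rng :: "'g \<Rightarrow> 'g"
  src :: "'g \<Rightarrow> 'g"
  gmul :: "'g \<Rightarrow> 'g \<Rightarrow> 'g"
  ginv :: "'g \<Rightarrow> 'g"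
  haar :: "'g \<Rightarrow> 'g measure"

definition range_fibre :: "'g groupoid_data \<Rightarrow> 'g \<Rightarrow> 'g set"
  where "range_fibre G u = {x. rng G x = u}"

definition source_fibre :: "'g groupoid_data \<Rightarrow> 'g \<Rightarrow> 'g set"
  where "source_fibre G u = {x. src G x = u}"

locale groupoid =
  fixes G :: "'g groupoid_data"
  assumes rng_unit: "rng G x \<in> units G"
    and src_unit: "src G x \<in> units G"
    and unit_rng: "u \<in> units G \<Longrightarrow> rng G u = u"
    and unit_src: "u \<in> units G \<Longrightarrow> src G u = u"
    and rng_mul: "src G x = rng G y \<Longrightarrow> rng G (gmul G x y) = rng G x"
    and src_mul: "src G x = rng G y \<Longrightarrow> src G (gmul G x y) = src G y"
    and mul_assoc: "src G x = rng G y \<Longrightarrow> src G y = rng G z \<Longrightarrow>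
          gmul G (gmul G x y) z = gmul G x (gmul G y z)"
    and unit_mul: "gmul G (rng G x) x = x"
    and mul_unit: "gmul G x (src G x) = x"
    and rng_inv: "rng G (ginv G x) = src G x"
    and src_inv: "src G (ginv G x) = rng G x"
    and mul_inv: "gmul G x (ginv G x) = rng G x"
    and inv_mul: "gmul G (ginv G x) x = src G x"

text \<open>Continuity of the range and source maps follows.\<close>

locale topological_groupoid = groupoid G
  for G :: "'g::topological_space groupoid_data" +
  assumes continuous_mul: "continuous_on {(x, y). src G x = rng G y} (\<lambda>(x, y). gmul G x y)"
    and continuous_inv: "continuous_on UNIV (ginv G)"

definition Cc :: "('a::topological_space \<Rightarrow> complex) set"
  where "Cc = {f. continuous_on UNIV f \<and> compact (closure {x. f x \<noteq> 0})}"

text \<open>The measure \<open>haar G u\<close> lives on the fibre over the unit \<open>u\<close>, with the Borel sets of that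
  fibre (its values at non-units are irrelevant). In a second countable locally compact Hausdorff
  space the Radon measures are the Borel measures that are finite on compact sets.\<close>

locale haar_groupoid = topological_groupoid G
  for G :: "'g::topological_space groupoid_data" +
  assumes sets_haar: "u \<in> units G \<Longrightarrow>
          sets (haar G u) = sets (restrict_space borel (range_fibre G u))"
    and haar_finite_on_compact: "u \<in> units G \<Longrightarrow> compact K \<Longrightarrow> K \<subseteq> range_fibre G u \<Longrightarrow>
          emeasure (haar G u) K < \<infinity>"
    and haar_full_support: "u \<in> units G \<Longrightarrow> open U \<Longrightarrow> U \<inter> range_fibre G u \<noteq> {} \<Longrightarrow>
          emeasure (haar G u) (U \<inter> range_fibre G u) > 0"
    and haar_continuous: "f \<in> Cc \<Longrightarrow> continuous_on (units G) (\<lambda>u. LINT x|haar G u. f x)"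
    and haar_left_invariant: "f \<in> Cc \<Longrightarrow>
          (LINT y|haar G (src G x). f (gmul G x y)) = (LINT y|haar G (rng G x). f y)"

definition haar_source :: "'g::topological_space groupoid_data \<Rightarrow> 'g \<Rightarrow> 'g measure"
  where "haar_source G u =
    distr (haar G u) (restrict_space borel (source_fibre G u)) (ginv G)"

definition conv ::
    "'g groupoid_data \<Rightarrow> ('g \<Rightarrow> complex) \<Rightarrow> ('g \<Rightarrow> complex) \<Rightarrow> 'g \<Rightarrow> complex"
  where "conv G f g x = (LINT t|haar G (rng G x). f t * g (gmul G (ginv G t) x))"

definition invol :: "'g groupoid_data \<Rightarrow> ('g \<Rightarrow> complex) \<Rightarrow> 'g \<Rightarrow> complex"
  where "invol G f x = cnj (f (ginv G x))"

definition flip :: "'g groupoid_data \<Rightarrow> ('g \<Rightarrow> complex) \<Rightarrow> 'g \<Rightarrow> complex"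
  where "flip G f x = f (ginv G x)"

text \<open>The suprema of reals below are over bounded nonempty sets whenever \<open>f\<close> lies in \<open>Cc\<close>.\<close>

definition I_norm :: "'g::topological_space groupoid_data \<Rightarrow> ('g \<Rightarrow> complex) \<Rightarrow> real"
  where "I_norm G f = max (SUP u\<in>units G. LINT x|haar G u. cmod (f x))
                          (SUP u\<in>units G. LINT x|haar_source G u. cmod (f x))"


section \<open>Square integrable functions and the reduced norm\<close>

definition sq_int :: "'a measure \<Rightarrow> ('a \<Rightarrow> complex) set"
  where "sq_int M = {\<xi> \<in> borel_measurable M. integrable M (\<lambda>x. (cmod (\<xi> x))\<^sup>2)}"

definition l2_inner :: "'a measure \<Rightarrow> ('a \<Rightarrow> complex) \<Rightarrow> ('a \<Rightarrow> complex) \<Rightarrow> complex"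
  where "l2_inner M \<xi> \<eta> = (LINT x|M. cnj (\<xi> x) * \<eta> x)"

definition l2_norm :: "'a measure \<Rightarrow> ('a \<Rightarrow> complex) \<Rightarrow> real"
  where "l2_norm M \<xi> = sqrt (LINT x|M. (cmod (\<xi> x))\<^sup>2)"

text \<open>Operator norm on \<open>L\<^sup>2\<close> of an operator given on representatives.\<close>

definition l2_opnorm :: "'a measure \<Rightarrow> (('a \<Rightarrow> complex) \<Rightarrow> 'a \<Rightarrow> complex) \<Rightarrow> real"
  where "l2_opnorm M T = (SUP \<xi>\<in>{\<xi> \<in> sq_int M. l2_norm M \<xi> \<le> 1}. l2_norm M (T \<xi>))"

text \<open>On the fibre of \<open>src G\<close> over \<open>u\<close> the following involves only the values of \<open>\<xi>\<close> on that
  fibre, so that one formula serves for the representations at all units \<open>u\<close>.\<close>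

definition reg_rep ::
    "'g groupoid_data \<Rightarrow> ('g \<Rightarrow> complex) \<Rightarrow> ('g \<Rightarrow> complex) \<Rightarrow> 'g \<Rightarrow> complex"
  where "reg_rep G F \<xi> x = (LINT t|haar G (rng G x). F t * \<xi> (gmul G (ginv G t) x))"

definition red_norm :: "'g::topological_space groupoid_data \<Rightarrow> ('g \<Rightarrow> complex) \<Rightarrow> real"
  where "red_norm G F = (SUP u\<in>units G. l2_opnorm (haar_source G u) (reg_rep G F))"


section \<open>Normed *-algebras and their completions\<close>

record 'a star_algebra =
  acarr :: "'a set"
  aadd :: "'a \<Rightarrow> 'a \<Rightarrow> 'a"
  ascl :: "complex \<Rightarrow> 'a \<Rightarrow> 'a"
  amul :: "'a \<Rightarrow> 'a \<Rightarrow> 'a"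
  astar :: "'a \<Rightarrow> 'a"
  anrm :: "'a \<Rightarrow> real"

definition adiff :: "'a star_algebra \<Rightarrow> 'a \<Rightarrow> 'a \<Rightarrow> 'a"
  where "adiff A x y = aadd A x (ascl A (-1) y)"

definition star_linear ::
    "'a star_algebra \<Rightarrow> 'b star_algebra \<Rightarrow> ('a \<Rightarrow> 'b) \<Rightarrow> bool"
  where "star_linear A B h \<longleftrightarrow>
    h \<in> acarr A \<rightarrow> acarr B \<and>
    (\<forall>x\<in>acarr A. \<forall>y\<in>acarr A. h (aadd A x y) = aadd B (h x) (h y)) \<and>
    (\<forall>c. \<forall>x\<in>acarr A. h (ascl A c x) = ascl B c (h x)) \<and>
    (\<forall>x\<in>acarr A. h (astar A x) = astar B (h x))"

definition star_hom :: "'a star_algebra \<Rightarrow> 'b star_algebra \<Rightarrow> ('a \<Rightarrow> 'b) \<Rightarrow> bool"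
  where "star_hom A B h \<longleftrightarrow> star_linear A B h \<and>
    (\<forall>x\<in>acarr A. \<forall>y\<in>acarr A. h (amul A x y) = amul B (h x) (h y))"

definition star_antihom :: "'a star_algebra \<Rightarrow> 'b star_algebra \<Rightarrow> ('a \<Rightarrow> 'b) \<Rightarrow> bool"
  where "star_antihom A B h \<longleftrightarrow> star_linear A B h \<and>
    (\<forall>x\<in>acarr A. \<forall>y\<in>acarr A. h (amul A x y) = amul B (h y) (h x))"

definition isometric_bij :: "'a star_algebra \<Rightarrow> 'b star_algebra \<Rightarrow> ('a \<Rightarrow> 'b) \<Rightarrow> bool"
  where "isometric_bij A B h \<longleftrightarrow> bij_betw h (acarr A) (acarr B) \<and>
    (\<forall>x\<in>acarr A. anrm B (h x) = anrm A x)"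

definition star_iso :: "'a star_algebra \<Rightarrow> 'b star_algebra \<Rightarrow> ('a \<Rightarrow> 'b) \<Rightarrow> bool"
  where "star_iso A B h \<longleftrightarrow> star_hom A B h \<and> isometric_bij A B h"

definition star_antiiso :: "'a star_algebra \<Rightarrow> 'b star_algebra \<Rightarrow> ('a \<Rightarrow> 'b) \<Rightarrow> bool"
  where "star_antiiso A B h \<longleftrightarrow> star_antihom A B h \<and> isometric_bij A B h"

definition norm_closure :: "'a star_algebra \<Rightarrow> 'a set \<Rightarrow> 'a set"
  where "norm_closure A S = {x \<in> acarr A. \<forall>e>0. \<exists>y\<in>S. anrm A (adiff A x y) < e}"

definition closure_alg :: "'a star_algebra \<Rightarrow> 'a set \<Rightarrow> 'a star_algebra"
  where "closure_alg A S = A\<lparr>acarr := norm_closure A S\<rparr>"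

text \<open>The completion consists of the Cauchy sequences modulo null sequences.\<close>

definition acauchy :: "'a star_algebra \<Rightarrow> (nat \<Rightarrow> 'a) \<Rightarrow> bool"
  where "acauchy A X \<longleftrightarrow> range X \<subseteq> acarr A \<and>
    (\<forall>e>0. \<exists>N. \<forall>m\<ge>N. \<forall>n\<ge>N. anrm A (adiff A (X m) (X n)) < e)"

definition aclass :: "'a star_algebra \<Rightarrow> (nat \<Rightarrow> 'a) \<Rightarrow> (nat \<Rightarrow> 'a) set"
  where "aclass A X = {Y. acauchy A Y \<and> (\<lambda>n. anrm A (adiff A (X n) (Y n))) \<longlonglongrightarrow> 0}"

definition rep :: "'a set \<Rightarrow> 'a"
  where "rep C = (SOME x. x \<in> C)"

definition completion :: "'a star_algebra \<Rightarrow> (nat \<Rightarrow> 'a) set star_algebra"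
  where "completion A =
    \<lparr>acarr = aclass A ` {X. acauchy A X},
     aadd = (\<lambda>x y. aclass A (\<lambda>n. aadd A (rep x n) (rep y n))),
     ascl = (\<lambda>c x. aclass A (\<lambda>n. ascl A c (rep x n))),
     amul = (\<lambda>x y. aclass A (\<lambda>n. amul A (rep x n) (rep y n))),
     astar = (\<lambda>x. aclass A (\<lambda>n. astar A (rep x n))),
     anrm = (\<lambda>x. lim (\<lambda>n. anrm A (rep x n)))\<rparr>"

definition completion_embed :: "'a star_algebra \<Rightarrow> 'a \<Rightarrow> (nat \<Rightarrow> 'a) set"
  where "completion_embed A a = aclass A (\<lambda>_. a)"

definition Cc_red :: "'g::topological_space groupoid_data \<Rightarrow> ('g \<Rightarrow> complex) star_algebra"
  where "Cc_red G =
    \<lparr>acarr = Cc,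
     aadd = (\<lambda>f g x. f x + g x),
     ascl = (\<lambda>c f x. c * f x),
     amul = conv G,
     astar = invol G,
     anrm = red_norm G\<rparr>"

definition cstar_red ::
    "'g::topological_space groupoid_data \<Rightarrow> (nat \<Rightarrow> 'g \<Rightarrow> complex) set star_algebra"
  where "cstar_red G = completion (Cc_red G)"


section \<open>Hilbert modules and adjointable operators\<close>

text \<open>The inner product is conjugate linear in the first variable, with values in the
  coefficient algebra \<open>hcoef\<close>, which acts on the right by \<open>hact\<close>.\<close>

record ('e, 'd) hilbert_module =
  hcarr :: "'e set"
  hcoef :: "'d set"
  hadd :: "'e \<Rightarrow> 'e \<Rightarrow> 'e"
  hscl :: "complex \<Rightarrow> 'e \<Rightarrow> 'e"
  hact :: "'e \<Rightarrow> 'd \<Rightarrow> 'e"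
  hinner :: "'e \<Rightarrow> 'e \<Rightarrow> 'd"
  hnrm :: "'e \<Rightarrow> real"

definition is_adjoint :: "('e, 'd) hilbert_module \<Rightarrow> ('e \<Rightarrow> 'e) \<Rightarrow> ('e \<Rightarrow> 'e) \<Rightarrow> bool"
  where "is_adjoint E T S \<longleftrightarrow> S \<in> hcarr E \<rightarrow>\<^sub>E hcarr E \<and>
    (\<forall>x\<in>hcarr E. \<forall>y\<in>hcarr E. hinner E (T x) y = hinner E x (S y))"

text \<open>In a Hilbert module the linearity and boundedness conditions are consequences of the
  existence of an adjoint.\<close>

definition adjointable :: "('e, 'd) hilbert_module \<Rightarrow> ('e \<Rightarrow> 'e) set"
  where "adjointable E = {T \<in> hcarr E \<rightarrow>\<^sub>E hcarr E.
    (\<forall>x\<in>hcarr E. \<forall>y\<in>hcarr E. T (hadd E x y) = hadd E (T x) (T y)) \<and>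
    (\<forall>c. \<forall>x\<in>hcarr E. T (hscl E c x) = hscl E c (T x)) \<and>
    (\<forall>x\<in>hcarr E. \<forall>b\<in>hcoef E. T (hact E x b) = hact E (T x) b) \<and>
    (\<exists>C. \<forall>x\<in>hcarr E. hnrm E (T x) \<le> C * hnrm E x) \<and>
    (\<exists>S. is_adjoint E T S)}"

definition adj_ops :: "('e, 'd) hilbert_module \<Rightarrow> ('e \<Rightarrow> 'e) star_algebra"
  where "adj_ops E =
    \<lparr>acarr = adjointable E,
     aadd = (\<lambda>S T. \<lambda>x\<in>hcarr E. hadd E (S x) (T x)),
     ascl = (\<lambda>c T. \<lambda>x\<in>hcarr E. hscl E c (T x)),
     amul = (\<lambda>S T. compose (hcarr E) S T),
     astar = (\<lambda>T. THE S. is_adjoint E T S),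
     anrm = (\<lambda>T. SUP x\<in>{x \<in> hcarr E. hnrm E x \<le> 1}. hnrm E (T x))\<rparr>"


section \<open>The Hilbert module of the field of the spaces \<open>L\<^sup>2\<close> of the range fibres\<close>

text \<open>Since the groupoid is the disjoint union of its range fibres, a choice of representatives
  turns a section of the field into one function on the groupoid, determined up to null sets in
  every fibre; no measurability across the fibres is involved. A section is continuous if it is
  locally a uniform limit of sections given by elements of \<open>Cc\<close>.\<close>

definition continuous_section :: "'g::topological_space groupoid_data \<Rightarrow> ('g \<Rightarrow> complex) \<Rightarrow> bool"
  where "continuous_section G \<xi> \<longleftrightarrow>
    (\<forall>u\<in>units G. \<xi> \<in> sq_int (haar G u)) \<and>
    (\<forall>u\<in>units G. \<forall>e>0. \<exists>f\<in>Cc. \<exists>V. open V \<and> u \<in> V \<and>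
       (\<forall>v\<in>V \<inter> units G. l2_norm (haar G v) (\<lambda>x. \<xi> x - f x) < e))"

definition vanishing_section :: "'g::topological_space groupoid_data \<Rightarrow> ('g \<Rightarrow> complex) \<Rightarrow> bool"
  where "vanishing_section G \<xi> \<longleftrightarrow>
    (\<forall>e>0. \<exists>K. compact K \<and> K \<subseteq> units G \<and> (\<forall>u\<in>units G - K. l2_norm (haar G u) \<xi> < e))"

definition sec_class :: "'g groupoid_data \<Rightarrow> ('g \<Rightarrow> complex) \<Rightarrow> ('g \<Rightarrow> complex) set"
  where "sec_class G \<xi> = {\<eta>. \<forall>u\<in>units G.
    \<eta> \<in> sq_int (haar G u) \<and> (AE x in haar G u. \<eta> x = \<xi> x)}"

definition C0_units :: "'g::topological_space groupoid_data \<Rightarrow> ('g \<Rightarrow> complex) set"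
  where "C0_units G = {b \<in> extensional (units G). continuous_on (units G) b \<and>
    (\<forall>e>0. \<exists>K. compact K \<and> K \<subseteq> units G \<and> (\<forall>u\<in>units G - K. cmod (b u) < e))}"

definition E2 ::
    "'g::topological_space groupoid_data \<Rightarrow> (('g \<Rightarrow> complex) set, 'g \<Rightarrow> complex) hilbert_module"
  where "E2 G =
    \<lparr>hcarr = sec_class G ` {\<xi>. continuous_section G \<xi> \<and> vanishing_section G \<xi>},
     hcoef = C0_units G,
     hadd = (\<lambda>A B. sec_class G (\<lambda>t. rep A t + rep B t)),
     hscl = (\<lambda>c A. sec_class G (\<lambda>t. c * rep A t)),
     hact = (\<lambda>A b. sec_class G (\<lambda>t. rep A t * b (rng G t))),
     hinner = (\<lambda>A B. \<lambda>u\<in>units G. l2_inner (haar G u) (rep A) (rep B)),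
     hnrm = (\<lambda>A. SUP u\<in>units G. l2_norm (haar G u) (rep A))\<rparr>"

end

theory Submission
  imports Defs
begin

text \<open>Elements of \<open>E2 G\<close> are sections of the field of the spaces \<open>L\<^sup>2\<close> of the range fibres, and
  \<open>R F\<close> can be defined on all of them by the convolution formula: on the fibre over \<open>u\<close> it is the
  integral operator with kernel \<open>F (t\<^sup>-\<^sup>1 x)\<close>, and left invariance of the Haar system turns the two
  marginal integrals of \<open>\<bar>F (t\<^sup>-\<^sup>1 x)\<bar>\<close> into integrals of \<open>\<bar>F\<bar>\<close> and of \<open>\<bar>F\<bar>\<close> composed with the
  inversion. Hence Schur's test bounds it by the \<open>I\<close>-norm, and Fubini's theorem yields its adjoint,
  convolution by \<open>F\<^sup>*\<close>, and the rule for products.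

  The inversion carries \<open>L\<^sup>2\<close> of the source fibre of \<open>u\<close> to that of the range fibre and the regular
  representation of \<open>F\<close> at \<open>u\<close> to right convolution by \<open>x \<mapsto> F (x\<^sup>-\<^sup>1)\<close>. The norm of \<open>R F\<close> is the
  supremum of its norms on the fibres, because a vector in one fibre extends approximately to a
  section without increase of the norm. So \<open>R\<close> is isometric for the reduced norm, and since the
  adjointable operators form a complete normed algebra it extends to the completion.\<close>


section \<open>Extension of isometric maps to completions\<close>

text \<open>\<open>R\<close> reverses products, so its own extension to the completion is an
  anti-isomorphism. An isomorphism onto the same closure comes from composing with
  \<open>flip\<close>: inversion reverses convolution as well, maps \<open>Cc\<close> onto itself
  and preserves the reduced norm. The measure theory is shaped by the axioms of the Haar system,
  which constrain integrals of \<open>Cc\<close> functions only, while Schur's test and Fubini's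
  theorem call for invariance with measurable integrands. Cozero sets of \<open>Cc\<close> functions
  bridge the gap: they are stable under intersection, generate the Borel sets, and have indicators
  that are limits of \<open>Cc\<close> functions. The same sets give the density of
  \<open>Cc\<close> in L2 of a fibre, through which a single vector is spread to a section. One
  constant bounds both marginals of the kernel because the I-norm is a maximum over the two kinds of
  fibres.\<close>

definition adst :: "'a star_algebra \<Rightarrow> 'a \<Rightarrow> 'a \<Rightarrow> real"
  where "adst A x y = anrm A (adiff A x y)"

text \<open>These are the estimates that make the operations of a Banach *-algebra continuous;
  \<open>dst_mul\<close> records x y - x' y' = x (y - y') + (x - x') y'. Distances are primitive
  because the norm of a record carries no topology, so that limits have to be expressed by real null
  sequences.\<close>

locale complete_star_algebra =
  fixes B :: "'b star_algebra"
  assumes add_closed: "x \<in> acarr B \<Longrightarrow> y \<in> acarr B \<Longrightarrow> aadd B x y \<in> acarr B"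
    and scl_closed: "x \<in> acarr B \<Longrightarrow> ascl B c x \<in> acarr B"
    and mul_closed: "x \<in> acarr B \<Longrightarrow> y \<in> acarr B \<Longrightarrow> amul B x y \<in> acarr B"
    and star_closed: "x \<in> acarr B \<Longrightarrow> astar B x \<in> acarr B"
    and dst_nonneg: "x \<in> acarr B \<Longrightarrow> y \<in> acarr B \<Longrightarrow> 0 \<le> adst B x y"
    and dst_eq: "x \<in> acarr B \<Longrightarrow> y \<in> acarr B \<Longrightarrow> adst B x y = 0 \<longleftrightarrow> x = y"
    and dst_sym: "x \<in> acarr B \<Longrightarrow> y \<in> acarr B \<Longrightarrow> adst B x y = adst B y x"
    and dst_triangle: "x \<in> acarr B \<Longrightarrow> y \<in> acarr B \<Longrightarrow> z \<in> acarr B \<Longrightarrow>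
          adst B x z \<le> adst B x y + adst B y z"
    and dst_add: "x \<in> acarr B \<Longrightarrow> y \<in> acarr B \<Longrightarrow> x' \<in> acarr B \<Longrightarrow> y' \<in> acarr B \<Longrightarrow>
          adst B (aadd B x y) (aadd B x' y') \<le> adst B x x' + adst B y y'"
    and dst_scl: "x \<in> acarr B \<Longrightarrow> y \<in> acarr B \<Longrightarrow>
          adst B (ascl B c x) (ascl B c y) \<le> cmod c * adst B x y"
    and dst_mul: "x \<in> acarr B \<Longrightarrow> y \<in> acarr B \<Longrightarrow> x' \<in> acarr B \<Longrightarrow> y' \<in> acarr B \<Longrightarrow>
          adst B (amul B x y) (amul B x' y') \<le> anrm B x * adst B y y' + adst B x x' * anrm B y'"
    and dst_star: "x \<in> acarr B \<Longrightarrow> y \<in> acarr B \<Longrightarrow> adst B (astar B x) (astar B y) \<le> adst B x y"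
    and dst_nrm: "x \<in> acarr B \<Longrightarrow> y \<in> acarr B \<Longrightarrow> \<bar>anrm B x - anrm B y\<bar> \<le> adst B x y"
    and complete: "acauchy B X \<Longrightarrow> \<exists>l\<in>acarr B. (\<lambda>n. adst B (X n) l) \<longlonglongrightarrow> 0"
begin

definition conv_to :: "(nat \<Rightarrow> 'b) \<Rightarrow> 'b \<Rightarrow> bool"
  where "conv_to X l \<longleftrightarrow> range X \<subseteq> acarr B \<and> l \<in> acarr B \<and> (\<lambda>n. adst B (X n) l) \<longlonglongrightarrow> 0"

lemma conv_to_carr:
  assumes "conv_to X l"
  shows "X n \<in> acarr B" "l \<in> acarr B" "(\<lambda>n. adst B (X n) l) \<longlonglongrightarrow> 0"
  using assms unfolding conv_to_def by auto

lemma conv_toI: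
  assumes "\<And>n. X n \<in> acarr B" "l \<in> acarr B" "a \<longlonglongrightarrow> 0" "\<And>n. adst B (X n) l \<le> a n"
  shows "conv_to X l"
  unfolding conv_to_def
proof (intro conjI)
  show "(\<lambda>n. adst B (X n) l) \<longlonglongrightarrow> 0"
    by (rule tendsto_sandwich[OF _ _ tendsto_const assms(3)])
       (use assms dst_nonneg in auto)
qed (use assms in auto)

text \<open>By the quadrilateral inequality the distance changes by at most the sum of the distances
  to the two limits.\<close>

lemma conv_to_dst:
  assumes X: "conv_to X l" and Y: "conv_to Y m"
  shows "(\<lambda>n. adst B (X n) (Y n)) \<longlonglongrightarrow> adst B l m"
proof -
  note [simp] = conv_to_carr(1,2)[OF X] conv_to_carr(1,2)[OF Y]
  have "\<bar>adst B (X n) (Y n) - adst B l m\<bar> \<le> adst B (X n) l + adst B (Y n) m" for n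
  proof -
    have "adst B (X n) (Y n) \<le> adst B (X n) l + (adst B l m + adst B m (Y n))"
      using dst_triangle[of "X n" l "Y n"] dst_triangle[of l m "Y n"] by simp
    moreover have "adst B l m \<le> adst B l (X n) + (adst B (X n) (Y n) + adst B (Y n) m)"
      using dst_triangle[of l "X n" m] dst_triangle[of "X n" "Y n" m] by simp
    ultimately show ?thesis using dst_sym[of l "X n"] dst_sym[of m "Y n"] by simp
  qed
  moreover have "(\<lambda>n. adst B (X n) l + adst B (Y n) m) \<longlonglongrightarrow> 0"
    using tendsto_add[OF conv_to_carr(3)[OF X] conv_to_carr(3)[OF Y]] by simp
  ultimately have "(\<lambda>n. adst B (X n) (Y n) - adst B l m) \<longlonglongrightarrow> 0"
    by (intro metric_tendsto_imp_tendsto[of _ 0 sequentially "\<lambda>n. adst B (X n) (Y n) - adst B l m" 0])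
       (auto simp: dist_norm intro!: always_eventually order_trans[OF _ abs_ge_self])
  then show ?thesis by (simp add: LIM_zero_iff)
qed

text \<open>The distance of a sequence to itself is 0, and it also tends to the distance of the two
  limits.\<close>

lemma conv_to_unique:
  assumes "conv_to X l" "conv_to X m" shows "l = m"
proof -
  note c = conv_to_carr[OF assms(1)] conv_to_carr[OF assms(2)]
  have "(\<lambda>n. adst B (X n) (X n)) \<longlonglongrightarrow> adst B l m" using conv_to_dst[OF assms] .
  moreover have "adst B (X n) (X n) = 0" for n using dst_eq c by blast
  ultimately have "adst B l m = 0" by (simp add: LIMSEQ_const_iff)
  then show ?thesis using dst_eq c by blast
qed

lemma conv_to_const: "l \<in> acarr B \<Longrightarrow> conv_to (\<lambda>_. l) l"
  unfolding conv_to_def using dst_eq[of l l] by auto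

lemma conv_to_add:
  assumes X: "conv_to X l" and Y: "conv_to Y m"
  shows "conv_to (\<lambda>n. aadd B (X n) (Y n)) (aadd B l m)"
proof (rule conv_toI[where a="\<lambda>n. adst B (X n) l + adst B (Y n) m"])
  show "(\<lambda>n. adst B (X n) l + adst B (Y n) m) \<longlonglongrightarrow> 0"
    using tendsto_add[OF conv_to_carr(3)[OF X] conv_to_carr(3)[OF Y]] by simp
qed (use conv_to_carr[OF X] conv_to_carr[OF Y] add_closed dst_add in auto)

lemma conv_to_scl:
  assumes X: "conv_to X l"
  shows "conv_to (\<lambda>n. ascl B c (X n)) (ascl B c l)"
proof (rule conv_toI[where a="\<lambda>n. cmod c * adst B (X n) l"])
  show "(\<lambda>n. cmod c * adst B (X n) l) \<longlonglongrightarrow> 0"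
    using tendsto_mult_left[OF conv_to_carr(3)[OF X]] by simp
qed (use conv_to_carr[OF X] scl_closed dst_scl in auto)

lemma conv_to_star:
  assumes X: "conv_to X l"
  shows "conv_to (\<lambda>n. astar B (X n)) (astar B l)"
  by (rule conv_toI[OF _ _ conv_to_carr(3)[OF X]])
     (use conv_to_carr[OF X] star_closed dst_star in auto)

lemma conv_to_nrm:
  assumes X: "conv_to X l"
  shows "(\<lambda>n. anrm B (X n)) \<longlonglongrightarrow> anrm B l"
proof -
  have "(\<lambda>n. anrm B (X n) - anrm B l) \<longlonglongrightarrow> 0"
    by (rule Lim_null_comparison[OF _ conv_to_carr(3)[OF X]])
       (use conv_to_carr[OF X] dst_nrm in auto)
  then show ?thesis by (simp add: LIM_zero_iff)
qed

lemma conv_to_mul: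
  assumes X: "conv_to X l" and Y: "conv_to Y m"
  shows "conv_to (\<lambda>n. amul B (X n) (Y n)) (amul B l m)"
proof (rule conv_toI[where a="\<lambda>n. anrm B (X n) * adst B (Y n) m + adst B (X n) l * anrm B m"])
  \<comment> \<open>The factor \<open>anrm B (X n)\<close> varies with n, but it converges, so its
    product with a null sequence is null.\<close>
  show "(\<lambda>n. anrm B (X n) * adst B (Y n) m + adst B (X n) l * anrm B m) \<longlonglongrightarrow> 0"
    using tendsto_add[OF tendsto_mult[OF conv_to_nrm[OF X] conv_to_carr(3)[OF Y]]
        tendsto_mult_right[OF conv_to_carr(3)[OF X]], of "anrm B m"] by simp
qed (use conv_to_carr[OF X] conv_to_carr[OF Y] mul_closed dst_mul in auto)

lemma acauchy_iff_conv_to: "acauchy B X \<longleftrightarrow> (\<exists>l. conv_to X l)"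
proof
  assume "acauchy B X"
  then show "\<exists>l. conv_to X l"
    using complete[of X] unfolding acauchy_def conv_to_def by blast
next
  assume "\<exists>l. conv_to X l"
  then obtain l where l: "conv_to X l" by blast
  note c = conv_to_carr[OF l]
  show "acauchy B X"
    unfolding acauchy_def adst_def[symmetric]
  proof (intro conjI allI impI)
    fix e :: real assume "e > 0"
    then obtain N where N: "\<And>n. n \<ge> N \<Longrightarrow> adst B (X n) l < e/2"
      using order_tendstoD(2)[OF c(3), of "e/2"] by (auto simp: eventually_sequentially)
    have "adst B (X m) (X n) < e" if "m \<ge> N" "n \<ge> N" for m n
      using dst_triangle[of "X m" l "X n"] dst_sym[of l "X n"] N[OF that(1)] N[OF that(2)] c by auto
    then show "\<exists>N. \<forall>m\<ge>N. \<forall>n\<ge>N. adst B (X m) (X n) < e" by blast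
  qed (use c in auto)
qed

end

text \<open>The norm of \<open>A\<close> inherits its properties from that of \<open>B\<close>
  through \<open>h\<close>, so Cauchy sequences of \<open>A\<close> are exactly the sequences whose
  images converge in \<open>B\<close>.\<close>

locale isometric_star_map = complete_star_algebra B
  for B :: "'b star_algebra" +
  fixes A :: "'a star_algebra" and h :: "'a \<Rightarrow> 'b"
  assumes A_add: "x \<in> acarr A \<Longrightarrow> y \<in> acarr A \<Longrightarrow> aadd A x y \<in> acarr A"
    and A_scl: "x \<in> acarr A \<Longrightarrow> ascl A c x \<in> acarr A"
    and A_mul: "x \<in> acarr A \<Longrightarrow> y \<in> acarr A \<Longrightarrow> amul A x y \<in> acarr A"
    and A_star: "x \<in> acarr A \<Longrightarrow> astar A x \<in> acarr A"
    and linear: "star_linear A B h"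
    and isometric: "x \<in> acarr A \<Longrightarrow> anrm B (h x) = anrm A x"
begin

lemma h_carr: "x \<in> acarr A \<Longrightarrow> h x \<in> acarr B"
  using linear unfolding star_linear_def by blast

lemma h_add: "x \<in> acarr A \<Longrightarrow> y \<in> acarr A \<Longrightarrow> h (aadd A x y) = aadd B (h x) (h y)"
  and h_scl: "x \<in> acarr A \<Longrightarrow> h (ascl A c x) = ascl B c (h x)"
  and h_star: "x \<in> acarr A \<Longrightarrow> h (astar A x) = astar B (h x)"
  using linear unfolding star_linear_def by blast+

lemma h_dst:
  assumes "x \<in> acarr A" "y \<in> acarr A"
  shows "anrm A (adiff A x y) = adst B (h x) (h y)"
  unfolding adst_def adiff_def
  using assms by (metis A_add A_scl h_add h_scl isometric)

lemma acauchy_A: "acauchy A X \<longleftrightarrow> range X \<subseteq> acarr A \<and> (\<exists>l. conv_to (\<lambda>n. h (X n)) l)"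
proof -
  have "acauchy A X \<longleftrightarrow> range X \<subseteq> acarr A \<and> acauchy B (\<lambda>n. h (X n))"
    unfolding acauchy_def using h_dst[of "X _" "X _"] h_carr
    by (auto simp: adst_def image_subset_iff)
  then show ?thesis using acauchy_iff_conv_to by blast
qed

text \<open>The point of \<open>B\<close> that a Cauchy sequence of \<open>A\<close> stands
  for.\<close>

definition hlim :: "(nat \<Rightarrow> 'a) \<Rightarrow> 'b"
  where "hlim X = (THE l. conv_to (\<lambda>n. h (X n)) l)"

lemma hlim_eqI: "conv_to (\<lambda>n. h (X n)) l \<Longrightarrow> hlim X = l"
  unfolding hlim_def using conv_to_unique by blast

lemma conv_to_hlim: "acauchy A X \<Longrightarrow> conv_to (\<lambda>n. h (X n)) (hlim X)"
  using acauchy_A hlim_eqI by blast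

lemma acauchy_AI: "(\<And>n. X n \<in> acarr A) \<Longrightarrow> conv_to (\<lambda>n. h (X n)) l \<Longrightarrow> acauchy A X"
  unfolding acauchy_A by blast

lemma acauchy_carr: "acauchy A X \<Longrightarrow> X n \<in> acarr A"
  unfolding acauchy_def by blast

text \<open>The distances in \<open>A\<close> tend to the distance of the limits in
  \<open>B\<close>. Equivalence of Cauchy sequences thus becomes equality of points of
  \<open>B\<close>, and questions about chosen representatives become questions about
  \<open>hlim\<close>.\<close>

lemma aclass_eq:
  assumes X: "acauchy A X"
  shows "aclass A X = {Y. acauchy A Y \<and> hlim Y = hlim X}"
proof -
  have "(\<lambda>n. anrm A (adiff A (X n) (Y n))) \<longlonglongrightarrow> 0 \<longleftrightarrow> hlim Y = hlim X" if Y: "acauchy A Y" for Y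
  proof -
    have *: "(\<lambda>n. anrm A (adiff A (X n) (Y n))) \<longlonglongrightarrow> adst B (hlim X) (hlim Y)"
      using conv_to_dst[OF conv_to_hlim[OF X] conv_to_hlim[OF Y]]
      by (simp add: h_dst acauchy_carr[OF X] acauchy_carr[OF Y])
    have "adst B (hlim X) (hlim Y) = 0 \<longleftrightarrow> hlim X = hlim Y"
      using dst_eq conv_to_carr(2)[OF conv_to_hlim[OF X]] conv_to_carr(2)[OF conv_to_hlim[OF Y]] .
    moreover have "(\<lambda>n. anrm A (adiff A (X n) (Y n))) \<longlonglongrightarrow> 0 \<longleftrightarrow> adst B (hlim X) (hlim Y) = 0"
      using * LIMSEQ_unique[OF *] by metis
    ultimately show ?thesis by auto
  qed
  then show ?thesis unfolding aclass_def by blast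
qed

lemma rep_aclass:
  assumes "acauchy A X"
  shows "acauchy A (rep (aclass A X))" "hlim (rep (aclass A X)) = hlim X"
proof -
  have "rep (aclass A X) \<in> aclass A X"
    unfolding rep_def by (rule someI[of _ X]) (use assms in \<open>simp add: aclass_eq\<close>)
  then show "acauchy A (rep (aclass A X))" "hlim (rep (aclass A X)) = hlim X"
    unfolding aclass_eq[OF assms] by auto
qed

text \<open>\<open>rep C\<close> is an arbitrary member of the class; \<open>hlim\<close> is
  constant on classes, so the choice does not affect the value.\<close>

definition ext :: "(nat \<Rightarrow> 'a) set \<Rightarrow> 'b"
  where "ext C = hlim (rep C)"

lemma ext_aclass: "acauchy A X \<Longrightarrow> ext (aclass A X) = hlim X"
  unfolding ext_def by (rule rep_aclass)

lemma hlim_closure: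
  assumes "acauchy A X" shows "hlim X \<in> norm_closure B (h ` acarr A)"
  unfolding norm_closure_def
proof (intro CollectI conjI allI impI)
  note c = conv_to_carr[OF conv_to_hlim[OF assms]]
  show "hlim X \<in> acarr B" by (rule c)
  fix e :: real assume "e > 0"
  then obtain n where "adst B (h (X n)) (hlim X) < e"
    using order_tendstoD(2)[OF c(3), of e] by (auto simp: eventually_sequentially)
  then show "\<exists>y\<in>h ` acarr A. anrm B (adiff B (hlim X) y) < e"
    using dst_sym[OF c(2) c(1)[of n]] acauchy_carr[OF assms, of n]
    by (intro bexI[of _ "h (X n)"]) (auto simp: adst_def)
qed

lemma closure_hlim:
  assumes "l \<in> norm_closure B (h ` acarr A)"
  shows "\<exists>X. acauchy A X \<and> hlim X = l"
proof -
  have l: "l \<in> acarr B" and *: "\<And>e. 0 < e \<Longrightarrow> \<exists>x. x \<in> acarr A \<and> adst B l (h x) < e"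
    using assms unfolding norm_closure_def adst_def by auto
  \<comment> \<open>The radii 1/(n+1) turn membership in the closure into a sequence converging to
    \<open>l\<close>.\<close>
  have "\<forall>n. \<exists>x. x \<in> acarr A \<and> adst B l (h x) < inverse (real (Suc n))"
    by (intro allI *) simp
  then obtain X where X: "\<And>n. X n \<in> acarr A" "\<And>n. adst B l (h (X n)) < inverse (real (Suc n))"
    by (auto simp only: choice_iff)
  have "conv_to (\<lambda>n. h (X n)) l"
  proof (rule conv_toI[OF _ l LIMSEQ_inverse_real_of_nat])
    fix n
    show "h (X n) \<in> acarr B" by (rule h_carr[OF X(1)])
    then have "adst B (h (X n)) l = adst B l (h (X n))" by (intro dst_sym l)
    then show "adst B (h (X n)) l \<le> inverse (real (Suc n))"
      by (rule ord_eq_le_trans[OF _ less_imp_le[OF X(2)]])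
  qed
  then show ?thesis using acauchy_AI X(1) hlim_eqI by blast
qed

lemma completion_carr: "C \<in> acarr (completion A) \<Longrightarrow> acauchy A (rep C)"
  unfolding completion_def using rep_aclass by auto

text \<open>Needed for injectivity of \<open>ext\<close>: a class is recovered from its chosen
  representative, hence from the limit of that representative.\<close>

lemma aclass_rep: "C \<in> acarr (completion A) \<Longrightarrow> aclass A (rep C) = C"
proof -
  assume "C \<in> acarr (completion A)"
  then obtain X where X: "acauchy A X" "C = aclass A X" by (auto simp: completion_def)
  have "aclass A (rep C) = {Y. acauchy A Y \<and> hlim Y = hlim X}"
    using aclass_eq[OF rep_aclass(1)[OF X(1)]] rep_aclass(2)[OF X(1)] by (simp only: X(2))
  also have "\<dots> = C"
    using aclass_eq[OF X(1)] by (simp only: X(2))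
  finally show ?thesis .
qed

lemma ext_isometric_bij:
  "isometric_bij (completion A) (closure_alg B (h ` acarr A)) ext"
  unfolding isometric_bij_def bij_betw_def
proof (intro conjI ballI)
  show "inj_on ext (acarr (completion A))"
  proof (rule inj_onI)
    fix C D assume C: "C \<in> acarr (completion A)" and D: "D \<in> acarr (completion A)" and "ext C = ext D"
    then have "aclass A (rep C) = aclass A (rep D)"
      using completion_carr[OF C] completion_carr[OF D] by (simp add: aclass_eq ext_def)
    then show "C = D" by (simp add: aclass_rep C D)
  qed
  show "ext ` acarr (completion A) = acarr (closure_alg B (h ` acarr A))"
  proof (intro set_eqI iffI)
    fix l assume "l \<in> acarr (closure_alg B (h ` acarr A))"
    then obtain X where "acauchy A X" "hlim X = l"
      using closure_hlim by (auto simp: closure_alg_def)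
    moreover from this have "aclass A X \<in> acarr (completion A)" by (simp add: completion_def)
    ultimately show "l \<in> ext ` acarr (completion A)"
      using ext_aclass by (metis image_eqI)
  next
    fix l assume "l \<in> ext ` acarr (completion A)"
    then show "l \<in> acarr (closure_alg B (h ` acarr A))"
      using hlim_closure completion_carr by (auto simp: closure_alg_def ext_def)
  qed
  fix C assume "C \<in> acarr (completion A)"
  then have C: "acauchy A (rep C)" using completion_carr by blast
  \<comment> \<open>The norm of the completion is a \<open>lim\<close>, which is informative only
    once convergence is known; isometry of \<open>h\<close> and continuity of the norm of
    \<open>B\<close> provide it.\<close>
  have "(\<lambda>n. anrm A (rep C n)) \<longlonglongrightarrow> anrm B (ext C)"
    using conv_to_nrm[OF conv_to_hlim[OF C]] isometric acauchy_carr[OF C] by (simp add: ext_def)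
  then show "anrm (closure_alg B (h ` acarr A)) (ext C) = anrm (completion A) C"
    by (simp add: closure_alg_def completion_def limI)
qed

lemma conv_to_ext: "C \<in> acarr (completion A) \<Longrightarrow> conv_to (\<lambda>n. h (rep C n)) (ext C)"
  unfolding ext_def by (rule conv_to_hlim[OF completion_carr])

text \<open>The operations of the completion are classes of termwise results, so each identity for
  \<open>ext\<close> amounts to the convergence of one sequence in \<open>B\<close>.\<close>

lemma ext_eqI:
  assumes "\<And>n. X n \<in> acarr A" "conv_to (\<lambda>n. h (X n)) l"
  shows "ext (aclass A X) = l"
  using ext_aclass[OF acauchy_AI[OF assms]] hlim_eqI[OF assms(2)] by simp

lemma ext_star_linear:
  "star_linear (completion A) (closure_alg B (h ` acarr A)) ext"
proof -
  have "ext \<in> acarr (completion A) \<rightarrow> acarr (closure_alg B (h ` acarr A))"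
    using ext_isometric_bij bij_betw_imp_funcset unfolding isometric_bij_def by metis
  moreover have "ext (aadd (completion A) x y) = aadd B (ext x) (ext y)"
    if "x \<in> acarr (completion A)" "y \<in> acarr (completion A)" for x y
    using ext_eqI[of "\<lambda>n. aadd A (rep x n) (rep y n)" "aadd B (ext x) (ext y)"]
      conv_to_add[OF conv_to_ext[OF that(1)] conv_to_ext[OF that(2)]]
      acauchy_carr[OF completion_carr[OF that(1)]] acauchy_carr[OF completion_carr[OF that(2)]]
    by (simp add: completion_def h_add A_add)
  moreover have "ext (ascl (completion A) k x) = ascl B k (ext x)"
    if "x \<in> acarr (completion A)" for x k
    using ext_eqI[of "\<lambda>n. ascl A k (rep x n)" "ascl B k (ext x)"]
      conv_to_scl[OF conv_to_ext[OF that]] acauchy_carr[OF completion_carr[OF that]]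
    by (simp add: completion_def h_scl A_scl)
  moreover have "ext (astar (completion A) x) = astar B (ext x)"
    if "x \<in> acarr (completion A)" for x
    using ext_eqI[of "\<lambda>n. astar A (rep x n)" "astar B (ext x)"]
      conv_to_star[OF conv_to_ext[OF that]] acauchy_carr[OF completion_carr[OF that]]
    by (simp add: completion_def h_star A_star)
  ultimately show ?thesis unfolding star_linear_def by (simp add: closure_alg_def)
qed

lemma ext_star_iso:
  assumes "star_hom A B h"
  shows "star_iso (completion A) (closure_alg B (h ` acarr A)) ext"
proof -
  have "ext (amul (completion A) x y) = amul B (ext x) (ext y)"
    if "x \<in> acarr (completion A)" "y \<in> acarr (completion A)" for x y
    using ext_eqI[of "\<lambda>n. amul A (rep x n) (rep y n)" "amul B (ext x) (ext y)"]
      conv_to_mul[OF conv_to_ext[OF that(1)] conv_to_ext[OF that(2)]]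
      acauchy_carr[OF completion_carr[OF that(1)]] acauchy_carr[OF completion_carr[OF that(2)]] assms
    by (simp add: completion_def star_hom_def A_mul)
  then show ?thesis
    using ext_star_linear ext_isometric_bij unfolding star_iso_def star_hom_def
    by (simp add: closure_alg_def)
qed

lemma ext_star_antiiso:
  assumes "star_antihom A B h"
  shows "star_antiiso (completion A) (closure_alg B (h ` acarr A)) ext"
proof -
  have "ext (amul (completion A) x y) = amul B (ext y) (ext x)"
    if "x \<in> acarr (completion A)" "y \<in> acarr (completion A)" for x y
    using ext_eqI[of "\<lambda>n. amul A (rep x n) (rep y n)" "amul B (ext y) (ext x)"]
      conv_to_mul[OF conv_to_ext[OF that(2)] conv_to_ext[OF that(1)]]
      acauchy_carr[OF completion_carr[OF that(1)]] acauchy_carr[OF completion_carr[OF that(2)]] assms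
    by (simp add: completion_def star_antihom_def A_mul)
  then show ?thesis
    using ext_star_linear ext_isometric_bij unfolding star_antiiso_def star_antihom_def
    by (simp add: closure_alg_def)
qed

lemma ext_embed: "x \<in> acarr A \<Longrightarrow> ext (completion_embed A x) = h x"
  unfolding completion_embed_def by (intro ext_eqI conv_to_const h_carr)

end

section \<open>Adjointable operators on modules with fibrewise inner products\<close>

text \<open>Definiteness is left out on purpose: the locale is applied to square integrable
  functions before null functions are divided out, and to a module at a single unit, where nonzero
  elements may vanish.\<close>

locale semi_inner =
  fixes V :: "'v set" and add :: "'v \<Rightarrow> 'v \<Rightarrow> 'v" and scl :: "complex \<Rightarrow> 'v \<Rightarrow> 'v"
    and ip :: "'v \<Rightarrow> 'v \<Rightarrow> complex"
  assumes V_add: "x \<in> V \<Longrightarrow> y \<in> V \<Longrightarrow> add x y \<in> V"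
    and V_scl: "x \<in> V \<Longrightarrow> scl c x \<in> V"
    and ip_add: "x \<in> V \<Longrightarrow> y \<in> V \<Longrightarrow> z \<in> V \<Longrightarrow> ip z (add x y) = ip z x + ip z y"
    and ip_scl: "x \<in> V \<Longrightarrow> z \<in> V \<Longrightarrow> ip z (scl c x) = c * ip z x"
    and ip_cnj: "x \<in> V \<Longrightarrow> y \<in> V \<Longrightarrow> ip y x = cnj (ip x y)"
    and ip_nonneg: "x \<in> V \<Longrightarrow> 0 \<le> Re (ip x x)"
begin

lemma ip_add_left: "x \<in> V \<Longrightarrow> y \<in> V \<Longrightarrow> z \<in> V \<Longrightarrow> ip (add x y) z = ip x z + ip y z"
  using ip_cnj[of z "add x y"] ip_cnj[of z x] ip_cnj[of z y] V_add ip_add by simp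

lemma ip_scl_left: "x \<in> V \<Longrightarrow> z \<in> V \<Longrightarrow> ip (scl c x) z = cnj c * ip x z"
  using ip_cnj[of z "scl c x"] ip_cnj[of z x] V_scl ip_scl by simp

definition nv :: "'v \<Rightarrow> real" where "nv x = sqrt (Re (ip x x))"

lemma nv_nonneg: "x \<in> V \<Longrightarrow> 0 \<le> nv x"
  and nv_sq: "x \<in> V \<Longrightarrow> (nv x)\<^sup>2 = Re (ip x x)"
  using ip_nonneg unfolding nv_def by auto

lemma nv_scl: "x \<in> V \<Longrightarrow> nv (scl c x) = cmod c * nv x"
proof -
  assume x: "x \<in> V"
  have "ip (scl c x) (scl c x) = of_real ((cmod c)\<^sup>2) * ip x x"
    using x by (simp add: ip_scl ip_scl_left V_scl complex_norm_square[symmetric] mult.assoc[symmetric])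
  then have "Re (ip (scl c x) (scl c x)) = (cmod c)\<^sup>2 * Re (ip x x)" by simp
  then show ?thesis unfolding nv_def by (simp add: real_sqrt_mult)
qed

text \<open>The form is nonnegative at y - t b x with b = \<open>ip x y\<close> and t real. For a >
  0 the best choice is t = 1/a; for a = 0 the expression is affine in t, which forces b = 0.\<close>

lemma cauchy_schwarz:
  assumes x: "x \<in> V" and y: "y \<in> V"
  shows "cmod (ip x y) \<le> nv x * nv y"
proof -
  define a b c where "a = Re (ip x x)" and "b = ip x y" and "c = Re (ip y y)"
  have ac: "0 \<le> a" "0 \<le> c" using ip_nonneg x y by (auto simp: a_def c_def)
  have im: "ip x x = of_real a"
    using ip_cnj[OF x x] unfolding a_def by (simp add: complex_eq_iff)
  have pos: "0 \<le> c - 2 * t * (cmod b)\<^sup>2 + t\<^sup>2 * (cmod b)\<^sup>2 * a" for t :: real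
  proof -
    let ?z = "add y (scl (- of_real t * b) x)"
    have z: "?z \<in> V" "scl (- of_real t * b) x \<in> V" using x y V_add V_scl by auto
    have "ip ?z ?z = ip y y + (- of_real t * b) * ip y x
        + (cnj (- of_real t * b) * ip x y + cnj (- of_real t * b) * ((- of_real t * b) * ip x x))"
      using x y z by (simp add: ip_add ip_add_left ip_scl ip_scl_left algebra_simps)
    also have "ip y x = cnj b" using ip_cnj[OF x y] b_def by simp
    also have "ip y y + (- of_real t * b) * cnj b
        + (cnj (- of_real t * b) * ip x y + cnj (- of_real t * b) * ((- of_real t * b) * ip x x))
      = ip y y - 2 * of_real t * (b * cnj b) + (of_real t)\<^sup>2 * (b * cnj b) * of_real a"
      unfolding im b_def[symmetric] by (simp add: algebra_simps power2_eq_square)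
    also have "b * cnj b = of_real ((cmod b)\<^sup>2)" by (simp only: complex_norm_square)
    finally have "Re (ip ?z ?z) = c - 2 * t * (cmod b)\<^sup>2 + t\<^sup>2 * (cmod b)\<^sup>2 * a"
      unfolding c_def by (simp flip: of_real_power of_real_mult)
    then show ?thesis using ip_nonneg[OF z(1)] by simp
  qed
  have "(cmod b)\<^sup>2 \<le> a * c"
  proof (cases "a = 0")
    case True
    have "cmod b = 0"
    proof (rule ccontr)
      assume "cmod b \<noteq> 0"
      \<comment> \<open>At this \<open>t\<close> the right side of \<open>pos\<close> would be
        -1.\<close>
      then have "2 * ((c + 1) / (2 * (cmod b)\<^sup>2)) * (cmod b)\<^sup>2 = c + 1" by simp
      then show False using pos[of "(c + 1) / (2 * (cmod b)\<^sup>2)"] True by simp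
    qed
    then show ?thesis using ac by simp
  next
    case False
    then have "0 < a" using ac by simp
    have "0 \<le> c - 2 * (1 / a) * (cmod b)\<^sup>2 + (1 / a)\<^sup>2 * (cmod b)\<^sup>2 * a" by (rule pos)
    also have "\<dots> = c - (cmod b)\<^sup>2 / a"
      using \<open>0 < a\<close> by (simp add: power2_eq_square field_simps)
    finally show ?thesis using \<open>0 < a\<close> by (simp add: field_simps)
  qed
  then have "cmod b \<le> sqrt (a * c)" by (rule real_le_rsqrt)
  then show ?thesis unfolding nv_def a_def b_def c_def real_sqrt_mult .
qed

lemma nv_add: "x \<in> V \<Longrightarrow> y \<in> V \<Longrightarrow> nv (add x y) \<le> nv x + nv y"
proof -
  assume x: "x \<in> V" and y: "y \<in> V"
  have "(nv (add x y))\<^sup>2 = Re (ip x x) + Re (ip y y) + (Re (ip x y) + Re (ip y x))"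
    using x y by (simp add: nv_sq V_add ip_add ip_add_left)
  also have "\<dots> \<le> (nv x)\<^sup>2 + (nv y)\<^sup>2 + 2 * (nv x * nv y)"
    using cauchy_schwarz[OF x y] cauchy_schwarz[OF y x] complex_Re_le_cmod[of "ip x y"]
      complex_Re_le_cmod[of "ip y x"] nv_sq[OF x] nv_sq[OF y] by (simp add: mult.commute)
  also have "\<dots> = (nv x + nv y)\<^sup>2" by (simp add: power2_sum)
  finally show ?thesis by (rule power2_le_imp_le) (use nv_nonneg x y in simp)
qed

end

text \<open>The coefficients are functions on \<open>U\<close>, so evaluation at each point reduces
  the theory of Hilbert modules to scalar semi-inner products and suprema.
  \<open>nondegenerate\<close> stands in for the module axioms: an identity between elements, such
  as a rearrangement of sums, is checked by taking inner products with all elements.\<close>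

locale pointwise_hilbert_module =
  fixes E :: "('e, 'u \<Rightarrow> complex) hilbert_module" and U :: "'u set"
  assumes U_ne: "U \<noteq> {}"
    and carr_ne: "hcarr E \<noteq> {}"
    and act_closed: "x \<in> hcarr E \<Longrightarrow> b \<in> hcoef E \<Longrightarrow> hact E x b \<in> hcarr E"
    and inner_act: "x \<in> hcarr E \<Longrightarrow> z \<in> hcarr E \<Longrightarrow> b \<in> hcoef E \<Longrightarrow> u \<in> U \<Longrightarrow>
          hinner E z (hact E x b) u = hinner E z x u * b u"
    and semi_inner: "u \<in> U \<Longrightarrow> semi_inner (hcarr E) (hadd E) (hscl E) (\<lambda>x y. hinner E x y u)"
    and inner_extensional: "x \<in> hcarr E \<Longrightarrow> y \<in> hcarr E \<Longrightarrow> hinner E x y \<in> extensional U"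
    and nondegenerate: "x \<in> hcarr E \<Longrightarrow> y \<in> hcarr E \<Longrightarrow>
          (\<And>z u. z \<in> hcarr E \<Longrightarrow> u \<in> U \<Longrightarrow> hinner E z x u = hinner E z y u) \<Longrightarrow> x = y"
    and nrm_bdd: "x \<in> hcarr E \<Longrightarrow> bdd_above ((\<lambda>u. sqrt (Re (hinner E x x u))) ` U)"
    and nrm_eq: "x \<in> hcarr E \<Longrightarrow> hnrm E x = (SUP u\<in>U. sqrt (Re (hinner E x x u)))"
    and nrm_complete: "(\<And>n. X n \<in> hcarr E) \<Longrightarrow>
          (\<And>e. e > 0 \<Longrightarrow> \<exists>N. \<forall>m\<ge>N. \<forall>n\<ge>N. hnrm E (hadd E (X m) (hscl E (-1) (X n))) < e) \<Longrightarrow>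
          \<exists>l\<in>hcarr E. (\<lambda>n. hnrm E (hadd E (X n) (hscl E (-1) l))) \<longlonglongrightarrow> 0"
begin

abbreviation "H \<equiv> hcarr E"
abbreviation "L \<equiv> adj_ops E"
abbreviation "dst \<equiv> adst L"
abbreviation "fn u x \<equiv> sqrt (Re (hinner E x x u))"
abbreviation "sub x y \<equiv> hadd E x (hscl E (-1) y)"

lemmas inner_add = semi_inner.ip_add[OF semi_inner]
  and inner_scl = semi_inner.ip_scl[OF semi_inner]
  and inner_add_left = semi_inner.ip_add_left[OF semi_inner]
  and inner_scl_left = semi_inner.ip_scl_left[OF semi_inner]
  and inner_cnj = semi_inner.ip_cnj[OF semi_inner]
  and inner_nonneg = semi_inner.ip_nonneg[OF semi_inner]

lemma add_closed: "x \<in> H \<Longrightarrow> y \<in> H \<Longrightarrow> hadd E x y \<in> H"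
  and scl_closed: "x \<in> H \<Longrightarrow> hscl E c x \<in> H"
proof -
  obtain u where "u \<in> U" using U_ne by blast
  then interpret semi_inner "H" "hadd E" "hscl E" "\<lambda>x y. hinner E x y u" by (rule semi_inner)
  show "x \<in> H \<Longrightarrow> y \<in> H \<Longrightarrow> hadd E x y \<in> H"
    "x \<in> H \<Longrightarrow> hscl E c x \<in> H"
    by (fact V_add, fact V_scl)
qed

lemmas closed = add_closed scl_closed

lemma fn_le_nrm: "x \<in> H \<Longrightarrow> u \<in> U \<Longrightarrow> fn u x \<le> hnrm E x"
  unfolding nrm_eq by (rule cSUP_upper[OF _ nrm_bdd])

lemma nrm_le: "x \<in> H \<Longrightarrow> (\<And>u. u \<in> U \<Longrightarrow> fn u x \<le> c) \<Longrightarrow> hnrm E x \<le> c"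
  unfolding nrm_eq by (rule cSUP_least[OF U_ne])

lemma nrm_nonneg: "x \<in> H \<Longrightarrow> 0 \<le> hnrm E x"
  using U_ne fn_le_nrm inner_nonneg by (meson all_not_in_conv order_trans real_sqrt_ge_zero)

lemma nrm_add: "x \<in> H \<Longrightarrow> y \<in> H \<Longrightarrow> hnrm E (hadd E x y) \<le> hnrm E x + hnrm E y"
proof (intro nrm_le closed)
  fix u assume a: "x \<in> H" "y \<in> H" "u \<in> U"
  interpret semi_inner "H" "hadd E" "hscl E" "\<lambda>x y. hinner E x y u" by (rule semi_inner[OF a(3)])
  show "fn u (hadd E x y) \<le> hnrm E x + hnrm E y"
    using nv_add[OF a(1,2)] fn_le_nrm[OF a(1,3)] fn_le_nrm[OF a(2,3)] unfolding nv_def by linarith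
qed

lemma nrm_scl_le: "x \<in> H \<Longrightarrow> hnrm E (hscl E c x) \<le> cmod c * hnrm E x"
proof (intro nrm_le closed)
  fix u assume a: "x \<in> H" "u \<in> U"
  interpret semi_inner "H" "hadd E" "hscl E" "\<lambda>x y. hinner E x y u" by (rule semi_inner[OF a(2)])
  show "fn u (hscl E c x) \<le> cmod c * hnrm E x"
    using nv_scl[OF a(1), of c] fn_le_nrm[OF a(1,2)] unfolding nv_def by (simp add: mult_left_mono)
qed

lemma inner_le:
  assumes "x \<in> H" "y \<in> H" "u \<in> U"
  shows "cmod (hinner E x y u) \<le> hnrm E x * hnrm E y"
proof -
  interpret semi_inner "H" "hadd E" "hscl E" "\<lambda>x y. hinner E x y u" by (rule semi_inner[OF assms(3)])
  show ?thesis
    using cauchy_schwarz[OF assms(1,2)] unfolding nv_def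
    by (rule order_trans) (intro mult_mono fn_le_nrm assms nrm_nonneg real_sqrt_ge_zero inner_nonneg)
qed

lemma hinner_eqI:
  assumes "x \<in> H" "y \<in> H" "x' \<in> H" "y' \<in> H"
    "\<And>u. u \<in> U \<Longrightarrow> hinner E x y u = hinner E x' y' u"
  shows "hinner E x y = hinner E x' y'"
  by (rule extensionalityI[OF inner_extensional inner_extensional]) (use assms in auto)

lemma nrm_zero_inner: "x \<in> H \<Longrightarrow> z \<in> H \<Longrightarrow> u \<in> U \<Longrightarrow> hnrm E x = 0 \<Longrightarrow> hinner E z x u = 0"
  using inner_le[of z x u] by simp

lemma sub_eq:
  assumes "x \<in> H" "y \<in> H" "hnrm E (sub x y) = 0"
  shows "x = y"
proof (rule nondegenerate[OF assms(1,2)])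
  fix z u assume a: "z \<in> H" "u \<in> U"
  show "hinner E z x u = hinner E z y u"
    using nrm_zero_inner[OF _ a assms(3)] assms a by (simp add: closed inner_add inner_scl)
qed

lemma nrm_sub_self: "x \<in> H \<Longrightarrow> hnrm E (sub x x) = 0"
  by (intro antisym nrm_le nrm_nonneg closed)
     (auto simp: closed inner_add inner_scl)

lemma nrm_sub_commute: "x \<in> H \<Longrightarrow> y \<in> H \<Longrightarrow> hnrm E (sub x y) = hnrm E (sub y x)"
proof -
  have *: "hnrm E (sub x y) \<le> hnrm E (sub y x)" if xy: "x \<in> H" "y \<in> H" for x y
  proof -
    have "sub x y = hscl E (-1) (sub y x)"
      by (rule nondegenerate) (use xy in \<open>auto simp: closed inner_add inner_scl\<close>)
    then show ?thesis using nrm_scl_le[of "sub y x" "-1"] xy by (simp add: closed)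
  qed
  assume "x \<in> H" "y \<in> H"
  then show ?thesis using * by (intro antisym)
qed

lemma nrm_sub_triangle:
  assumes "x \<in> H" "y \<in> H" "z \<in> H"
  shows "hnrm E (sub x z) \<le> hnrm E (sub x y) + hnrm E (sub y z)"
proof -
  have "sub x z = hadd E (sub x y) (sub y z)"
    by (rule nondegenerate) (use assms in \<open>auto simp: closed inner_add inner_scl\<close>)
  then show ?thesis using nrm_add[of "sub x y" "sub y z"] assms by (simp add: closed)
qed

lemma nrm_le_sub:
  assumes "x \<in> H" "y \<in> H"
  shows "hnrm E x \<le> hnrm E (sub x y) + hnrm E y"
proof -
  have "hadd E (sub x y) y = x"
    by (rule nondegenerate) (use assms in \<open>auto simp: closed inner_add inner_scl\<close>)
  then show ?thesis using nrm_add[of "sub x y" y] assms by (simp add: closed)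
qed

lemma adjoint_PiE: "is_adjoint E T S \<Longrightarrow> S \<in> H \<rightarrow>\<^sub>E H"
  by (simp only: is_adjoint_def)

lemma adjoint_inner:
  assumes "is_adjoint E T S" "x \<in> H" "y \<in> H"
  shows "hinner E (T x) y = hinner E x (S y)"
  by (rule assms(1)[unfolded is_adjoint_def, THEN conjunct2, rule_format, OF assms(2,3)])

lemma is_adjoint_sym:
  assumes T: "T \<in> H \<rightarrow>\<^sub>E H" and a: "is_adjoint E T S"
  shows "is_adjoint E S T"
  unfolding is_adjoint_def
proof (intro conjI ballI)
  show "T \<in> H \<rightarrow>\<^sub>E H" by (rule T)
next
  fix x y assume xy: "x \<in> H" "y \<in> H"
  have S: "S x \<in> H" "T y \<in> H"
    using PiE_mem[OF adjoint_PiE[OF a] xy(1)] PiE_mem[OF T xy(2)] by auto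
  show "hinner E (S x) y = hinner E x (T y)"
  proof (rule hinner_eqI[OF S(1) xy(2) xy(1) S(2)])
    fix u assume u: "u \<in> U"
    have "hinner E (S x) y u = cnj (hinner E y (S x) u)" by (rule inner_cnj[OF u xy(2) S(1)])
    then show "hinner E (S x) y u = hinner E x (T y) u"
      by (simp only: adjoint_inner[OF a xy(2,1), symmetric] inner_cnj[OF u S(2) xy(1)])
  qed
qed

lemma is_adjoint_unique:
  assumes "is_adjoint E T S" "is_adjoint E T S'"
  shows "S = S'"
proof (rule extensionalityI[of _ "H"])
  have S: "S \<in> H \<rightarrow>\<^sub>E H" "S' \<in> H \<rightarrow>\<^sub>E H"
    using assms adjoint_PiE by auto
  then show "S \<in> extensional (H)" "S' \<in> extensional (H)" by (auto simp: PiE_def)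
  fix x assume x: "x \<in> H"
  show "S x = S' x"
  proof (rule nondegenerate)
    fix z u assume "z \<in> H" "u \<in> U"
    then show "hinner E z (S x) u = hinner E z (S' x) u"
      using adjoint_inner[OF assms(1) _ x, of z] adjoint_inner[OF assms(2) _ x, of z] by simp
  qed (use S x in auto)
qed

text \<open>Inside an inner product \<open>T\<close> can be moved to the other side as
  \<open>S\<close>, which frees its argument; sums, scalars and coefficients then pull out, and
  nondegeneracy returns the identity for \<open>T\<close>.\<close>

lemma adjointableI:
  assumes T: "T \<in> H \<rightarrow>\<^sub>E H" and a: "is_adjoint E T S"
    and bd: "\<And>x. x \<in> H \<Longrightarrow> hnrm E (T x) \<le> C * hnrm E x"
  shows "T \<in> adjointable E"
proof -
  have S: "S \<in> H \<rightarrow>\<^sub>E H" using a unfolding is_adjoint_def by simp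
  have mv: "hinner E z (T x) u = hinner E (S z) x u" if "z \<in> H" "x \<in> H" for z x u
    using adjoint_inner[OF is_adjoint_sym[OF T a] that] by simp
  note c = PiE_mem[OF T] PiE_mem[OF S] closed
  show ?thesis
    unfolding adjointable_def
  proof (intro CollectI conjI allI ballI T)
    fix x y assume xy: "x \<in> H" "y \<in> H"
    show "T (hadd E x y) = hadd E (T x) (T y)"
      by (rule nondegenerate) (use xy in \<open>simp_all add: c mv inner_add\<close>)
  next
    fix k x assume x: "x \<in> H"
    show "T (hscl E k x) = hscl E k (T x)"
      by (rule nondegenerate) (use x in \<open>simp_all add: c mv inner_scl\<close>)
  next
    fix x b assume x: "x \<in> H" "b \<in> hcoef E"
    show "T (hact E x b) = hact E (T x) b"
      by (rule nondegenerate) (use x in \<open>simp_all add: c mv inner_act act_closed\<close>)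
  qed (use a bd in blast)+
qed

section \<open>Operator norms and norms of adjoints\<close>

abbreviation "opn T \<equiv> anrm L T"

lemma opn_eq: "opn T = (SUP x\<in>{x \<in> H. hnrm E x \<le> 1}. hnrm E (T x))"
  by (simp add: adj_ops_def)

text \<open>The record names no zero vector; x - x takes its place.\<close>

lemma unit_ball_ne: "{x \<in> H. hnrm E x \<le> 1} \<noteq> {}"
proof -
  obtain x where x: "x \<in> H" using carr_ne by blast
  then have "sub x x \<in> {x \<in> H. hnrm E x \<le> 1}"
    using nrm_sub_self[OF x] by (simp add: closed)
  then show ?thesis by blast
qed

lemma opn_le:
  assumes "c \<ge> 0" "\<And>x. x \<in> H \<Longrightarrow> hnrm E (T x) \<le> c * hnrm E x"
  shows "opn T \<le> c"
  unfolding opn_eq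
proof (rule cSUP_least[OF unit_ball_ne])
  fix x assume "x \<in> {x \<in> H. hnrm E x \<le> 1}"
  then show "hnrm E (T x) \<le> c"
    using assms(2)[of x] mult_left_mono[of "hnrm E x" 1 c] assms(1) by auto
qed

context
  fixes T assumes T: "T \<in> adjointable E"
begin

lemma adj_carr: "x \<in> H \<Longrightarrow> T x \<in> H"
  and adj_PiE: "T \<in> H \<rightarrow>\<^sub>E H"
  using T unfolding adjointable_def by auto

lemma adj_add: "x \<in> H \<Longrightarrow> y \<in> H \<Longrightarrow> T (hadd E x y) = hadd E (T x) (T y)"
  and adj_scl: "x \<in> H \<Longrightarrow> T (hscl E k x) = hscl E k (T x)"
  and adj_act: "x \<in> H \<Longrightarrow> b \<in> hcoef E \<Longrightarrow> T (hact E x b) = hact E (T x) b"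
  using T unfolding adjointable_def by auto

lemma adj_sub: "x \<in> H \<Longrightarrow> y \<in> H \<Longrightarrow> T (sub x y) = sub (T x) (T y)"
  by (simp add: adj_add adj_scl closed)

lemma opn_upper:
  assumes x: "x \<in> H" and "hnrm E x \<le> 1"
  shows "hnrm E (T x) \<le> opn T"
proof -
  obtain C where C: "\<And>x. x \<in> H \<Longrightarrow> hnrm E (T x) \<le> C * hnrm E x"
    using T unfolding adjointable_def by blast
  have "hnrm E (T x) \<le> \<bar>C\<bar>" if "x \<in> H" "hnrm E x \<le> 1" for x
    using C[OF that(1)] mult_right_mono[OF abs_ge_self nrm_nonneg[OF that(1)], of C]
      mult_left_mono[OF that(2), of "\<bar>C\<bar>"] by auto
  then have "bdd_above ((\<lambda>x. hnrm E (T x)) ` {x \<in> H. hnrm E x \<le> 1})"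
    by (auto intro!: bdd_aboveI2[where M="\<bar>C\<bar>"])
  then show ?thesis unfolding opn_eq by (rule cSUP_upper2) (use assms in auto)
qed

lemma opn_nonneg: "0 \<le> opn T"
proof -
  obtain x where "x \<in> H" "hnrm E x \<le> 1" using unit_ball_ne by blast
  then show ?thesis using opn_upper[of x] nrm_nonneg[OF adj_carr] by force
qed

lemma opn_bound:
  assumes x: "x \<in> H"
  shows "hnrm E (T x) \<le> opn T * hnrm E x"
proof (cases "hnrm E x = 0")
  \<comment> \<open>This \<open>x\<close> cannot be normalised, but any bound for \<open>T\<close>
    already gives norm 0 for \<open>T x\<close>.\<close>
  case True
  obtain C where "hnrm E (T x) \<le> C * hnrm E x"
    using T x unfolding adjointable_def by auto
  then show ?thesis using True by simp
next
  case False
  then have r: "hnrm E x > 0" using nrm_nonneg[OF x] by simp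
  let ?y = "hscl E (of_real (1 / hnrm E x)) x"
  have y: "?y \<in> H" using x closed by simp
  have x': "hscl E (of_real (hnrm E x)) ?y = x"
    by (rule nondegenerate[OF _ x]) (use x r closed in \<open>auto simp: inner_scl\<close>)
  have "hnrm E ?y \<le> 1" using nrm_scl_le[OF x, of "of_real (1 / hnrm E x)"] r
    by (simp add: norm_divide)
  then have "hnrm E (T ?y) \<le> opn T" by (rule opn_upper[OF y])
  then have "hnrm E (hscl E (of_real (hnrm E x)) (T ?y)) \<le> hnrm E x * opn T"
    using nrm_scl_le[OF adj_carr[OF y], of "of_real (hnrm E x)"] r
    by (auto intro: order_trans mult_left_mono)
  then show ?thesis using x' adj_scl[OF y, of "of_real (hnrm E x)"] by (simp add: mult.commute)
qed

lemma is_adjoint_astar: "is_adjoint E T (astar L T)"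
proof -
  obtain S where S: "is_adjoint E T S" using T unfolding adjointable_def by auto
  then have "\<exists>!S. is_adjoint E T S" using is_adjoint_unique by blast
  then show ?thesis unfolding adj_ops_def by (simp add: theI')
qed

lemma astar_eqI: "is_adjoint E T S \<Longrightarrow> astar L T = S"
  using is_adjoint_unique is_adjoint_astar by blast

text \<open>The usual argument for Hilbert spaces: the square of the norm of S x is an inner product
  of T (S x) with x, so it is at most \<open>opn T\<close> times the norms of S x and x, and one
  factor cancels. It runs at each point of \<open>U\<close>, and the supremum is taken under the
  square root.\<close>

lemma adjoint_bound:
  assumes a: "is_adjoint E T S" and x: "x \<in> H"
  shows "hnrm E (S x) \<le> opn T * hnrm E x"
proof (cases "hnrm E (S x) = 0")
  case True
  then show ?thesis using opn_nonneg nrm_nonneg[OF x] by simp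
next
  case False
  have S: "S x \<in> H" by (rule PiE_mem[OF adjoint_PiE[OF a] x])
  then have pos: "hnrm E (S x) > 0" using False nrm_nonneg by force
  have "fn u (S x) \<le> sqrt (opn T * hnrm E (S x) * hnrm E x)" if u: "u \<in> U" for u
  proof (rule real_sqrt_le_mono)
    have "Re (hinner E (S x) (S x) u) = Re (hinner E (T (S x)) x u)"
      using adjoint_inner[OF a S x] by simp
    also have "\<dots> \<le> hnrm E (T (S x)) * hnrm E x"
      by (rule order_trans[OF complex_Re_le_cmod inner_le[OF adj_carr[OF S] x u]])
    also have "\<dots> \<le> opn T * hnrm E (S x) * hnrm E x"
      by (intro mult_right_mono opn_bound S nrm_nonneg x)
    finally show "Re (hinner E (S x) (S x) u) \<le> opn T * hnrm E (S x) * hnrm E x" .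
  qed
  then have "hnrm E (S x) \<le> sqrt (opn T * hnrm E (S x) * hnrm E x)" by (rule nrm_le[OF S])
  then have "(hnrm E (S x))\<^sup>2 \<le> (sqrt (opn T * hnrm E (S x) * hnrm E x))\<^sup>2"
    using pos by (intro power_mono) auto
  also have "\<dots> = hnrm E (S x) * (opn T * hnrm E x)"
    using opn_nonneg pos nrm_nonneg[OF x] by simp
  finally show ?thesis using pos by (simp add: power2_eq_square)
qed

lemma astar_adjointable: "astar L T \<in> adjointable E"
  using is_adjoint_astar adjoint_bound[OF is_adjoint_astar] is_adjoint_sym[OF adj_PiE is_adjoint_astar]
  by (intro adjointableI[where S=T]) (auto simp: is_adjoint_def)

end

section \<open>Sums, multiples, products and limits of adjointable operators\<close>

lemma aadd_apply: "x \<in> H \<Longrightarrow> aadd L S T x = hadd E (S x) (T x)"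
  and ascl_apply: "x \<in> H \<Longrightarrow> ascl L c T x = hscl E c (T x)"
  and amul_apply: "x \<in> H \<Longrightarrow> amul L S T x = S (T x)"
  and adiff_apply: "x \<in> H \<Longrightarrow> adiff L S T x = sub (S x) (T x)"
  by (simp_all add: adj_ops_def adiff_def compose_def)

lemma adjoint_aadd:
  assumes S: "S \<in> adjointable E" and T: "T \<in> adjointable E"
    and "is_adjoint E S S'" "is_adjoint E T T'"
  shows "is_adjoint E (aadd L S T) (aadd L S' T')"
proof -
  have S': "S' \<in> H \<rightarrow>\<^sub>E H" "T' \<in> H \<rightarrow>\<^sub>E H"
    using assms adjoint_PiE by auto
  note c = adj_carr[OF S] adj_carr[OF T] PiE_mem[OF S'(1)] PiE_mem[OF S'(2)] closed
  have "hinner E (hadd E (S x) (T x)) y = hinner E x (hadd E (S' y) (T' y))"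
    if "x \<in> H" "y \<in> H" for x y
    by (rule hinner_eqI)
       (use that in \<open>simp_all add: c inner_add inner_add_left adjoint_inner[OF assms(3)] adjoint_inner[OF assms(4)]\<close>)
  then show ?thesis unfolding is_adjoint_def
    by (auto simp: aadd_apply c) (auto simp: adj_ops_def)
qed

lemma adjoint_ascl:
  assumes S: "S \<in> adjointable E" and "is_adjoint E S S'"
  shows "is_adjoint E (ascl L k S) (ascl L (cnj k) S')"
proof -
  have S': "S' \<in> H \<rightarrow>\<^sub>E H" using assms adjoint_PiE by auto
  note c = adj_carr[OF S] PiE_mem[OF S'(1)] closed
  have "hinner E (hscl E k (S x)) y = hinner E x (hscl E (cnj k) (S' y))"
    if "x \<in> H" "y \<in> H" for x y
    by (rule hinner_eqI)
       (use that in \<open>simp_all add: c inner_scl inner_scl_left adjoint_inner[OF assms(2)]\<close>)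
  then show ?thesis unfolding is_adjoint_def
    by (auto simp: ascl_apply c) (auto simp: adj_ops_def)
qed

lemma adjoint_amul:
  assumes S: "S \<in> adjointable E" and T: "T \<in> adjointable E"
    and "is_adjoint E S S'" "is_adjoint E T T'"
  shows "is_adjoint E (amul L S T) (amul L T' S')"
proof -
  have S': "S' \<in> H \<rightarrow>\<^sub>E H" "T' \<in> H \<rightarrow>\<^sub>E H"
    using assms adjoint_PiE by auto
  note c = adj_carr[OF S] adj_carr[OF T] PiE_mem[OF S'(1)] PiE_mem[OF S'(2)] closed
  have "hinner E (S (T x)) y = hinner E x (T' (S' y))"
    if "x \<in> H" "y \<in> H" for x y
    using that by (simp add: c adjoint_inner[OF assms(3)] adjoint_inner[OF assms(4)])
  then show ?thesis unfolding is_adjoint_def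
    by (auto simp: amul_apply c) (auto simp: adj_ops_def compose_def)
qed

lemma aadd_closed:
  assumes S: "S \<in> adjointable E" and T: "T \<in> adjointable E"
  shows "aadd L S T \<in> adjointable E"
proof (rule adjointableI[OF _ adjoint_aadd[OF S T is_adjoint_astar[OF S] is_adjoint_astar[OF T]]])
  show "aadd L S T \<in> H \<rightarrow>\<^sub>E H"
    using adj_carr[OF S] adj_carr[OF T] closed by (auto simp: adj_ops_def)
  fix x assume x: "x \<in> H"
  show "hnrm E (aadd L S T x) \<le> (opn S + opn T) * hnrm E x"
    using nrm_add[OF adj_carr[OF S x] adj_carr[OF T x]] opn_bound[OF S x] opn_bound[OF T x] x
    by (simp add: aadd_apply distrib_right)
qed

lemma ascl_closed:
  assumes S: "S \<in> adjointable E"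
  shows "ascl L k S \<in> adjointable E"
proof (rule adjointableI[OF _ adjoint_ascl[OF S is_adjoint_astar[OF S]]])
  show "ascl L k S \<in> H \<rightarrow>\<^sub>E H"
    using adj_carr[OF S] closed by (auto simp: adj_ops_def)
  fix x assume x: "x \<in> H"
  show "hnrm E (ascl L k S x) \<le> (cmod k * opn S) * hnrm E x"
    using nrm_scl_le[OF adj_carr[OF S x], of k] mult_left_mono[OF opn_bound[OF S x], of "cmod k"] x
    by (simp add: ascl_apply mult.assoc)
qed

lemma amul_closed:
  assumes S: "S \<in> adjointable E" and T: "T \<in> adjointable E"
  shows "amul L S T \<in> adjointable E"
proof (rule adjointableI[OF _ adjoint_amul[OF S T is_adjoint_astar[OF S] is_adjoint_astar[OF T]]])
  show "amul L S T \<in> H \<rightarrow>\<^sub>E H"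
    using adj_carr[OF S] adj_carr[OF T] closed by (auto simp: adj_ops_def compose_def)
  fix x assume x: "x \<in> H"
  show "hnrm E (amul L S T x) \<le> (opn S * opn T) * hnrm E x"
    using opn_bound[OF S adj_carr[OF T x]] mult_left_mono[OF opn_bound[OF T x] opn_nonneg[OF S]] x
    by (simp add: amul_apply mult.assoc)
qed

lemma adiff_closed:
  "S \<in> adjointable E \<Longrightarrow> T \<in> adjointable E \<Longrightarrow> adiff L S T \<in> adjointable E"
  unfolding adiff_def by (intro aadd_closed ascl_closed)

lemma adst_le:
  assumes "c \<ge> 0" "\<And>x. x \<in> H \<Longrightarrow> hnrm E (sub (S x) (T x)) \<le> c * hnrm E x"
  shows "dst S T \<le> c"
  unfolding adst_def using assms by (intro opn_le) (simp_all add: adiff_apply)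

lemma adst_bound:
  assumes "S \<in> adjointable E" "T \<in> adjointable E" "x \<in> H"
  shows "hnrm E (sub (S x) (T x)) \<le> dst S T * hnrm E x"
  using opn_bound[OF adiff_closed[OF assms(1,2)] assms(3)] assms(3)
  unfolding adst_def by (simp add: adiff_apply)

lemma adst_nonneg:
  "S \<in> adjointable E \<Longrightarrow> T \<in> adjointable E \<Longrightarrow> 0 \<le> dst S T"
  unfolding adst_def by (intro opn_nonneg adiff_closed)

text \<open>The difference of the adjoints is an adjoint of the difference, so
  \<open>adjoint_bound\<close> applies to it.\<close>

lemma astar_dst:
  assumes S: "S \<in> adjointable E" and T: "T \<in> adjointable E"
  shows "dst (astar L S) (astar L T) \<le> dst S T"
proof -
  have "is_adjoint E (adiff L S T) (adiff L (astar L S) (astar L T))"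
    using adjoint_aadd[OF S ascl_closed[OF T, of "-1"] is_adjoint_astar[OF S]
        adjoint_ascl[OF T is_adjoint_astar[OF T], of "-1"]]
    by (simp add: adiff_def)
  note adj = adjoint_bound[OF adiff_closed[OF S T] this]
  show ?thesis
    by (rule adst_le[OF adst_nonneg[OF S T]]) (use adj in \<open>auto simp: adiff_apply adst_def\<close>)
qed

text \<open>The limit is taken vector by vector; the estimate relative to the norm of x makes the
  convergence one in operator norm. No adjoint of the limit is claimed yet.\<close>

lemma pointwise_limit:
  fixes X :: "nat \<Rightarrow> 'e \<Rightarrow> 'e"
  assumes X: "\<And>n. X n \<in> adjointable E"
    and cauchy: "\<And>e. e > 0 \<Longrightarrow> \<exists>N. \<forall>m\<ge>N. \<forall>n\<ge>N. dst (X m) (X n) < e"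
  shows "\<exists>T \<in> H \<rightarrow>\<^sub>E H. \<forall>e>0. \<exists>N. \<forall>n\<ge>N. \<forall>x\<in>H. hnrm E (sub (X n x) (T x)) \<le> e * hnrm E x"
proof -
  have "\<exists>l\<in>H. (\<lambda>n. hnrm E (sub (X n x) l)) \<longlonglongrightarrow> 0" if x: "x \<in> H" for x
  proof (rule nrm_complete)
    show "X n x \<in> H" for n by (rule adj_carr[OF X x])
    fix e :: real assume e: "e > 0"
    \<comment> \<open>The summand 1 permits division when \<open>x\<close> has norm 0.\<close>
    have p: "hnrm E x + 1 > 0" using nrm_nonneg[OF x] by simp
    obtain N where N: "\<And>m n. m \<ge> N \<Longrightarrow> n \<ge> N \<Longrightarrow> dst (X m) (X n) < e / (hnrm E x + 1)"
      using cauchy[of "e / (hnrm E x + 1)"] e p by auto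
    have "hnrm E (sub (X m x) (X n x)) < e" if mn: "m \<ge> N" "n \<ge> N" for m n
    proof -
      have "hnrm E (sub (X m x) (X n x)) \<le> dst (X m) (X n) * hnrm E x"
        by (rule adst_bound[OF X X x])
      also have "\<dots> \<le> e / (hnrm E x + 1) * hnrm E x"
        by (rule mult_right_mono[OF less_imp_le[OF N[OF mn]] nrm_nonneg[OF x]])
      also have "\<dots> < e" using e p by (simp add: field_simps)
      finally show ?thesis .
    qed
    then show "\<exists>N. \<forall>m\<ge>N. \<forall>n\<ge>N. hnrm E (sub (X m x) (X n x)) < e" by blast
  qed
  then obtain Q where Q: "\<And>x. x \<in> H \<Longrightarrow> Q x \<in> H"
    "\<And>x. x \<in> H \<Longrightarrow> (\<lambda>n. hnrm E (sub (X n x) (Q x))) \<longlonglongrightarrow> 0"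
    by metis
  have "\<exists>N. \<forall>n\<ge>N. \<forall>x\<in>H. hnrm E (sub (X n x) (Q x)) \<le> e * hnrm E x" if e: "e > 0" for e
  proof -
    obtain N where N: "\<And>m n. m \<ge> N \<Longrightarrow> n \<ge> N \<Longrightarrow> dst (X m) (X n) < e"
      using cauchy[OF e] by auto
    have "hnrm E (sub (X n x) (Q x)) \<le> e * hnrm E x" if n: "n \<ge> N" and x: "x \<in> H" for n x
    proof -
      \<comment> \<open>With n fixed, m tends to infinity in the Cauchy estimate, and the last
        summand disappears.\<close>
      have "(\<lambda>m. e * hnrm E x + hnrm E (sub (X m x) (Q x))) \<longlonglongrightarrow> e * hnrm E x + 0"
        by (intro tendsto_add tendsto_const Q x)
      moreover have "\<forall>m\<ge>N. hnrm E (sub (X n x) (Q x)) \<le> e * hnrm E x + hnrm E (sub (X m x) (Q x))"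
      proof (intro allI impI)
        fix m assume m: "m \<ge> N"
        have "hnrm E (sub (X n x) (X m x)) \<le> e * hnrm E x"
          using adst_bound[OF X X x] mult_right_mono[OF less_imp_le[OF N[OF n m]] nrm_nonneg[OF x]]
          by (rule order_trans)
        then show "hnrm E (sub (X n x) (Q x)) \<le> e * hnrm E x + hnrm E (sub (X m x) (Q x))"
          using nrm_sub_triangle[OF adj_carr[OF X x] adj_carr[OF X x] Q(1)[OF x], of n m] by linarith
      qed
      ultimately show ?thesis using LIMSEQ_le_const[of _ "e * hnrm E x"] by auto
    qed
    then show ?thesis by blast
  qed
  then show ?thesis
    by (intro bexI[of _ "restrict Q (H)"]) (use Q(1) in auto)
qed

lemma inner_limit:
  fixes X :: "nat \<Rightarrow> 'e"
  assumes x: "\<And>n. X n \<in> H" "l \<in> H" and y: "y \<in> H" and u: "u \<in> U"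
    and lim: "(\<lambda>n. hnrm E (sub (X n) l)) \<longlonglongrightarrow> 0"
  shows "(\<lambda>n. hinner E y (X n) u) \<longlonglongrightarrow> hinner E y l u"
proof -
  have "hinner E y (sub (X n) l) u = hinner E y (X n) u - hinner E y l u" for n
    using x y u by (simp add: inner_add inner_scl closed)
  moreover have "(\<lambda>n. hinner E y (sub (X n) l) u) \<longlonglongrightarrow> 0"
    by (rule Lim_null_comparison[OF always_eventually tendsto_mult_right_zero[OF lim, of "hnrm E y"]])
       (use inner_le[OF y _ u] x closed in auto)
  ultimately show ?thesis by (simp add: LIM_zero_iff)
qed

sublocale complete_star_algebra "adj_ops E"
proof
  have [simp]: "acarr L = adjointable E" by (simp add: adj_ops_def)
  show "\<And>x y. x \<in> acarr L \<Longrightarrow> y \<in> acarr L \<Longrightarrow> aadd L x y \<in> acarr L"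
    "\<And>x c. x \<in> acarr L \<Longrightarrow> ascl L c x \<in> acarr L"
    "\<And>x y. x \<in> acarr L \<Longrightarrow> y \<in> acarr L \<Longrightarrow> amul L x y \<in> acarr L"
    "\<And>x. x \<in> acarr L \<Longrightarrow> astar L x \<in> acarr L"
    "\<And>x y. x \<in> acarr L \<Longrightarrow> y \<in> acarr L \<Longrightarrow> 0 \<le> dst x y"
    by (simp_all add: aadd_closed ascl_closed amul_closed astar_adjointable adst_nonneg)
  show "(dst S T = 0) = (S = T)" if "S \<in> acarr L" "T \<in> acarr L" for S T
  proof
    assume 0: "dst S T = 0"
    have S: "S \<in> adjointable E" and T: "T \<in> adjointable E" using that by auto
    show "S = T"
    proof (rule extensionalityI[of _ "H"])
      fix x assume x: "x \<in> H"
      have "hnrm E (sub (S x) (T x)) \<le> 0" using adst_bound[OF S T x] 0 by simp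
      then have "hnrm E (sub (S x) (T x)) = 0"
        using nrm_nonneg[of "sub (S x) (T x)"] adj_carr[OF S x] adj_carr[OF T x] closed by force
      then show "S x = T x" by (rule sub_eq[OF adj_carr[OF S x] adj_carr[OF T x]])
    qed (use adj_PiE[OF S] adj_PiE[OF T] in \<open>auto simp: PiE_def\<close>)
  next
    assume eq: "S = T"
    have T: "T \<in> adjointable E" using that by auto
    have "dst S T \<le> 0" unfolding eq
      by (rule adst_le) (use adj_carr[OF T] nrm_sub_self in auto)
    then show "dst S T = 0" using adst_nonneg[of S T] that by auto
  qed
  have sym: "dst S T \<le> dst T S" if "S \<in> adjointable E" "T \<in> adjointable E" for S T
    using adst_bound[OF that(2,1)] nrm_sub_commute adj_carr that adst_nonneg by (intro adst_le) auto
  then show "dst S T = dst T S" if "S \<in> acarr L" "T \<in> acarr L" for S T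
    using that by (intro antisym) auto
  show "dst S Q \<le> dst S T + dst T Q"
    if "S \<in> acarr L" "T \<in> acarr L" "Q \<in> acarr L" for S T Q
  proof -
    have a: "S \<in> adjointable E" "T \<in> adjointable E" "Q \<in> adjointable E" using that by auto
    show ?thesis
    proof (rule adst_le)
      fix x assume x: "x \<in> H"
      show "hnrm E (sub (S x) (Q x)) \<le> (dst S T + dst T Q) * hnrm E x"
        using nrm_sub_triangle[OF adj_carr[OF a(1) x] adj_carr[OF a(2) x] adj_carr[OF a(3) x]]
          adst_bound[OF a(1,2) x] adst_bound[OF a(2,3) x] by (simp add: distrib_right)
    qed (simp add: adst_nonneg a)
  qed
  show "dst (aadd L S T) (aadd L S' T') \<le>
      dst S S' + dst T T'"
    if "S \<in> acarr L" "T \<in> acarr L" "S' \<in> acarr L" "T' \<in> acarr L" for S T S' T'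
  proof -
    have a: "S \<in> adjointable E" "T \<in> adjointable E" "S' \<in> adjointable E" "T' \<in> adjointable E"
      using that by auto
    show ?thesis
    proof (rule adst_le)
      fix x assume x: "x \<in> H"
      note c = adj_carr[OF a(1) x] adj_carr[OF a(2) x] adj_carr[OF a(3) x] adj_carr[OF a(4) x] closed
      have "sub (hadd E (S x) (T x)) (hadd E (S' x) (T' x)) = hadd E (sub (S x) (S' x)) (sub (T x) (T' x))"
        by (rule nondegenerate) (simp_all add: c inner_add inner_scl)
      then show "hnrm E (sub (aadd L S T x) (aadd L S' T' x))
          \<le> (dst S S' + dst T T') * hnrm E x"
        using nrm_add[of "sub (S x) (S' x)" "sub (T x) (T' x)"]
          adst_bound[OF a(1,3) x] adst_bound[OF a(2,4) x] x by (simp add: aadd_apply distrib_right c)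
    qed (simp add: adst_nonneg a)
  qed
  show "dst (ascl L k S) (ascl L k T) \<le> cmod k * dst S T"
    if "S \<in> acarr L" "T \<in> acarr L" for S T k
  proof -
    have a: "S \<in> adjointable E" "T \<in> adjointable E" using that by auto
    show ?thesis
    proof (rule adst_le)
      fix x assume x: "x \<in> H"
      note c = adj_carr[OF a(1) x] adj_carr[OF a(2) x] closed
      have "sub (hscl E k (S x)) (hscl E k (T x)) = hscl E k (sub (S x) (T x))"
        by (rule nondegenerate) (simp_all add: c inner_add inner_scl algebra_simps)
      then show "hnrm E (sub (ascl L k S x) (ascl L k T x))
          \<le> (cmod k * dst S T) * hnrm E x"
        using nrm_scl_le[of "sub (S x) (T x)" k]
          mult_left_mono[OF adst_bound[OF a(1,2) x], of "cmod k"] x by (simp add: ascl_apply mult.assoc c)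
    qed (simp add: adst_nonneg a)
  qed
  show "dst (amul L S T) (amul L S' T') \<le>
      opn S * dst T T' + dst S S' * opn T'"
    if "S \<in> acarr L" "T \<in> acarr L" "S' \<in> acarr L" "T' \<in> acarr L" for S T S' T'
  proof -
    have a: "S \<in> adjointable E" "T \<in> adjointable E" "S' \<in> adjointable E" "T' \<in> adjointable E"
      using that by auto
    show ?thesis
    proof (rule adst_le)
      fix x assume x: "x \<in> H"
      note c = adj_carr[OF a(2) x] adj_carr[OF a(4) x]
      \<comment> \<open>The intermediate vector S (T' x) splits S T - S' T' into S (T - T') and (S -
        S') T'.\<close>
      have "hnrm E (sub (S (T x)) (S' (T' x))) \<le> hnrm E (S (sub (T x) (T' x))) + hnrm E (sub (S (T' x)) (S' (T' x)))"
        using nrm_sub_triangle[of "S (T x)" "S (T' x)" "S' (T' x)"]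
        by (simp add: adj_sub[OF a(1)] c adj_carr[OF a(1)] adj_carr[OF a(3)])
      also have "hnrm E (S (sub (T x) (T' x))) \<le> opn S * (dst T T' * hnrm E x)"
        by (rule order_trans[OF opn_bound[OF a(1)]])
           (use c closed adst_bound[OF a(2,4) x] opn_nonneg[OF a(1)] in \<open>auto intro: mult_left_mono\<close>)
      also have "hnrm E (sub (S (T' x)) (S' (T' x))) \<le> dst S S' * (opn T' * hnrm E x)"
        by (rule order_trans[OF adst_bound[OF a(1,3) c(2)]])
           (use opn_bound[OF a(4) x] adst_nonneg[OF a(1,3)] in \<open>auto intro: mult_left_mono\<close>)
      finally show "hnrm E (sub (amul L S T x) (amul L S' T' x))
          \<le> (opn S * dst T T' + dst S S' * opn T') * hnrm E x"
        using x by (simp add: amul_apply algebra_simps)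
    qed (simp add: adst_nonneg opn_nonneg a)
  qed
  show "dst (astar L S) (astar L T) \<le> dst S T" if "S \<in> acarr L" "T \<in> acarr L" for S T
    using astar_dst that by simp
  have nrm1: "opn S \<le> opn T + dst S T" if a: "S \<in> adjointable E" "T \<in> adjointable E" for S T
  proof (rule opn_le)
    fix x assume x: "x \<in> H"
    show "hnrm E (S x) \<le> (opn T + dst S T) * hnrm E x"
      using nrm_le_sub[OF adj_carr[OF a(1) x] adj_carr[OF a(2) x]] opn_bound[OF a(2) x]
        adst_bound[OF a x] by (simp add: distrib_right)
  qed (simp add: adst_nonneg opn_nonneg a)
  show "\<bar>opn S - opn T\<bar> \<le> dst S T"
    if "S \<in> acarr L" "T \<in> acarr L" for S T
    using nrm1[of S T] nrm1[of T S] sym[of T S] that by auto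
  show "\<exists>l\<in>acarr L. (\<lambda>n. dst (X n) l) \<longlonglongrightarrow> 0"
    if c: "acauchy L X" for X
  proof -
    have X: "X n \<in> adjointable E" for n using c unfolding acauchy_def by auto
    \<comment> \<open>The limit operator must come with an adjoint. The adjoints form a Cauchy
      sequence too, and their limit turns out to be the adjoint of the limit.\<close>
    let ?Y = "\<lambda>n. astar L (X n)"
    have Y: "?Y n \<in> adjointable E" for n by (rule astar_adjointable[OF X])
    have cX: "\<exists>N. \<forall>m\<ge>N. \<forall>n\<ge>N. dst (X m) (X n) < e" if "e > 0" for e
      using c that unfolding acauchy_def adst_def by blast
    have star: "dst (?Y m) (?Y n) \<le> dst (X m) (X n)" for m n by (rule astar_dst[OF X X])
    have cY: "\<exists>N. \<forall>m\<ge>N. \<forall>n\<ge>N. dst (?Y m) (?Y n) < e" if e: "e > 0" for e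
    proof -
      obtain N where "\<forall>m\<ge>N. \<forall>n\<ge>N. dst (X m) (X n) < e" using cX[OF e] by blast
      then show ?thesis by (intro exI[of _ N] allI impI) (rule le_less_trans[OF star], simp)
    qed
    obtain T where T: "T \<in> H \<rightarrow>\<^sub>E H"
      and Tl: "\<And>e. e > 0 \<Longrightarrow> \<exists>N. \<forall>n\<ge>N. \<forall>x\<in>H. hnrm E (sub (X n x) (T x)) \<le> e * hnrm E x"
      using pointwise_limit[OF X cX] by blast
    obtain S where S: "S \<in> H \<rightarrow>\<^sub>E H"
      and Sl: "\<And>e. e > 0 \<Longrightarrow> \<exists>N. \<forall>n\<ge>N. \<forall>x\<in>H. hnrm E (sub (?Y n x) (S x)) \<le> e * hnrm E x"
      using pointwise_limit[OF Y cY] by blast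
    have lim: "(\<lambda>n. hnrm E (sub (Z n x) (Q x))) \<longlonglongrightarrow> 0"
      if x: "x \<in> H" and Z: "\<And>n. Z n \<in> adjointable E" and Q: "Q \<in> H \<rightarrow>\<^sub>E H"
        and l: "\<And>e. e > 0 \<Longrightarrow> \<exists>N. \<forall>n\<ge>N. \<forall>x\<in>H. hnrm E (sub (Z n x) (Q x)) \<le> e * hnrm E x"
      for x Z Q
    proof (rule LIMSEQ_I)
      fix e :: real assume e: "e > 0"
      have p: "hnrm E x + 1 > 0" using nrm_nonneg[OF x] by simp
      obtain N where N: "\<And>n. n \<ge> N \<Longrightarrow> hnrm E (sub (Z n x) (Q x)) \<le> e / (hnrm E x + 1) * hnrm E x"
        using l[of "e / (hnrm E x + 1)"] e p x by auto
      have "e / (hnrm E x + 1) * hnrm E x < e" using e p by (simp add: field_simps)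
      moreover have "0 \<le> hnrm E (sub (Z n x) (Q x))" for n
        by (intro nrm_nonneg closed adj_carr[OF Z] PiE_mem[OF Q] x)
      ultimately show "\<exists>N. \<forall>n\<ge>N. norm (hnrm E (sub (Z n x) (Q x)) - 0) < e"
        using N by (intro exI[of _ N]) (auto intro: le_less_trans)
    qed
    have adj: "is_adjoint E T S"
      unfolding is_adjoint_def
    proof (intro conjI ballI S)
      fix x y assume xy: "x \<in> H" "y \<in> H"
      show "hinner E (T x) y = hinner E x (S y)"
      proof (rule hinner_eqI)
        fix u assume u: "u \<in> U"
        have "(\<lambda>n. hinner E x (?Y n y) u) \<longlonglongrightarrow> hinner E x (S y) u"
          by (rule inner_limit[OF adj_carr[OF Y xy(2)] PiE_mem[OF S xy(2)] xy(1) u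
                lim[OF xy(2) Y S Sl]])
        moreover have "(\<lambda>n. cnj (hinner E y (X n x) u)) \<longlonglongrightarrow> cnj (hinner E y (T x) u)"
          by (intro tendsto_cnj inner_limit[OF adj_carr[OF X xy(1)] PiE_mem[OF T xy(1)] xy(2) u
                lim[OF xy(1) X T Tl]])
        moreover have "cnj (hinner E y (X n x) u) = hinner E x (?Y n y) u" for n
        proof -
          have "hinner E x (?Y n y) u = hinner E (X n x) y u"
            using adjoint_inner[OF is_adjoint_astar[OF X] xy] by simp
          also have "\<dots> = cnj (hinner E y (X n x) u)"
            using inner_cnj[OF u xy(2) adj_carr[OF X xy(1)]] .
          finally show ?thesis by simp
        qed
        ultimately have "cnj (hinner E y (T x) u) = hinner E x (S y) u"
          using LIMSEQ_unique by auto
        then show "hinner E (T x) y u = hinner E x (S y) u"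
          using inner_cnj[OF u xy(2) PiE_mem[OF T xy(1)]] by simp
      qed (use xy T S in auto)
    qed
    \<comment> \<open>A single member of the sequence within distance 1 of \<open>T\<close> suffices
      to bound \<open>T\<close>.\<close>
    obtain N where N: "\<And>x. x \<in> H \<Longrightarrow> hnrm E (sub (X N x) (T x)) \<le> 1 * hnrm E x"
      using Tl[of 1] by auto
    have TA: "T \<in> adjointable E"
    proof (rule adjointableI[OF T adj])
      fix x assume x: "x \<in> H"
      show "hnrm E (T x) \<le> (1 + opn (X N)) * hnrm E x"
        using nrm_le_sub[OF PiE_mem[OF T x] adj_carr[OF X x, of N]] N[OF x]
          nrm_sub_commute[OF PiE_mem[OF T x] adj_carr[OF X x, of N]] opn_bound[OF X x, of N]
        by (simp add: distrib_right)
    qed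
    have "(\<lambda>n. dst (X n) T) \<longlonglongrightarrow> 0"
    proof (rule LIMSEQ_I)
      fix e :: real assume e: "e > 0"
      obtain N where N: "\<And>n x. n \<ge> N \<Longrightarrow> x \<in> H \<Longrightarrow> hnrm E (sub (X n x) (T x)) \<le> e / 2 * hnrm E x"
        using Tl[of "e / 2"] e by auto
      have "dst (X n) T \<le> e / 2" if "n \<ge> N" for n
        by (rule adst_le) (use e N[OF that] in auto)
      then show "\<exists>N. \<forall>n\<ge>N. norm (dst (X n) T - 0) < e"
        using e adst_nonneg[OF X TA] by (intro exI[of _ N]) (fastforce intro: le_less_trans)
    qed
    then show ?thesis using TA by auto
  qed
qed

end

section \<open>The spaces of square integrable functions\<close>

lemma sq_int_measurable: "\<xi> \<in> sq_int M \<Longrightarrow> \<xi> \<in> borel_measurable M"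
  and sq_int_integrable: "\<xi> \<in> sq_int M \<Longrightarrow> integrable M (\<lambda>x. (cmod (\<xi> x))\<^sup>2)"
  unfolding sq_int_def by auto

lemma l2_norm_nonneg: "0 \<le> l2_norm M \<xi>"
  unfolding l2_norm_def by (simp add: integral_nonneg_AE)

lemma l2_norm_sq: "(l2_norm M \<xi>)\<^sup>2 = (LINT x|M. (cmod (\<xi> x))\<^sup>2)"
  unfolding l2_norm_def by (simp add: integral_nonneg_AE)

lemma nn_integral_l2_norm:
  "\<xi> \<in> sq_int M \<Longrightarrow> (\<integral>\<^sup>+x. ennreal ((cmod (\<xi> x))\<^sup>2) \<partial>M) = ennreal ((l2_norm M \<xi>)\<^sup>2)"
  unfolding l2_norm_sq by (intro nn_integral_eq_integral sq_int_integrable) auto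

lemma sq_intI_nn_integral:
  assumes [measurable]: "\<xi> \<in> borel_measurable M"
    and le: "(\<integral>\<^sup>+x. ennreal ((cmod (\<xi> x))\<^sup>2) \<partial>M) \<le> ennreal (c\<^sup>2)" and c: "0 \<le> c"
  shows "\<xi> \<in> sq_int M" "l2_norm M \<xi> \<le> c"
proof -
  have "integrable M (\<lambda>x. (cmod (\<xi> x))\<^sup>2)"
    by (intro integrableI_bounded) (use le in \<open>auto simp: le_less_trans\<close>)
  then show *: "\<xi> \<in> sq_int M" unfolding sq_int_def by simp
  have "ennreal ((l2_norm M \<xi>)\<^sup>2) \<le> ennreal (c\<^sup>2)" using le nn_integral_l2_norm[OF *] by simp
  then show "l2_norm M \<xi> \<le> c" using c by (simp add: power2_le_iff_abs_le l2_norm_nonneg)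
qed

lemma sq_int_bound:
  assumes "\<xi> \<in> borel_measurable M" "\<eta> \<in> sq_int M" "AE x in M. cmod (\<xi> x) \<le> cmod (\<eta> x)"
  shows "\<xi> \<in> sq_int M"
proof -
  have "integrable M (\<lambda>x. (cmod (\<xi> x))\<^sup>2)"
    by (rule Bochner_Integration.integrable_bound[OF sq_int_integrable[OF assms(2)]])
       (use assms in \<open>auto intro: power_mono\<close>)
  then show ?thesis unfolding sq_int_def using assms(1) by simp
qed

text \<open>The product is dominated by the sum of the two squares.\<close>

lemma sq_int_mult_integrable:
  assumes a: "\<xi> \<in> sq_int M" and b: "\<eta> \<in> sq_int M"
  shows "integrable M (\<lambda>x. \<xi> x * \<eta> x)"
proof (rule Bochner_Integration.integrable_bound)
  show "integrable M (\<lambda>x. (cmod (\<xi> x))\<^sup>2 + (cmod (\<eta> x))\<^sup>2)"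
    by (intro Bochner_Integration.integrable_add sq_int_integrable a b)
  show "(\<lambda>x. \<xi> x * \<eta> x) \<in> borel_measurable M"
    using sq_int_measurable[OF a] sq_int_measurable[OF b] by measurable
  have "cmod (\<xi> x * \<eta> x) \<le> (cmod (\<xi> x))\<^sup>2 + (cmod (\<eta> x))\<^sup>2" for x
    using sum_squares_bound[of "cmod (\<xi> x)" "cmod (\<eta> x)"] mult_nonneg_nonneg[of "cmod (\<xi> x)" "cmod (\<eta> x)"]
    by (simp add: norm_mult del: mult_nonneg_nonneg)
  then show "AE x in M. norm (\<xi> x * \<eta> x) \<le> norm ((cmod (\<xi> x))\<^sup>2 + (cmod (\<eta> x))\<^sup>2)"
    by (intro AE_I2) (simp add: order_trans)
qed

lemma borel_measurable_cnj:
  "f \<in> borel_measurable M \<Longrightarrow> (\<lambda>x. cnj (f x)) \<in> borel_measurable M"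
  by (rule measurable_compose[OF _ borel_measurable_continuous_onI])
     (auto intro!: continuous_intros)

lemma sq_int_cnj: "\<xi> \<in> sq_int M \<Longrightarrow> (\<lambda>x. cnj (\<xi> x)) \<in> sq_int M"
  by (rule sq_int_bound[of _ _ \<xi>]) (auto dest: sq_int_measurable intro: borel_measurable_cnj)

lemma sq_int_add:
  assumes a: "\<xi> \<in> sq_int M" and b: "\<eta> \<in> sq_int M"
  shows "(\<lambda>x. \<xi> x + \<eta> x) \<in> sq_int M"
proof -
  have m: "(\<lambda>x. \<xi> x + \<eta> x) \<in> borel_measurable M"
    using sq_int_measurable[OF a] sq_int_measurable[OF b] by measurable
  have "integrable M (\<lambda>x. (cmod (\<xi> x + \<eta> x))\<^sup>2)"
  proof (rule Bochner_Integration.integrable_bound)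
    show "integrable M (\<lambda>x. 2 * (cmod (\<xi> x))\<^sup>2 + 2 * (cmod (\<eta> x))\<^sup>2)"
      using sq_int_integrable[OF a] sq_int_integrable[OF b] by simp
    have "(cmod (\<xi> x + \<eta> x))\<^sup>2 \<le> 2 * (cmod (\<xi> x))\<^sup>2 + 2 * (cmod (\<eta> x))\<^sup>2" for x
      using power_mono[OF norm_triangle_ineq, of "\<xi> x" "\<eta> x" 2]
        sum_squares_bound[of "cmod (\<xi> x)" "cmod (\<eta> x)"] by (simp add: power2_sum)
    then show "AE x in M. norm ((cmod (\<xi> x + \<eta> x))\<^sup>2) \<le> norm (2 * (cmod (\<xi> x))\<^sup>2 + 2 * (cmod (\<eta> x))\<^sup>2)"
      by (intro AE_I2) simp
  qed (use m in measurable)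
  then show ?thesis unfolding sq_int_def using m by simp
qed

lemma sq_int_scale:
  assumes a: "\<xi> \<in> sq_int M"
  shows "(\<lambda>x. c * \<xi> x) \<in> sq_int M"
  using sq_int_measurable[OF a] sq_int_integrable[OF a]
  unfolding sq_int_def by (auto simp: norm_mult power_mult_distrib)

lemma semi_inner_l2:
  "semi_inner (sq_int M) (\<lambda>\<xi> \<eta> x. \<xi> x + \<eta> x) (\<lambda>c \<xi> x. c * \<xi> x) (l2_inner M)"
proof
  fix x y z :: "'a \<Rightarrow> complex" and c
  assume x: "x \<in> sq_int M"
  show "(\<lambda>t. c * x t) \<in> sq_int M" by (rule sq_int_scale[OF x])
  show "0 \<le> Re (l2_inner M x x)"
    unfolding l2_inner_def
    by (simp add: integral_Re[symmetric] sq_int_mult_integrable[OF sq_int_cnj[OF x] x] integral_nonneg_AE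
        del: integral_Re)
  { assume z: "z \<in> sq_int M"
    show "l2_inner M z (\<lambda>t. c * x t) = c * l2_inner M z x"
      unfolding l2_inner_def by (simp add: mult.left_commute[of _ c]) }
  { assume y: "y \<in> sq_int M"
    show "(\<lambda>t. x t + y t) \<in> sq_int M" by (rule sq_int_add[OF x y])
    show "l2_inner M y x = cnj (l2_inner M x y)"
      unfolding l2_inner_def by (simp add: mult.commute flip: Bochner_Integration.integral_cnj)
    assume z: "z \<in> sq_int M"
    show "l2_inner M z (\<lambda>t. x t + y t) = l2_inner M z x + l2_inner M z y"
      unfolding l2_inner_def
      by (simp add: distrib_left sq_int_mult_integrable[OF sq_int_cnj[OF z] x]
          sq_int_mult_integrable[OF sq_int_cnj[OF z] y]) }
qed

lemma l2_inner_self: "l2_inner M \<xi> \<xi> = of_real ((l2_norm M \<xi>)\<^sup>2)"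
  unfolding l2_inner_def l2_norm_sq
  by (simp add: complex_norm_square[symmetric] mult.commute flip: integral_complex_of_real)

lemma l2_norm_eq: "l2_norm M \<xi> = sqrt (Re (l2_inner M \<xi> \<xi>))"
  unfolding l2_inner_self by (simp add: l2_norm_nonneg)

lemma nv_l2: "semi_inner.nv (l2_inner M) = l2_norm M"
  unfolding semi_inner.nv_def[OF semi_inner_l2] l2_norm_eq ..

lemmas l2_cauchy_schwarz = semi_inner.cauchy_schwarz[OF semi_inner_l2, unfolded nv_l2]
  and l2_norm_add = semi_inner.nv_add[OF semi_inner_l2, unfolded nv_l2]
  and l2_norm_scale = semi_inner.nv_scl[OF semi_inner_l2, unfolded nv_l2]
  and l2_inner_add = semi_inner.ip_add[OF semi_inner_l2]

lemma sq_int_diff: "\<xi> \<in> sq_int M \<Longrightarrow> \<eta> \<in> sq_int M \<Longrightarrow> (\<lambda>x. \<xi> x - \<eta> x) \<in> sq_int M"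
  using sq_int_add[of \<xi> M "\<lambda>x. (-1) * \<eta> x"] sq_int_scale[of \<eta> M "-1"] by simp

lemma l2_norm_diff_commute: "l2_norm M (\<lambda>x. \<xi> x - \<eta> x) = l2_norm M (\<lambda>x. \<eta> x - \<xi> x)"
  unfolding l2_norm_def by (simp add: norm_minus_commute)

lemma l2_norm_diff_triangle:
  assumes "\<xi> \<in> sq_int M" "\<eta> \<in> sq_int M" "\<zeta> \<in> sq_int M"
  shows "l2_norm M (\<lambda>x. \<xi> x - \<zeta> x) \<le> l2_norm M (\<lambda>x. \<xi> x - \<eta> x) + l2_norm M (\<lambda>x. \<eta> x - \<zeta> x)"
  using l2_norm_add[OF sq_int_diff[OF assms(1,2)] sq_int_diff[OF assms(2,3)]] by simp

lemma l2_norm_triangle_sub: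
  assumes "\<xi> \<in> sq_int M" "\<eta> \<in> sq_int M"
  shows "l2_norm M \<xi> \<le> l2_norm M \<eta> + l2_norm M (\<lambda>x. \<xi> x - \<eta> x)"
  using l2_norm_add[OF assms(2) sq_int_diff[OF assms]] by simp

lemma l2_norm_cong_AE:
  assumes "AE x in M. \<xi> x = \<eta> x" "\<xi> \<in> borel_measurable M" "\<eta> \<in> borel_measurable M"
  shows "l2_norm M \<xi> = l2_norm M \<eta>"
  unfolding l2_norm_def
  by (rule arg_cong[where f=sqrt], rule integral_cong_AE) (use assms in auto)

lemma l2_inner_cong_AE:
  assumes "AE x in M. \<xi> x = \<xi>' x" "AE x in M. \<eta> x = \<eta>' x"
    "\<xi> \<in> sq_int M" "\<xi>' \<in> sq_int M" "\<eta> \<in> sq_int M" "\<eta>' \<in> sq_int M"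
  shows "l2_inner M \<xi> \<eta> = l2_inner M \<xi>' \<eta>'"
  unfolding l2_inner_def
proof (rule integral_cong_AE)
  show "AE x in M. cnj (\<xi> x) * \<eta> x = cnj (\<xi>' x) * \<eta>' x" using assms(1,2) by eventually_elim simp
qed (intro borel_measurable_integrable sq_int_mult_integrable sq_int_cnj assms)+

lemma l2_norm_0_AE:
  assumes "\<xi> \<in> sq_int M" "l2_norm M \<xi> = 0"
  shows "AE x in M. \<xi> x = 0"
proof -
  have "(LINT x|M. (cmod (\<xi> x))\<^sup>2) = 0" using assms(2) l2_norm_sq[of M \<xi>] by simp
  then have "AE x in M. (cmod (\<xi> x))\<^sup>2 = 0"
    using integral_nonneg_eq_0_iff_AE[OF sq_int_integrable[OF assms(1)]] by simp
  then show ?thesis by simp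
qed

text \<open>The weights \<open>4 ^ k\<close> replace Minkowski's inequality for infinite sums in the usual proof of
  the Riesz-Fischer theorem.\<close>

lemma l2_complete:
  fixes X :: "nat \<Rightarrow> 'a \<Rightarrow> complex"
  assumes X: "\<And>n. X n \<in> sq_int M"
    and cauchy: "\<And>e. e > 0 \<Longrightarrow> \<exists>N. \<forall>m\<ge>N. \<forall>n\<ge>N. l2_norm M (\<lambda>x. X m x - X n x) < e"
  shows "\<exists>l \<in> sq_int M. (\<lambda>n. l2_norm M (\<lambda>x. X n x - l x)) \<longlonglongrightarrow> 0"
proof -
  have Xm [measurable]: "X n \<in> borel_measurable M" for n using X sq_int_measurable by blast
  have "\<forall>k. \<exists>N. \<forall>m\<ge>N. \<forall>n\<ge>N. l2_norm M (\<lambda>x. X m x - X n x) < (1/4)^k"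
    by (intro allI cauchy) simp
  then obtain N where N: "\<And>k m n. m \<ge> N k \<Longrightarrow> n \<ge> N k \<Longrightarrow> l2_norm M (\<lambda>x. X m x - X n x) < (1/4)^k"
    by metis
  \<comment> \<open>Both \<open>r k\<close> and \<open>r (Suc k)\<close> are at least
    \<open>N k\<close>, so consecutive terms of the subsequence are within (1/4)^k; the summand k
    makes the indices unbounded.\<close>
  define r where "r k = k + (\<Sum>i\<le>k. N i)" for k
  have rN: "r k \<ge> N k" "r (Suc k) \<ge> N k" "r k \<ge> k" for k
  proof -
    have "N k \<le> (\<Sum>i\<le>k. N i)" by (rule member_le_sum) auto
    then show "r k \<ge> N k" "r (Suc k) \<ge> N k" "r k \<ge> k" unfolding r_def by auto
  qed
  define Y where "Y k = X (r k)" for k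
  define d where "d k x = (cmod (Y (Suc k) x - Y k x))\<^sup>2" for k x
  have Ym [measurable]: "Y k \<in> borel_measurable M" for k unfolding Y_def by simp
  have dm [measurable]: "d k \<in> borel_measurable M" for k unfolding d_def by measurable
  have d0: "0 \<le> d k x" for k x unfolding d_def by simp
  \<comment> \<open>Squaring the distance (1/4)^k leaves a factor to spare, which pays for the
    weight 4^k and still leaves a summable bound.\<close>
  have "(\<integral>\<^sup>+x. ennreal (4^k * d k x) \<partial>M) \<le> ennreal ((1/4)^k)" for k
  proof -
    have "(\<integral>\<^sup>+x. ennreal (d k x) \<partial>M) = ennreal ((l2_norm M (\<lambda>x. Y (Suc k) x - Y k x))\<^sup>2)"
      unfolding d_def Y_def by (rule nn_integral_l2_norm[OF sq_int_diff[OF X X]])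
    also have "\<dots> \<le> ennreal (((1/4)^k)\<^sup>2)"
      unfolding Y_def
      by (intro ennreal_leI power_mono less_imp_le[OF N[OF rN(2,1)]] l2_norm_nonneg)
    finally have *: "(\<integral>\<^sup>+x. ennreal (d k x) \<partial>M) \<le> ennreal (((1/4)^k)\<^sup>2)" .
    have "(\<integral>\<^sup>+x. ennreal (4^k * d k x) \<partial>M) = ennreal (4^k) * (\<integral>\<^sup>+x. ennreal (d k x) \<partial>M)"
      by (simp add: ennreal_mult' nn_integral_cmult del: ennreal_power)
    also have "\<dots> \<le> ennreal (4^k) * ennreal (((1/4)^k)\<^sup>2)" by (intro mult_left_mono *) simp
    also have "\<dots> = ennreal (4^k * ((1/4)^k)\<^sup>2)" by (simp add: ennreal_mult' del: ennreal_power)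
    also have "4^k * ((1/4)^k)\<^sup>2 = (1/4::real)^k"
      by (simp add: power2_eq_square power_divide)
    finally show ?thesis .
  qed
  then have "(\<Sum>k. \<integral>\<^sup>+x. ennreal (4^k * d k x) \<partial>M) \<le> (\<Sum>k. ennreal ((1/4)^k))"
    by (intro suminf_le) auto
  also have "\<dots> < \<infinity>"
    by (subst suminf_ennreal2) (auto intro!: summable_geometric)
  finally have "(\<integral>\<^sup>+x. (\<Sum>k. ennreal (4^k * d k x)) \<partial>M) < \<infinity>"
    by (subst nn_integral_suminf) auto
  then have "AE x in M. (\<Sum>k. ennreal (4^k * d k x)) \<noteq> \<infinity>"
    by (intro nn_integral_noteq_infinite) auto
  then have conv: "AE x in M. convergent (\<lambda>k. Y k x)"
  proof eventually_elim
    fix x assume "(\<Sum>k. ennreal (4^k * d k x)) \<noteq> \<infinity>"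
    then have "summable (\<lambda>k. 4^k * d k x)"
      by (intro summable_suminf_not_top) (auto simp: d0)
    \<comment> \<open>Boundedness of the weighted terms gives d k x \<le> C (1/4)^k, whose square
      root is geometric with ratio 1/2; hence the increments are absolutely summable.\<close>
    then have "Bseq (\<lambda>k. 4^k * d k x)" by (rule summable_imp_Bseq)
    then obtain C where C': "\<forall>k. norm (4^k * d k x) \<le> C" by (rule BseqE)
    then have C: "norm (4^k * d k x) \<le> C" for k by blast
    have "summable (\<lambda>k. Y (Suc k) x - Y k x)"
    proof (rule summable_comparison_test')
      show "summable (\<lambda>k. sqrt C * (1/2)^k)" by (intro summable_mult summable_geometric) simp
      fix k :: nat
      have "d k x \<le> C * (1/4)^k" using C[of k] by (simp add: power_divide field_simps d0)
      then have "sqrt (d k x) \<le> sqrt (C * (1/4)^k)" by (rule real_sqrt_le_mono)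
      also have "\<dots> = sqrt C * (1/2)^k"
        by (simp add: real_sqrt_mult real_sqrt_power real_sqrt_divide)
      finally show "norm (Y (Suc k) x - Y k x) \<le> sqrt C * (1/2)^k" unfolding d_def by simp
    qed
    then have "convergent (\<lambda>n. \<Sum>k<n. Y (Suc k) x - Y k x)" by (simp add: summable_iff_convergent)
    then have "convergent (\<lambda>n. (Y n x - Y 0 x) + Y 0 x)"
      by (intro convergent_add convergent_const) (simp add: sum_lessThan_telescope[of "\<lambda>k. Y k x"])
    then show "convergent (\<lambda>k. Y k x)" by simp
  qed
  define l where "l x = lim (\<lambda>k. Y k x)" for x
  have [measurable]: "l \<in> borel_measurable M"
    unfolding l_def by (rule borel_measurable_lim_metric) measurable
  have lim: "AE x in M. (\<lambda>k. Y k x) \<longlonglongrightarrow> l x"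
    using conv by eventually_elim (simp add: l_def convergent_LIMSEQ_iff)
  \<comment> \<open>Fatou's lemma along the subsequence carries the Cauchy bound over to the
    limit.\<close>
  have main: "(\<lambda>x. X n x - l x) \<in> sq_int M \<and> l2_norm M (\<lambda>x. X n x - l x) \<le> (1/4)^j"
    if n: "n \<ge> N j" for n j
  proof -
    have "(\<integral>\<^sup>+x. ennreal ((cmod (X n x - l x))\<^sup>2) \<partial>M)
        = (\<integral>\<^sup>+x. liminf (\<lambda>k. ennreal ((cmod (X n x - Y k x))\<^sup>2)) \<partial>M)"
    proof (rule nn_integral_cong_AE)
      show "AE x in M. ennreal ((cmod (X n x - l x))\<^sup>2) = liminf (\<lambda>k. ennreal ((cmod (X n x - Y k x))\<^sup>2))"
        using lim
      proof eventually_elim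
        fix x assume "(\<lambda>k. Y k x) \<longlonglongrightarrow> l x"
        then have "(\<lambda>k. ennreal ((cmod (X n x - Y k x))\<^sup>2)) \<longlonglongrightarrow> ennreal ((cmod (X n x - l x))\<^sup>2)"
          by (intro tendsto_intros)
        then show "ennreal ((cmod (X n x - l x))\<^sup>2) = liminf (\<lambda>k. ennreal ((cmod (X n x - Y k x))\<^sup>2))"
          by (intro lim_imp_Liminf[symmetric]) auto
      qed
    qed
    also have "\<dots> \<le> liminf (\<lambda>k. \<integral>\<^sup>+x. ennreal ((cmod (X n x - Y k x))\<^sup>2) \<partial>M)"
      by (rule nn_integral_liminf) measurable
    also have "\<dots> \<le> ennreal (((1/4)^j)\<^sup>2)"
    proof (rule Liminf_le)
      have "(\<integral>\<^sup>+x. ennreal ((cmod (X n x - Y k x))\<^sup>2) \<partial>M) \<le> ennreal (((1/4)^j)\<^sup>2)" if "k \<ge> N j" for k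
      proof -
        have "(\<integral>\<^sup>+x. ennreal ((cmod (X n x - Y k x))\<^sup>2) \<partial>M) = ennreal ((l2_norm M (\<lambda>x. X n x - Y k x))\<^sup>2)"
          unfolding Y_def by (rule nn_integral_l2_norm[OF sq_int_diff[OF X X]])
        also have "\<dots> \<le> ennreal (((1/4)^j)\<^sup>2)"
          unfolding Y_def
          by (intro ennreal_leI power_mono less_imp_le[OF N] l2_norm_nonneg n
              order_trans[OF that rN(3)])
        finally show ?thesis .
      qed
      then show "\<forall>\<^sub>F k in sequentially. (\<integral>\<^sup>+x. ennreal ((cmod (X n x - Y k x))\<^sup>2) \<partial>M) \<le> ennreal (((1/4)^j)\<^sup>2)"
        by (auto simp: eventually_sequentially)
    qed simp
    finally show ?thesis by (intro conjI sq_intI_nn_integral) auto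
  qed
  have l: "l \<in> sq_int M"
    using sq_int_diff[OF X[of "N 0"], of "\<lambda>x. X (N 0) x - l x"] main[of 0 "N 0"] by simp
  have "(\<lambda>n. l2_norm M (\<lambda>x. X n x - l x)) \<longlonglongrightarrow> 0"
  proof (rule LIMSEQ_I)
    fix e :: real assume "e > 0"
    then obtain j where j: "(1/4)^j < e" using real_arch_pow_inv[of e "1/4"] by auto
    then have "\<forall>n\<ge>N j. norm (l2_norm M (\<lambda>x. X n x - l x) - 0) < e"
      using main[of j] l2_norm_nonneg[of M] by (fastforce intro: le_less_trans)
    then show "\<exists>N. \<forall>n\<ge>N. norm (l2_norm M (\<lambda>x. X n x - l x) - 0) < e" by blast
  qed
  then show ?thesis using l by blast
qed

section \<open>Schur's test for integral operators\<close>

locale schur_kernel = sigma_finite_measure M for M :: "'a measure" +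
  fixes k :: "'a \<times> 'a \<Rightarrow> complex" and C :: real
  assumes k_meas [measurable]: "k \<in> borel_measurable (M \<Otimes>\<^sub>M M)"
    and C_nonneg: "0 \<le> C"
    and bound_snd: "t \<in> space M \<Longrightarrow> (\<integral>\<^sup>+x. ennreal (cmod (k (t, x))) \<partial>M) \<le> ennreal C"
    and bound_fst: "x \<in> space M \<Longrightarrow> (\<integral>\<^sup>+t. ennreal (cmod (k (t, x))) \<partial>M) \<le> ennreal C"
begin

sublocale pair_sigma_finite M M ..

lemma kernel_swap: "schur_kernel M (\<lambda>(x, t). k (t, x)) C"
  by unfold_locales (use C_nonneg bound_snd bound_fst in auto)

definition op :: "('a \<Rightarrow> complex) \<Rightarrow> 'a \<Rightarrow> complex"
  where "op \<xi> x = (LINT t|M. \<xi> t * k (t, x))"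

lemma op_measurable:
  assumes [measurable]: "\<xi> \<in> borel_measurable M"
  shows "op \<xi> \<in> borel_measurable M"
  unfolding op_def by measurable

text \<open>The Cauchy-Schwarz inequality for the measure with density \<open>\<bar>k (\<cdot>, x)\<bar>\<close>.\<close>

lemma op_pointwise:
  assumes [measurable]: "\<xi> \<in> borel_measurable M" and x [measurable]: "x \<in> space M"
  shows "ennreal ((cmod (op \<xi> x))\<^sup>2)
    \<le> ennreal C * (\<integral>\<^sup>+t. ennreal ((cmod (\<xi> t))\<^sup>2) * ennreal (cmod (k (t, x))) \<partial>M)"
proof -
  have [measurable]: "(\<lambda>t. k (t, x)) \<in> borel_measurable M" by measurable
  have "ennreal (cmod (op \<xi> x)) \<le> (\<integral>\<^sup>+t. ennreal (cmod (\<xi> t * k (t, x))) \<partial>M)"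
  proof (cases "integrable M (\<lambda>t. \<xi> t * k (t, x))")
    case True
    then show ?thesis unfolding op_def by (rule integral_norm_bound_ennreal)
  next
    \<comment> \<open>Without integrability the Bochner integral is 0 by convention, so the bound is
      trivial.\<close>
    case False
    then show ?thesis unfolding op_def by (simp add: not_integrable_integral_eq)
  qed
  also have "\<dots> = (\<integral>\<^sup>+t. ennreal (cmod (\<xi> t) * sqrt (cmod (k (t, x)))) * ennreal (sqrt (cmod (k (t, x)))) \<partial>M)"
    by (intro nn_integral_cong) (simp add: norm_mult mult.assoc flip: ennreal_mult')
  finally have "(ennreal (cmod (op \<xi> x)))\<^sup>2 \<le>
      (\<integral>\<^sup>+t. ennreal (cmod (\<xi> t) * sqrt (cmod (k (t, x)))) * ennreal (sqrt (cmod (k (t, x)))) \<partial>M)\<^sup>2"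
    by (rule power_mono) simp
  also have "\<dots> \<le> (\<integral>\<^sup>+t. (ennreal (cmod (\<xi> t) * sqrt (cmod (k (t, x)))))\<^sup>2 \<partial>M)
      * (\<integral>\<^sup>+t. (ennreal (sqrt (cmod (k (t, x)))))\<^sup>2 \<partial>M)"
    by (rule Cauchy_Schwarz_nn_integral) measurable
  also have "(\<integral>\<^sup>+t. (ennreal (sqrt (cmod (k (t, x)))))\<^sup>2 \<partial>M) = (\<integral>\<^sup>+t. ennreal (cmod (k (t, x))) \<partial>M)"
    by (simp add: ennreal_power)
  also have "(\<integral>\<^sup>+t. (ennreal (cmod (\<xi> t) * sqrt (cmod (k (t, x)))))\<^sup>2 \<partial>M)
      = (\<integral>\<^sup>+t. ennreal ((cmod (\<xi> t))\<^sup>2) * ennreal (cmod (k (t, x))) \<partial>M)"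
    by (intro nn_integral_cong) (simp add: ennreal_power power_mult_distrib flip: ennreal_mult')
  also have "(\<integral>\<^sup>+t. ennreal ((cmod (\<xi> t))\<^sup>2) * ennreal (cmod (k (t, x))) \<partial>M) * (\<integral>\<^sup>+t. ennreal (cmod (k (t, x))) \<partial>M)
      \<le> (\<integral>\<^sup>+t. ennreal ((cmod (\<xi> t))\<^sup>2) * ennreal (cmod (k (t, x))) \<partial>M) * ennreal C"
    by (intro mult_left_mono bound_fst x) simp
  finally show ?thesis by (simp add: ennreal_power mult.commute)
qed

text \<open>After exchanging the integrals by Tonelli's theorem, the inner one is a marginal of the
  kernel.\<close>

lemma kernel_weighted:
  assumes [measurable]: "\<xi> \<in> borel_measurable M"
  shows "(\<integral>\<^sup>+x. \<integral>\<^sup>+t. ennreal ((cmod (\<xi> t))\<^sup>2) * ennreal (cmod (k (t, x))) \<partial>M \<partial>M)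
    \<le> ennreal C * (\<integral>\<^sup>+t. ennreal ((cmod (\<xi> t))\<^sup>2) \<partial>M)"
proof -
  have "(\<integral>\<^sup>+x. \<integral>\<^sup>+t. ennreal ((cmod (\<xi> t))\<^sup>2) * ennreal (cmod (k (t, x))) \<partial>M \<partial>M)
      = (\<integral>\<^sup>+t. \<integral>\<^sup>+x. ennreal ((cmod (\<xi> t))\<^sup>2) * ennreal (cmod (k (t, x))) \<partial>M \<partial>M)"
    by (rule Fubini'[of "\<lambda>t x. ennreal ((cmod (\<xi> t))\<^sup>2) * ennreal (cmod (k (t, x)))"]) measurable
  also have "\<dots> = (\<integral>\<^sup>+t. ennreal ((cmod (\<xi> t))\<^sup>2) * (\<integral>\<^sup>+x. ennreal (cmod (k (t, x))) \<partial>M) \<partial>M)"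
    by (intro nn_integral_cong nn_integral_cmult) measurable
  also have "\<dots> \<le> (\<integral>\<^sup>+t. ennreal ((cmod (\<xi> t))\<^sup>2) * ennreal C \<partial>M)"
    by (intro nn_integral_mono mult_left_mono bound_snd) auto
  also have "\<dots> = ennreal C * (\<integral>\<^sup>+t. ennreal ((cmod (\<xi> t))\<^sup>2) \<partial>M)"
    by (subst nn_integral_multc) (auto simp: mult.commute)
  finally show ?thesis .
qed

text \<open>One factor \<open>C\<close> comes from Cauchy-Schwarz, where the kernel is integrated
  over t, and the other from \<open>kernel_weighted\<close>, where it is integrated over x; together
  they give C^2 for the squared norm.\<close>

lemma
  assumes \<xi>: "\<xi> \<in> sq_int M"
  shows op_sq_int: "op \<xi> \<in> sq_int M" and op_bound: "l2_norm M (op \<xi>) \<le> C * l2_norm M \<xi>"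
proof -
  note [measurable] = sq_int_measurable[OF \<xi>]
  have "(\<integral>\<^sup>+x. ennreal ((cmod (op \<xi> x))\<^sup>2) \<partial>M)
      \<le> (\<integral>\<^sup>+x. ennreal C * (\<integral>\<^sup>+t. ennreal ((cmod (\<xi> t))\<^sup>2) * ennreal (cmod (k (t, x))) \<partial>M) \<partial>M)"
    by (intro nn_integral_mono op_pointwise) auto
  also have "\<dots> = ennreal C * (\<integral>\<^sup>+x. \<integral>\<^sup>+t. ennreal ((cmod (\<xi> t))\<^sup>2) * ennreal (cmod (k (t, x))) \<partial>M \<partial>M)"
    by (rule nn_integral_cmult) measurable
  also have "\<dots> \<le> ennreal C * (ennreal C * (\<integral>\<^sup>+t. ennreal ((cmod (\<xi> t))\<^sup>2) \<partial>M))"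
    by (intro mult_left_mono kernel_weighted) auto
  also have "\<dots> = ennreal ((C * l2_norm M \<xi>)\<^sup>2)"
    unfolding nn_integral_l2_norm[OF \<xi>] using C_nonneg
    by (simp add: power2_eq_square algebra_simps l2_norm_nonneg flip: ennreal_mult')
  finally have "(\<integral>\<^sup>+x. ennreal ((cmod (op \<xi> x))\<^sup>2) \<partial>M) \<le> ennreal ((C * l2_norm M \<xi>)\<^sup>2)" .
  from sq_intI_nn_integral[OF op_measurable this]
  show "op \<xi> \<in> sq_int M" "l2_norm M (op \<xi>) \<le> C * l2_norm M \<xi>"
    using C_nonneg l2_norm_nonneg[of M \<xi>] by auto
qed

text \<open>Fubini's theorem. Joint integrability holds because the product of the absolute values
  of xi t and eta x is at most the sum of their squares; weighted by the kernel, each square is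
  handled by \<open>kernel_weighted\<close>, the second one with the variables of the kernel
  exchanged.\<close>

lemma op_dual:
  assumes \<xi>: "\<xi> \<in> sq_int M" and \<eta>: "\<eta> \<in> sq_int M"
  shows "(LINT x|M. op \<xi> x * \<eta> x) = (LINT t|M. \<xi> t * (LINT x|M. k (t, x) * \<eta> x))"
proof -
  note [measurable] = sq_int_measurable[OF \<xi>] sq_int_measurable[OF \<eta>]
  let ?f = "\<lambda>(t, x). \<xi> t * k (t, x) * \<eta> x"
  have int: "integrable (M \<Otimes>\<^sub>M M) ?f"
  proof (rule integrableI_bounded)
    show "?f \<in> borel_measurable (M \<Otimes>\<^sub>M M)" by measurable
    have le: "cmod (?f p) \<le> (cmod (\<xi> (fst p)))\<^sup>2 * cmod (k p) + (cmod (\<eta> (snd p)))\<^sup>2 * cmod (k p)" for p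
    proof -
      have "cmod (\<xi> (fst p)) * cmod (\<eta> (snd p)) \<le> (cmod (\<xi> (fst p)))\<^sup>2 + (cmod (\<eta> (snd p)))\<^sup>2"
        using sum_squares_bound[of "cmod (\<xi> (fst p))" "cmod (\<eta> (snd p))"]
          mult_nonneg_nonneg[of "cmod (\<xi> (fst p))" "cmod (\<eta> (snd p))"] by (simp del: mult_nonneg_nonneg)
      from mult_right_mono[OF this, of "cmod (k p)"] show ?thesis
        by (simp add: case_prod_beta norm_mult algebra_simps)
    qed
    have sf: "sigma_finite_measure M" by unfold_locales
    interpret s: schur_kernel M "\<lambda>(x, t). k (t, x)" C by (rule kernel_swap)
    have "(\<integral>\<^sup>+p. ennreal (cmod (?f p)) \<partial>(M \<Otimes>\<^sub>M M)) \<le>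
       (\<integral>\<^sup>+p. ennreal ((cmod (\<xi> (fst p)))\<^sup>2) * ennreal (cmod (k p))
          + ennreal ((cmod (\<eta> (snd p)))\<^sup>2) * ennreal (cmod (k p)) \<partial>(M \<Otimes>\<^sub>M M))"
      using le by (intro nn_integral_mono) (simp add: ennreal_leI flip: ennreal_mult' ennreal_plus)
    also have "\<dots> = (\<integral>\<^sup>+p. ennreal ((cmod (\<xi> (fst p)))\<^sup>2) * ennreal (cmod (k p)) \<partial>(M \<Otimes>\<^sub>M M))
        + (\<integral>\<^sup>+p. ennreal ((cmod (\<eta> (snd p)))\<^sup>2) * ennreal (cmod (k p)) \<partial>(M \<Otimes>\<^sub>M M))"
      by (rule nn_integral_add) measurable
    also have "(\<integral>\<^sup>+p. ennreal ((cmod (\<xi> (fst p)))\<^sup>2) * ennreal (cmod (k p)) \<partial>(M \<Otimes>\<^sub>M M))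
        = (\<integral>\<^sup>+x. \<integral>\<^sup>+t. ennreal ((cmod (\<xi> t))\<^sup>2) * ennreal (cmod (k (t, x))) \<partial>M \<partial>M)"
      by (subst nn_integral_snd[symmetric]) auto
    also have "(\<integral>\<^sup>+p. ennreal ((cmod (\<eta> (snd p)))\<^sup>2) * ennreal (cmod (k p)) \<partial>(M \<Otimes>\<^sub>M M))
        = (\<integral>\<^sup>+t. \<integral>\<^sup>+x. ennreal ((cmod (\<eta> x))\<^sup>2) * ennreal (cmod (k (t, x))) \<partial>M \<partial>M)"
      by (subst sigma_finite_measure.nn_integral_fst[OF sf, of "\<lambda>p. ennreal ((cmod (\<eta> (snd p)))\<^sup>2) * ennreal (cmod (k p))", symmetric]) auto
    also have "(\<integral>\<^sup>+x. \<integral>\<^sup>+t. ennreal ((cmod (\<xi> t))\<^sup>2) * ennreal (cmod (k (t, x))) \<partial>M \<partial>M)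
        + (\<integral>\<^sup>+t. \<integral>\<^sup>+x. ennreal ((cmod (\<eta> x))\<^sup>2) * ennreal (cmod (k (t, x))) \<partial>M \<partial>M)
      \<le> ennreal C * ennreal ((l2_norm M \<xi>)\<^sup>2) + ennreal C * ennreal ((l2_norm M \<eta>)\<^sup>2)"
      unfolding nn_integral_l2_norm[OF \<xi>, symmetric] nn_integral_l2_norm[OF \<eta>, symmetric]
      using s.kernel_weighted[of \<eta>] by (intro add_mono kernel_weighted) auto
    also have "\<dots> < \<infinity>" by (simp add: ennreal_mult_less_top)
    finally show "(\<integral>\<^sup>+p. ennreal (norm (?f p)) \<partial>(M \<Otimes>\<^sub>M M)) < \<infinity>" .
  qed
  have "(LINT x|M. op \<xi> x * \<eta> x) = (LINT x|M. LINT t|M. ?f (t, x))"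
    unfolding op_def by simp
  also have "\<dots> = (LINT t|M. LINT x|M. ?f (t, x))"
    using Fubini_integral[of "\<lambda>t x. ?f (t, x)"] int by simp
  also have "\<dots> = (LINT t|M. \<xi> t * (LINT x|M. k (t, x) * \<eta> x))"
    by (simp add: mult.assoc)
  finally show ?thesis .
qed

end

section \<open>Compactly supported functions and locally finite Borel measures\<close>

lemma CcI:
  fixes f :: "'a::t2_space \<Rightarrow> complex"
  assumes "continuous_on UNIV f" "compact L" "\<And>x. f x \<noteq> 0 \<Longrightarrow> x \<in> L"
  shows "f \<in> Cc"
proof -
  have "closure {x. f x \<noteq> 0} \<subseteq> L"
    using assms by (intro closure_minimal compact_imp_closed) auto
  then have "closure {x. f x \<noteq> 0} = L \<inter> closure {x. f x \<noteq> 0}" by blast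
  then have "compact (closure {x. f x \<noteq> 0})"
    using compact_Int_closed[OF assms(2) closed_closure] by metis
  then show ?thesis unfolding Cc_def using assms(1) by simp
qed

lemma Cc_continuous: "f \<in> Cc \<Longrightarrow> continuous_on UNIV f"
  unfolding Cc_def by simp

lemma Cc_supportE:
  assumes "f \<in> Cc"
  obtains L where "compact L" "\<forall>x. f x \<noteq> 0 \<longrightarrow> x \<in> L"
  using assms closure_subset[of "{x. f x \<noteq> 0}"] unfolding Cc_def by blast

lemma Cc_comp:
  fixes f :: "'a::t2_space \<Rightarrow> complex"
  assumes "f \<in> Cc" "continuous_on UNIV \<phi>" "\<phi> 0 = 0"
  shows "(\<lambda>x. \<phi> (f x)) \<in> Cc"
proof -
  obtain L where L: "compact L" "\<forall>x. f x \<noteq> 0 \<longrightarrow> x \<in> L" by (rule Cc_supportE[OF assms(1)])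
  show ?thesis
    by (rule CcI[OF continuous_on_compose2[OF assms(2) Cc_continuous[OF assms(1)]] L(1)])
       (use L assms(3) in force)+
qed

lemma Cc_mult:
  fixes f :: "'a::t2_space \<Rightarrow> complex"
  assumes "f \<in> Cc" "continuous_on UNIV g"
  shows "(\<lambda>x. f x * g x) \<in> Cc"
proof -
  obtain L where L: "compact L" "\<forall>x. f x \<noteq> 0 \<longrightarrow> x \<in> L" by (rule Cc_supportE[OF assms(1)])
  show ?thesis
    by (rule CcI[OF continuous_on_mult[OF Cc_continuous[OF assms(1)] assms(2)] L(1)])
       (use L in auto)
qed

lemma Cc_add:
  fixes f :: "'a::t2_space \<Rightarrow> complex"
  assumes "f \<in> Cc" "g \<in> Cc"
  shows "(\<lambda>x. f x + g x) \<in> Cc"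
proof -
  obtain L where L: "compact L" "\<forall>x. f x \<noteq> 0 \<longrightarrow> x \<in> L" by (rule Cc_supportE[OF assms(1)])
  obtain K where K: "compact K" "\<forall>x. g x \<noteq> 0 \<longrightarrow> x \<in> K" by (rule Cc_supportE[OF assms(2)])
  show ?thesis
  proof (rule CcI[OF _ compact_Un[OF L(1) K(1)]])
    show "continuous_on UNIV (\<lambda>x. f x + g x)"
      by (intro continuous_on_add Cc_continuous assms)
    fix x assume "f x + g x \<noteq> 0"
    then have "f x \<noteq> 0 \<or> g x \<noteq> 0" by auto
    then show "x \<in> L \<union> K" using L(2) K(2) by blast
  qed
qed

lemma Cc_cmult: "f \<in> Cc \<Longrightarrow> (\<lambda>x. c * f x) \<in> Cc" for f :: "'a::t2_space \<Rightarrow> complex"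
  by (erule Cc_comp) (auto intro!: continuous_intros)

lemma Cc_zero: "(\<lambda>x::'a::t2_space. 0) \<in> Cc"
  by (rule CcI[where L="{}"]) auto

lemma Cc_cmod: "f \<in> Cc \<Longrightarrow> (\<lambda>x. complex_of_real (cmod (f x))) \<in> Cc" for f :: "'a::t2_space \<Rightarrow> complex"
  by (erule Cc_comp) (auto intro!: continuous_intros)

lemma Cc_cmod_sq: "f \<in> Cc \<Longrightarrow> (\<lambda>x. complex_of_real ((cmod (f x))\<^sup>2)) \<in> Cc"
  for f :: "'a::t2_space \<Rightarrow> complex"
  by (erule Cc_comp) (auto intro!: continuous_intros)

lemma Cc_borel: "f \<in> Cc \<Longrightarrow> f \<in> borel_measurable borel"
  by (intro borel_measurable_continuous_onI Cc_continuous)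

lemma Cc_bounded:
  assumes "f \<in> Cc" obtains B where "0 \<le> B" "\<forall>x. cmod (f x) \<le> B"
proof -
  have "compact (f ` closure {x. f x \<noteq> 0})"
    using assms unfolding Cc_def by (auto intro: compact_continuous_image continuous_on_subset)
  then obtain B where B: "\<And>x. x \<in> closure {x. f x \<noteq> 0} \<Longrightarrow> cmod (f x) \<le> B"
    using compact_imp_bounded bounded_iff by (metis imageI)
  have "cmod (f x) \<le> \<bar>B\<bar>" for x
    using B[of x] closure_subset[of "{x. f x \<noteq> 0}"] by (cases "f x = 0") force+
  then show thesis by (intro that[of "\<bar>B\<bar>"]) auto
qed

section \<open>Cutoff functions and continuous extension in locally compact spaces\<close>

context
  assumes lc: "locally_compact_space (euclidean :: 'a::{t2_space, second_countable_topology} topology)"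
begin

lemma completely_regular: "completely_regular_space (euclidean :: 'a topology)"
proof -
  have "Hausdorff_space (euclidean :: 'a topology)"
    unfolding Hausdorff_space_def disjnt_def using hausdorff by auto
  then show ?thesis using locally_compact_regular_imp_completely_regular_space[OF lc] by simp
qed

lemma compact_neighbourhood:
  fixes K :: "'a set"
  assumes "compact K" obtains W L where "open W" "compact L" "K \<subseteq> W" "W \<subseteq> L"
proof -
  have "\<exists>U L. open U \<and> compact L \<and> x \<in> U \<and> U \<subseteq> L" for x :: 'a
    using lc unfolding locally_compact_space_def by simp
  then obtain U L where UL: "\<And>x::'a. open (U x)" "\<And>x. compact (L x)" "\<And>x. x \<in> U x" "\<And>x. U x \<subseteq> L x"
    by metis
  have "K \<subseteq> (\<Union>x\<in>K. U x)" using UL(3) by blast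
  then obtain C where C: "C \<subseteq> K" "finite C" "K \<subseteq> (\<Union>x\<in>C. U x)"
    by (rule compactE_image[OF assms UL(1)])
  show thesis
    by (rule that[of "\<Union>x\<in>C. U x" "\<Union>x\<in>C. L x"]) (use UL C in \<open>blast intro: compact_UN finite_subset\<close>)+
qed

text \<open>The compact set is separated not from the complement of \<open>U\<close> but from that
  of U \<inter> W with \<open>W\<close> relatively compact, so the support of the function is
  compact.\<close>

lemma urysohn_Cc:
  fixes K :: "'a set"
  assumes K: "compact K" and U: "open U" and "K \<subseteq> U"
  obtains h :: "'a \<Rightarrow> real" where "continuous_on UNIV h" "\<And>x. 0 \<le> h x" "\<And>x. h x \<le> 1"
    "\<And>x. x \<in> K \<Longrightarrow> h x = 1" "\<And>x. h x \<noteq> 0 \<Longrightarrow> x \<in> U" "(\<lambda>x. complex_of_real (h x)) \<in> Cc"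
proof -
  obtain W L where WL: "open W" "compact L" "K \<subseteq> W" "W \<subseteq> L" by (rule compact_neighbourhood[OF K])
  have "closedin euclidean (- (U \<inter> W))" "compactin euclidean K" "disjnt (- (U \<inter> W)) K"
    using assms WL by (auto simp: disjnt_def)
  then obtain f where f: "continuous_map euclidean (subtopology euclidean {0..1::real}) f"
    "f ` K \<subseteq> {0}" "f ` (- (U \<inter> W)) \<subseteq> {1}"
    using Urysohn_completely_regular_closed_compact[OF zero_le_one completely_regular] by metis
  have cf: "continuous_on UNIV f" and f01: "\<And>x. 0 \<le> f x" "\<And>x. f x \<le> 1"
    using f(1) by (auto simp: continuous_map_in_subtopology)
  let ?h = "\<lambda>x. 1 - f x"
  have ch: "continuous_on UNIV ?h" by (intro continuous_intros cf)
  have supp: "x \<in> U \<inter> W" if "?h x \<noteq> 0" for x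
    using f(3) that by (cases "x \<in> U \<inter> W") auto
  have "(\<lambda>x. complex_of_real (?h x)) \<in> Cc"
    by (rule CcI[OF _ WL(2)]) (use supp WL ch in \<open>auto intro!: continuous_intros cf\<close>)
  then show thesis
    using ch f01 f(2) supp by (intro that[of ?h]) auto
qed

text \<open>Real and imaginary parts are extended separately. The purpose is to continue t \<mapsto>
  F (t^-1 x) from a compact part of one fibre to the whole groupoid.\<close>

lemma tietze_complex:
  fixes f :: "'a \<Rightarrow> complex"
  assumes S: "compact S" and f: "continuous_on S f"
  obtains g where "continuous_on UNIV g" "\<And>x. x \<in> S \<Longrightarrow> g x = f x"
proof -
  have c: "continuous_map (subtopology euclidean S) euclidean (\<lambda>x. Re (f x))"
    "continuous_map (subtopology euclidean S) euclidean (\<lambda>x. Im (f x))"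
    using f by (auto intro!: continuous_intros)
  obtain g1 where g1: "continuous_map euclidean euclideanreal g1" "\<And>x. x \<in> S \<Longrightarrow> g1 x = Re (f x)"
    using Tietze_extension_completely_regular[OF completely_regular _ is_interval_univ _ c(1)] S
    by (metis UNIV_not_empty compactin_euclidean_iff subset_UNIV)
  obtain g2 where g2: "continuous_map euclidean euclideanreal g2" "\<And>x. x \<in> S \<Longrightarrow> g2 x = Im (f x)"
    using Tietze_extension_completely_regular[OF completely_regular _ is_interval_univ _ c(2)] S
    by (metis UNIV_not_empty compactin_euclidean_iff subset_UNIV)
  show thesis
    by (rule that[of "\<lambda>x. Complex (g1 x) (g2 x)"])
       (use g1 g2 in \<open>auto simp: complex_eq_iff Complex_eq intro!: continuous_intros\<close>)
qed

end

text \<open>These sets tie integrals of \<open>Cc\<close> functions to Borel sets: products give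
  intersections, compact supports give finite measure, and \<open>step\<close> approximates the
  indicators.\<close>

definition cozero :: "'a::topological_space set set"
  where "cozero = {{x. h x \<noteq> 0} |h::'a \<Rightarrow> complex. h \<in> Cc}"

lemma cozero_open: "A \<in> cozero \<Longrightarrow> open A"
  unfolding cozero_def by (auto dest!: Cc_continuous intro!: open_Collect_neq continuous_on_const)

lemma cozero_Int: "A \<in> cozero \<Longrightarrow> B \<in> cozero \<Longrightarrow> A \<inter> B \<in> cozero"
  for A :: "'a::t2_space set"
proof -
  assume "A \<in> cozero" "B \<in> cozero"
  then obtain f g where fg: "f \<in> Cc" "g \<in> Cc" "A = {x. f x \<noteq> 0}" "B = {x. g x \<noteq> 0}"
    unfolding cozero_def by blast
  then show ?thesis
    unfolding cozero_def using Cc_mult[OF fg(1) Cc_continuous[OF fg(2)]]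
    by (intro CollectI exI[of _ "\<lambda>x. f x * g x"]) auto
qed

text \<open>Absolute values prevent cancellation in the sum of the two defining functions.\<close>

lemma cozero_Un: "A \<in> cozero \<Longrightarrow> B \<in> cozero \<Longrightarrow> A \<union> B \<in> cozero"
  for A :: "'a::t2_space set"
proof -
  assume "A \<in> cozero" "B \<in> cozero"
  then obtain f g where fg: "f \<in> Cc" "g \<in> Cc" "A = {x. f x \<noteq> 0}" "B = {x. g x \<noteq> 0}"
    unfolding cozero_def by blast
  have "(\<lambda>x. complex_of_real (cmod (f x)) + complex_of_real (cmod (g x))) \<in> Cc"
    by (intro Cc_add Cc_cmod fg)
  moreover have "complex_of_real (cmod (f x)) + complex_of_real (cmod (g x)) \<noteq> 0 \<longleftrightarrow> f x \<noteq> 0 \<or> g x \<noteq> 0" for x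
    using norm_ge_zero[of "f x"] norm_ge_zero[of "g x"]
    by (simp add: add_nonneg_eq_0_iff flip: of_real_add)
  ultimately show ?thesis
    unfolding cozero_def
    by (intro CollectI exI[of _ "\<lambda>x. complex_of_real (cmod (f x)) + complex_of_real (cmod (g x))"])
       (auto simp: fg)
qed

lemma cozero_empty: "{} \<in> (cozero :: 'a::t2_space set set)"
  unfolding cozero_def using Cc_zero by force

text \<open>Urysohn functions at single points cover the open set by cozero sets, and the Lindelof
  property of a second countable space makes the cover countable.\<close>

lemma open_countable_cozero:
  fixes U :: "'a::{t2_space, second_countable_topology} set"
  assumes lc: "locally_compact_space (euclidean :: 'a topology)" and U: "open U"
  obtains F where "countable F" "F \<subseteq> cozero" "\<Union>F = U"
proof -
  let ?F = "{A \<in> cozero. A \<subseteq> U}"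
  have "\<exists>A\<in>?F. x \<in> A" if x: "x \<in> U" for x
  proof -
    obtain h :: "'a \<Rightarrow> real" where "\<And>y. y \<in> {x} \<Longrightarrow> h y = 1" "\<And>y. h y \<noteq> 0 \<Longrightarrow> y \<in> U"
      "(\<lambda>y. complex_of_real (h y)) \<in> Cc"
      using urysohn_Cc[OF lc compact_sing U, of x] x by (metis empty_subsetI insert_subset)
    then show ?thesis
      by (intro bexI[of _ "{y. complex_of_real (h y) \<noteq> 0}"])
         (auto simp: cozero_def intro!: exI[of _ "\<lambda>y. complex_of_real (h y)"])
  qed
  then have "\<Union>?F = U" by blast
  moreover obtain F' where "F' \<subseteq> ?F" "countable F'" "\<Union>F' = \<Union>?F"
    using Lindelof[of ?F] cozero_open by blast
  ultimately show thesis using that[of F'] by blast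
qed

lemma sets_borel_cozero:
  assumes lc: "locally_compact_space (euclidean :: 'a::{t2_space, second_countable_topology} topology)"
  shows "sets (borel :: 'a measure) = sigma_sets UNIV cozero"
  unfolding sets_borel
proof (rule sigma_sets_eqI)
  fix U :: "'a set" assume "U \<in> {S. open S}"
  then obtain F where F: "countable F" "F \<subseteq> cozero" "\<Union>F = U"
    using open_countable_cozero[OF lc] by auto
  have "\<Union>F \<in> sigma_sets UNIV cozero"
    by (rule sigma_sets_UNION[OF F(1)]) (use F(2) in auto)
  then show "U \<in> sigma_sets UNIV cozero" using F by simp
qed (auto dest: cozero_open)

text \<open>As n grows, these functions increase to the indicator of the set where \<open>h\<close>
  is nonzero.\<close>

definition step :: "('a \<Rightarrow> complex) \<Rightarrow> nat \<Rightarrow> 'a \<Rightarrow> complex"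
  where "step h n x = complex_of_real (min 1 (real n * cmod (h x)))"

lemma step_Cc: "h \<in> Cc \<Longrightarrow> step h n \<in> Cc" for h :: "'a::t2_space \<Rightarrow> complex"
  unfolding step_def[abs_def] by (erule Cc_comp) (auto intro!: continuous_intros)

lemma step_tendsto: "(\<lambda>n. step h n x) \<longlonglongrightarrow> indicator {x. h x \<noteq> 0} x"
proof (cases "h x = 0")
  case False
  obtain N where N: "1 / cmod (h x) < real N" using reals_Archimedean2 by blast
  have "step h n x = 1" if "n \<ge> N" for n
  proof -
    have "1 / cmod (h x) \<le> real n" using that N by linarith
    then have "1 \<le> real n * cmod (h x)" using False by (simp add: field_simps)
    then show ?thesis unfolding step_def by simp
  qed
  then have "(\<lambda>n. step h n x) \<longlonglongrightarrow> 1"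
    by (intro tendsto_eventually) (auto simp: eventually_sequentially)
  then show ?thesis using False by simp
qed (simp add: step_def)

lemma step_bound: "cmod (step h n x) \<le> indicator {x. h x \<noteq> 0} x"
  unfolding step_def by (auto simp: indicator_def)

locale locally_finite_borel =
  fixes M :: "'a::{t2_space, second_countable_topology} measure"
  assumes lc: "locally_compact_space (euclidean :: 'a topology)"
    and sets_M: "sets M = sets borel"
    and finite_compact: "compact K \<Longrightarrow> emeasure M K < \<infinity>"
begin

lemma borel_M: "borel_measurable M = borel_measurable borel"
  by (rule measurable_cong_sets[OF sets_M refl])

lemma cozero_finite:
  assumes "A \<in> cozero" shows "A \<in> sets M" "emeasure M A < \<infinity>"
proof -
  obtain h where h: "h \<in> Cc" "A = {x. h x \<noteq> 0}" using assms unfolding cozero_def by blast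
  obtain L where L: "compact L" "\<forall>x. h x \<noteq> 0 \<longrightarrow> x \<in> L" by (rule Cc_supportE[OF h(1)])
  show "A \<in> sets M" using cozero_open[OF assms] sets_M by simp
  have "emeasure M A \<le> emeasure M L"
    by (rule emeasure_mono) (use h L sets_M borel_closed[OF compact_imp_closed] in auto)
  then show "emeasure M A < \<infinity>" using finite_compact[OF L(1)] by (rule le_less_trans)
qed

lemma Cc_integrable:
  assumes f: "f \<in> Cc" shows "integrable M f"
proof -
  obtain B where B: "\<forall>x. cmod (f x) \<le> B" by (rule Cc_bounded[OF f])
  have A: "{x. f x \<noteq> 0} \<in> cozero" unfolding cozero_def using f by blast
  show ?thesis
  proof (rule Bochner_Integration.integrable_bound)
    show "integrable M (\<lambda>x. indicator {x. f x \<noteq> 0} x * B)"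
      using cozero_finite[OF A] by (intro integrable_mult_left) (simp add: integrable_indicator_iff)
    have "cmod (f x) \<le> indicator {x. f x \<noteq> 0} x * B" for x
      using B by (auto simp: indicator_def)
    then show "AE x in M. norm (f x) \<le> norm (indicator {x. f x \<noteq> 0} x * B)"
      by (intro AE_I2) (simp add: order_trans[OF _ abs_ge_self])
    show "f \<in> borel_measurable M" unfolding borel_M by (rule Cc_borel[OF f])
  qed
qed

text \<open>Finite unions of a countable cozero cover form an increasing sequence of sets, each of
  finite measure.\<close>

lemma exhaustion:
  obtains C :: "nat \<Rightarrow> 'a set" where "\<And>n. C n \<in> cozero" "incseq C" "(\<Union>n. C n) = UNIV"
proof -
  obtain F :: "'a set set" where F: "countable F" "F \<subseteq> cozero" "\<Union>F = UNIV"
    by (rule open_countable_cozero[OF lc open_UNIV])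
  then have "F \<noteq> {}" by auto
  then obtain B :: "nat \<Rightarrow> 'a set" where B: "F = range B"
    using range_from_nat_into[OF _ F(1)] by metis
  define C where "C n = (\<Union>i<n. B i)" for n :: nat
  have "C n \<in> cozero" for n
    by (induction n) (use B F(2) in \<open>auto simp: C_def cozero_empty lessThan_Suc intro!: cozero_Un\<close>)
  moreover have "incseq C" unfolding C_def by (intro monoI UN_mono) auto
  moreover have "(\<Union>n. C n) = UNIV" using F(3) unfolding C_def B by blast
  ultimately show thesis by (rule that)
qed

text \<open>Dominated convergence: \<open>step h n\<close> lies below the indicator of a set of
  finite measure, which is also its limit.\<close>

lemma measure_cozero_limit:
  assumes h: "h \<in> Cc"
  shows "(\<lambda>n. LINT x|M. step h n x) \<longlonglongrightarrow> of_real (measure M {x. h x \<noteq> 0})"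
proof -
  have A: "{x. h x \<noteq> 0} \<in> cozero" unfolding cozero_def using h by blast
  have "(\<lambda>n. LINT x|M. step h n x) \<longlonglongrightarrow> (LINT x|M. indicator {x. h x \<noteq> 0} x)"
  proof (rule integral_dominated_convergence[where w="indicator {x. h x \<noteq> 0}"])
    show "integrable M (indicator {x. h x \<noteq> 0} :: 'a \<Rightarrow> real)"
      using cozero_finite[OF A] by (simp add: integrable_indicator_iff)
    show "step h n \<in> borel_measurable M" for n
      unfolding borel_M by (rule Cc_borel[OF step_Cc[OF h]])
    show "AE x in M. (\<lambda>n. step h n x) \<longlonglongrightarrow> indicator {x. h x \<noteq> 0} x"
      by (rule AE_I2) (rule step_tendsto)
    show "AE x in M. norm (step h n x) \<le> indicator {x. h x \<noteq> 0} x" for n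
      by (rule AE_I2) (rule step_bound)
  qed (use cozero_finite(1)[OF A] in auto)
  also have "(LINT x|M. indicator {x. h x \<noteq> 0} x) = (LINT x|M. complex_of_real (indicator {x. h x \<noteq> 0} x))"
    by (intro Bochner_Integration.integral_cong) (auto simp: indicator_def)
  also have "\<dots> = complex_of_real (measure M {x. h x \<noteq> 0})"
    using cozero_finite[OF A] sets_eq_imp_space_eq[OF sets_M] by (simp add: integral_complex_of_real)
  finally show ?thesis .
qed

end

text \<open>The uniqueness half of the Riesz representation theorem. Integrals of \<open>Cc\<close>
  functions determine the measures of cozero sets, and these form a generator stable under
  intersection that contains an exhaustion by sets of finite measure.\<close>

lemma locally_finite_borel_eqI:
  fixes M N :: "'a::{t2_space, second_countable_topology} measure"
  assumes "locally_finite_borel M" "locally_finite_borel N"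
    and eq: "\<And>f. f \<in> Cc \<Longrightarrow> (LINT x|M. f x) = (LINT x|N. f x)"
  shows "M = N"
proof -
  interpret M: locally_finite_borel M by fact
  interpret N: locally_finite_borel N by fact
  obtain C :: "nat \<Rightarrow> 'a set" where C: "\<And>n. C n \<in> cozero" "(\<Union>n. C n) = UNIV"
    using M.exhaustion by metis
  show ?thesis
  proof (rule measure_eqI_generator_eq[where E=cozero and \<Omega>=UNIV and A=C])
    show "Int_stable (cozero :: 'a set set)" using cozero_Int unfolding Int_stable_def by blast
    show "sets M = sigma_sets UNIV cozero" "sets N = sigma_sets UNIV cozero"
      using sets_borel_cozero[OF M.lc] M.sets_M N.sets_M by auto
    fix A :: "'a set" assume A: "A \<in> cozero"
    then obtain h where h: "h \<in> Cc" "A = {x. h x \<noteq> 0}" unfolding cozero_def by blast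
    have "complex_of_real (measure M A) = complex_of_real (measure N A)"
      using M.measure_cozero_limit[OF h(1)] N.measure_cozero_limit[OF h(1)]
      unfolding eq[OF step_Cc[OF h(1)]] h(2) by (rule LIMSEQ_unique)
    then show "emeasure M A = emeasure N A"
      using M.cozero_finite[OF A] N.cozero_finite[OF A]
      by (simp add: emeasure_eq_ennreal_measure less_top)
  qed (use C M.cozero_finite in \<open>auto simp: less_top\<close>)
qed

section \<open>Density of \<open>Cc\<close> in L1 and L2\<close>

context locally_finite_borel
begin

definition approximable :: "('a \<Rightarrow> complex) \<Rightarrow> bool"
  where "approximable f \<longleftrightarrow> integrable M f \<and> (\<forall>e>0. \<exists>g\<in>Cc. (LINT x|M. cmod (f x - g x)) < e)"

lemma approximable_integrable: "approximable f \<Longrightarrow> integrable M f"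
  unfolding approximable_def by blast

lemma approximable_Cc: "f \<in> Cc \<Longrightarrow> approximable f"
  unfolding approximable_def using Cc_integrable by (auto intro!: bexI[of _ f])

lemma approximable_add:
  assumes f: "approximable f" and g: "approximable g"
  shows "approximable (\<lambda>x. f x + g x)"
  unfolding approximable_def
proof (intro conjI allI impI)
  note [simp] = approximable_integrable[OF f] approximable_integrable[OF g]
  show "integrable M (\<lambda>x. f x + g x)" by simp
  fix e :: real assume e: "e > 0"
  obtain f' where f': "f' \<in> Cc" "(LINT x|M. cmod (f x - f' x)) < e/2"
    using f e unfolding approximable_def by (meson half_gt_zero)
  obtain g' where g': "g' \<in> Cc" "(LINT x|M. cmod (g x - g' x)) < e/2"
    using g e unfolding approximable_def by (meson half_gt_zero)
  note [simp] = Cc_integrable[OF f'(1)] Cc_integrable[OF g'(1)]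
  have "(LINT x|M. cmod (f x + g x - (f' x + g' x))) \<le> (LINT x|M. cmod (f x - f' x) + cmod (g x - g' x))"
    by (intro integral_mono) (auto intro: norm_diff_triangle_ineq)
  also have "\<dots> < e" using f' g' by simp
  finally show "\<exists>h\<in>Cc. (LINT x|M. cmod (f x + g x - h x)) < e"
    by (intro bexI[OF _ Cc_add[OF f'(1) g'(1)]])
qed

lemma approximable_cmult:
  assumes f: "approximable f"
  shows "approximable (\<lambda>x. c * f x)"
  unfolding approximable_def
proof (intro conjI allI impI)
  note [simp] = approximable_integrable[OF f]
  show "integrable M (\<lambda>x. c * f x)" by simp
  fix e :: real assume e: "e > 0"
  have p: "cmod c + 1 > 0" by (simp add: add_nonneg_pos)
  then obtain g where g: "g \<in> Cc" "(LINT x|M. cmod (f x - g x)) < e / (cmod c + 1)"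
    using f e unfolding approximable_def by (meson divide_pos_pos)
  note [simp] = Cc_integrable[OF g(1)]
  have "(LINT x|M. cmod (c * f x - c * g x)) = cmod c * (LINT x|M. cmod (f x - g x))"
    by (simp add: norm_mult flip: right_diff_distrib)
  also have "\<dots> \<le> (cmod c + 1) * (LINT x|M. cmod (f x - g x))"
    by (intro mult_right_mono) auto
  also have "\<dots> < e" using g(2) p by (simp add: field_simps)
  finally show "\<exists>h\<in>Cc. (LINT x|M. cmod (c * f x - h x)) < e"
    by (intro bexI[OF _ Cc_cmult[OF g(1)]])
qed

text \<open>By dominated convergence the functions converge in L1, so half of e goes to the distance
  from some member of the sequence and half to approximating that member.\<close>

lemma approximable_lim:
  fixes s :: "nat \<Rightarrow> 'a \<Rightarrow> complex"
  assumes s: "\<And>n. approximable (s n)" and f: "f \<in> borel_measurable M"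
    and lim: "\<And>x. (\<lambda>n. s n x) \<longlonglongrightarrow> f x"
    and w: "integrable M w" and le: "\<And>n x. cmod (s n x) \<le> w x"
  shows "approximable f"
  unfolding approximable_def
proof (intro conjI allI impI)
  note [measurable] = f borel_measurable_integrable[OF approximable_integrable[OF s]]
  have fw: "cmod (f x) \<le> w x" for x
    by (rule LIMSEQ_le_const2[OF tendsto_norm[OF lim[of x]]]) (use le in auto)
  show int: "integrable M f"
    by (rule Bochner_Integration.integrable_bound[OF w f]) (use fw in \<open>auto intro: AE_I2 order_trans[OF _ abs_ge_self]\<close>)
  have "(\<lambda>n. LINT x|M. cmod (f x - s n x)) \<longlonglongrightarrow> (LINT x|M. 0)"
  proof (rule integral_dominated_convergence[where w="\<lambda>x. 2 * w x"])
    have "(\<lambda>n. cmod (f x - s n x)) \<longlonglongrightarrow> 0" for x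
    proof -
      have "(\<lambda>n. cmod (f x - s n x)) \<longlonglongrightarrow> cmod (f x - f x)" by (intro tendsto_intros lim)
      then show ?thesis by simp
    qed
    then show "AE x in M. (\<lambda>n. cmod (f x - s n x)) \<longlonglongrightarrow> 0" by simp
    have "norm (cmod (f x - s n x)) \<le> 2 * w x" for n x
      using norm_triangle_ineq4[of "f x" "s n x"] fw[of x] le[of n x] by simp
    then show "AE x in M. norm (cmod (f x - s n x)) \<le> 2 * w x" for n by simp
  qed (use w in auto)
  then have l: "(\<lambda>n. LINT x|M. cmod (f x - s n x)) \<longlonglongrightarrow> 0" by simp
  fix e :: real assume e: "e > 0"
  then obtain n where n: "(LINT x|M. cmod (f x - s n x)) < e/2"
    using order_tendstoD(2)[OF l, of "e/2"] by (auto simp: eventually_sequentially)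
  obtain g where g: "g \<in> Cc" "(LINT x|M. cmod (s n x - g x)) < e/2"
    using s[of n] e unfolding approximable_def by (meson half_gt_zero)
  note [simp] = Cc_integrable[OF g(1)] int approximable_integrable[OF s]
  have "(LINT x|M. cmod (f x - g x)) \<le> (LINT x|M. cmod (f x - s n x) + cmod (s n x - g x))"
  proof (intro integral_mono)
    show "cmod (f x - g x) \<le> cmod (f x - s n x) + cmod (s n x - g x)" for x
      using norm_triangle_ineq[of "f x - s n x" "s n x - g x"] by simp
  qed auto
  also have "\<dots> < e" using n g(2) by simp
  finally show "\<exists>h\<in>Cc. (LINT x|M. cmod (f x - h x)) < e" using g(1) by blast
qed

lemma space_M: "space M = UNIV"
  using sets_eq_imp_space_eq[OF sets_M] by simp

lemma approximable_indicator_cozero: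
  assumes A: "A \<in> cozero" shows "approximable (indicator A)"
proof -
  obtain h where h: "h \<in> Cc" "A = {x. h x \<noteq> 0}" using A unfolding cozero_def by blast
  show ?thesis
    unfolding h(2)
  proof (rule approximable_lim[where s="step h" and w="indicator {x. h x \<noteq> 0}"])
    show "approximable (step h n)" for n by (intro approximable_Cc step_Cc h)
    show "indicator {x. h x \<noteq> 0} \<in> borel_measurable M"
      using cozero_finite(1)[OF A] h(2) by simp
    show "integrable M (indicator {x. h x \<noteq> 0} :: 'a \<Rightarrow> real)"
      using cozero_finite[OF A] h(2) by (simp add: integrable_indicator_iff)
  qed (rule step_tendsto step_bound)+
qed

text \<open>Dynkin induction over \<open>A\<close>. Intersecting with the fixed set \<open>C\<close>
  keeps complements integrable and bounds the partial sums of disjoint unions by the integrable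
  indicator of \<open>C\<close>.\<close>

lemma approximable_indicator_Int:
  assumes A: "A \<in> sets M" and C: "C \<in> cozero"
  shows "approximable (indicator (A \<inter> C))"
proof -
  have A': "A \<in> sigma_sets UNIV cozero" using A sets_M sets_borel_cozero[OF lc] by simp
  have "Int_stable (cozero :: 'a set set)" using cozero_Int unfolding Int_stable_def by blast
  moreover have "(cozero :: 'a set set) \<subseteq> Pow UNIV" by simp
  ultimately show ?thesis using A'
  proof (induction rule: sigma_sets_induct_disjoint)
    case (basic A)
    then show ?case by (intro approximable_indicator_cozero cozero_Int C)
  next
    case empty
    show ?case using approximable_Cc[OF Cc_zero] by (simp add: indicator_def[abs_def])
  next
    case (compl A)
    have "approximable (\<lambda>x. indicator C x + (-1) * indicator (A \<inter> C) x)"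
      by (intro approximable_add approximable_cmult approximable_indicator_cozero C compl)
    also have "(\<lambda>x. indicator C x + (-1) * indicator (A \<inter> C) x) = (indicator ((UNIV - A) \<inter> C) :: 'a \<Rightarrow> complex)"
      by (auto simp: fun_eq_iff indicator_def)
    finally show ?case .
  next
    case (union A)
    let ?s = "\<lambda>n x. \<Sum>i<n. (indicator (A i \<inter> C) x :: complex)"
    have dis: "disjoint_family (\<lambda>i. A i \<inter> C)" using union(1) unfolding disjoint_family_on_def by blast
    have s_eq: "?s n x = indicator (\<Union>i<n. A i \<inter> C) x" for n x
      by (rule indicator_UN_disjoint[symmetric]) (use dis in \<open>auto simp: disjoint_family_on_def\<close>)
    have "A i \<in> sets M" for i using union(2) sets_M sets_borel_cozero[OF lc] by auto
    then have m: "\<Union>(range A) \<inter> C \<in> sets M" using cozero_finite(1)[OF C] by auto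
    show ?case
    proof (rule approximable_lim[where s="?s" and w="indicator C"])
      show "approximable (?s n)" for n
      proof (induction n)
        case 0
        show ?case using approximable_Cc[OF Cc_zero] by simp
      next
        case (Suc n)
        then show ?case using approximable_add[OF Suc union(3)[of n]] by (simp add: add.commute)
      qed
      show "indicator (\<Union>(range A) \<inter> C) \<in> borel_measurable M" using m by simp
      show "integrable M (indicator C :: 'a \<Rightarrow> real)"
        using cozero_finite[OF C] by (simp add: integrable_indicator_iff)
      show "(\<lambda>n. ?s n x) \<longlonglongrightarrow> indicator (\<Union>(range A) \<inter> C) x" for x
      proof -
        have "(\<lambda>n. indicator (\<Union>i<n. A i \<inter> C) x :: complex) \<longlonglongrightarrow> indicator (\<Union>i. A i \<inter> C) x"
          by (rule LIMSEQ_indicator_UN)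
        moreover have "(\<Union>i. A i \<inter> C) = \<Union>(range A) \<inter> C" by blast
        ultimately show ?thesis unfolding s_eq by simp
      qed
      show "cmod (?s n x) \<le> indicator C x" for n x unfolding s_eq by (auto simp: indicator_def)
    qed
  qed
qed

lemma approximable_indicator:
  assumes A: "A \<in> sets M" and fin: "emeasure M A < \<infinity>"
  shows "approximable (indicator A)"
proof -
  obtain C :: "nat \<Rightarrow> 'a set" where C: "\<And>n. C n \<in> cozero" "incseq C" "(\<Union>n. C n) = UNIV"
    using exhaustion by metis
  show ?thesis
  proof (rule approximable_lim[where s="\<lambda>n. indicator (A \<inter> C n)" and w="indicator A"])
    show "approximable (indicator (A \<inter> C n))" for n by (rule approximable_indicator_Int[OF A C(1)])
    have "incseq (\<lambda>n. A \<inter> C n)" using C(2) unfolding incseq_def by blast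
    then have "(\<lambda>n. indicator (A \<inter> C n) x :: complex) \<longlonglongrightarrow> indicator (\<Union>n. A \<inter> C n) x" for x
      by (rule LIMSEQ_indicator_incseq)
    moreover have "(\<Union>n. A \<inter> C n) = A" using C(3) by blast
    ultimately show "(\<lambda>n. indicator (A \<inter> C n) x :: complex) \<longlonglongrightarrow> indicator A x" for x by simp
  qed (use A fin in \<open>auto simp: integrable_indicator_iff indicator_def\<close>)
qed

lemma Cc_dense_L1: "integrable M f \<Longrightarrow> approximable f"
proof (induction rule: integrable_induct)
  case (base A c)
  have "approximable (\<lambda>x. c * indicator A x)" by (intro approximable_cmult approximable_indicator base)
  then show ?case by (simp add: scaleR_conv_of_real mult.commute of_real_indicator)
next
  case (add f g)
  then show ?case by (intro approximable_add)
next
  case (lim f s)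
  show ?case
    \<comment> \<open>The induction rule supplies simple functions bounded by twice the absolute
      value of their limit.\<close>
    by (rule approximable_lim[where s=s and w="\<lambda>x. 2 * cmod (f x)"])
       (use lim space_M in auto)
qed

text \<open>The radial retraction onto the disc of radius r moves w by its distance to the disc,
  hence by no more than its distance to the point z of the disc; the triangle inequality then gives
  the factor 2.\<close>

lemma radial_truncation:
  assumes "cmod z \<le> r" "0 < r"
  shows "cmod (z - w / of_real (max 1 (cmod w / r))) \<le> 2 * cmod (z - w)"
    and "cmod (w / of_real (max 1 (cmod w / r))) \<le> r"
proof -
  have "cmod (w - w / of_real (max 1 (cmod w / r))) \<le> cmod (z - w)
      \<and> cmod (w / of_real (max 1 (cmod w / r))) \<le> r"
  proof (cases "cmod w \<le> r")
    case True
    then have "max 1 (cmod w / r) = 1" using assms by (simp add: field_simps)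
    then show ?thesis using True by simp
  next
    case False
    have "cmod w > 0" using False assms by linarith
    then have w: "w \<noteq> 0" by simp
    from False have e: "max 1 (cmod w / r) = cmod w / r" using assms by (simp add: field_simps)
    have "w - w / of_real (cmod w / r) = w * of_real (1 - r / cmod w)"
      using False assms w by (simp add: field_simps)
    then have "cmod (w - w / of_real (cmod w / r)) = cmod w * \<bar>1 - r / cmod w\<bar>"
      by (simp only: norm_mult norm_of_real)
    also have "\<dots> = cmod w - r" using False assms w by (simp add: field_simps abs_if)
    also have "\<dots> \<le> cmod (z - w)" using assms norm_triangle_ineq2[of w z] by (simp add: norm_minus_commute)
    finally show ?thesis unfolding e using False assms w by (auto simp: norm_divide norm_mult)
  qed
  then show "cmod (z - w / of_real (max 1 (cmod w / r))) \<le> 2 * cmod (z - w)"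
    "cmod (w / of_real (max 1 (cmod w / r))) \<le> r"
    using norm_triangle_ineq[of "z - w" "w - w / of_real (max 1 (cmod w / r))"] by auto
qed

text \<open>A bounded function with support of finite measure is approximated in the mean; truncating
  the approximation makes the mean square error at most a multiple of the mean error.\<close>

lemma Cc_dense_L2:
  assumes \<xi>: "\<xi> \<in> sq_int M" and e: "e > 0"
  shows "\<exists>f\<in>Cc. f \<in> sq_int M \<and> l2_norm M (\<lambda>x. \<xi> x - f x) < e"
proof -
  note [measurable] = sq_int_measurable[OF \<xi>]
  obtain C :: "nat \<Rightarrow> 'a set" where C: "\<And>n. C n \<in> cozero" "incseq C" "(\<Union>n. C n) = UNIV"
    using exhaustion by metis
  have [measurable]: "C n \<in> sets M" for n by (rule cozero_finite(1)[OF C(1)])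
  \<comment> \<open>The truncation is twofold: the set \<open>C n\<close> makes the support of
    finite measure, and the bound n makes the function bounded, hence integrable.\<close>
  define s where "s n x = (if x \<in> C n \<and> cmod (\<xi> x) \<le> real n then \<xi> x else 0)" for n x
  have [measurable]: "s n \<in> borel_measurable M" for n unfolding s_def by measurable
  have "(\<lambda>n. LINT x|M. (cmod (\<xi> x - s n x))\<^sup>2) \<longlonglongrightarrow> (LINT x|M. 0)"
  proof (rule integral_dominated_convergence[where w="\<lambda>x. (cmod (\<xi> x))\<^sup>2"])
    have "(\<lambda>n. (cmod (\<xi> x - s n x))\<^sup>2) \<longlonglongrightarrow> 0" for x
    proof -
      obtain k where k: "x \<in> C k" using C(3) by blast
      obtain j where j: "cmod (\<xi> x) \<le> real j" using real_arch_simple by blast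
      have "s n x = \<xi> x" if "n \<ge> max k j" for n
        using that k j monoD[OF C(2), of k n] unfolding s_def by auto
      then have "\<forall>n\<ge>max k j. (cmod (\<xi> x - s n x))\<^sup>2 = 0" by simp
      then show ?thesis
        by (intro tendsto_eventually) (unfold eventually_sequentially, blast)
    qed
    then show "AE x in M. (\<lambda>n. (cmod (\<xi> x - s n x))\<^sup>2) \<longlonglongrightarrow> 0" by simp
    show "AE x in M. norm ((cmod (\<xi> x - s n x))\<^sup>2) \<le> (cmod (\<xi> x))\<^sup>2" for n
      by (rule AE_I2) (auto simp: s_def)
  qed (use sq_int_integrable[OF \<xi>] in auto)
  then have l: "(\<lambda>n. LINT x|M. (cmod (\<xi> x - s n x))\<^sup>2) \<longlonglongrightarrow> 0" by simp
  have "\<forall>\<^sub>F n in sequentially. (LINT x|M. (cmod (\<xi> x - s n x))\<^sup>2) < (e/2)\<^sup>2"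
    using order_tendstoD(2)[OF l, of "(e/2)\<^sup>2"] e by simp
  then have "\<forall>\<^sub>F n in sequentially. (LINT x|M. (cmod (\<xi> x - s n x))\<^sup>2) < (e/2)\<^sup>2 \<and> n > 0"
    by (intro eventually_conj eventually_gt_at_top)
  then obtain n where n: "(LINT x|M. (cmod (\<xi> x - s n x))\<^sup>2) < (e/2)\<^sup>2" "n > 0"
    by (auto simp: eventually_sequentially)
  have sb: "cmod (s n x) \<le> real n" for x unfolding s_def by auto
  have s2: "s n \<in> sq_int M"
    by (rule sq_int_bound[OF _ \<xi>]) (auto simp: s_def)
  have \<xi>s: "l2_norm M (\<lambda>x. \<xi> x - s n x) < e/2"
    unfolding l2_norm_def using real_sqrt_less_mono[OF n(1)] e by simp
  have "integrable M (\<lambda>x. indicator (C n) x * real n)"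
    using cozero_finite[OF C(1)] by (intro integrable_mult_left) (simp add: integrable_indicator_iff)
  then have s1: "integrable M (s n)"
    by (rule Bochner_Integration.integrable_bound) (auto simp: s_def indicator_def)
  \<comment> \<open>The squared error is at most (2 n) (2 cmod (s n x - g x)) at each point;
    \<open>d\<close> is chosen so that 4 n d = (e/2)^2.\<close>
  define d where "d = (e/2)\<^sup>2 / (4 * real n)"
  have d: "d > 0" unfolding d_def using e n by simp
  obtain g where g: "g \<in> Cc" "(LINT x|M. cmod (s n x - g x)) < d"
    using Cc_dense_L1[OF s1] d unfolding approximable_def by blast
  \<comment> \<open>The approximant \<open>g\<close> may be large; pushing its values into the disc
    of radius n keeps it in \<open>Cc\<close> and at most doubles its pointwise error.\<close>
  define f where "f x = g x / of_real (max 1 (cmod (g x) / real n))" for x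
  have f: "f \<in> Cc" unfolding f_def[abs_def]
    using n(2) by (intro Cc_comp[OF g(1)]) (auto intro!: continuous_intros)
  note [simp] = Cc_integrable[OF g(1)] Cc_integrable[OF f] s1
  have fb: "cmod (s n x - f x) \<le> 2 * cmod (s n x - g x)" "cmod (f x) \<le> real n" for x
    unfolding f_def using radial_truncation[OF sb] n(2) by auto
  have f2: "f \<in> sq_int M"
  proof -
    have "(\<lambda>x. complex_of_real ((cmod (f x))\<^sup>2)) \<in> Cc" by (rule Cc_cmod_sq[OF f])
    from integrable_Re[OF Cc_integrable[OF this]] show ?thesis
      unfolding sq_int_def using borel_measurable_integrable[OF Cc_integrable[OF f]] by simp
  qed
  have "(LINT x|M. (cmod (s n x - f x))\<^sup>2) \<le> (LINT x|M. (4 * real n) * cmod (s n x - g x))"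
  proof (rule integral_mono)
    show "integrable M (\<lambda>x. (cmod (s n x - f x))\<^sup>2)" by (rule sq_int_integrable[OF sq_int_diff[OF s2 f2]])
    fix x
    have "cmod (s n x - f x) * cmod (s n x - f x) \<le> (2 * real n) * (2 * cmod (s n x - g x))"
      using fb[of x] sb[of x] norm_triangle_ineq4[of "s n x" "f x"] by (intro mult_mono) auto
    then show "(cmod (s n x - f x))\<^sup>2 \<le> (4 * real n) * cmod (s n x - g x)"
      by (simp add: power2_eq_square)
  qed simp
  also have "\<dots> < (e/2)\<^sup>2" using g(2) n(2) unfolding d_def by (simp add: field_simps)
  finally have "l2_norm M (\<lambda>x. s n x - f x) < e/2"
    unfolding l2_norm_def using real_sqrt_less_mono e by fastforce
  then have "l2_norm M (\<lambda>x. \<xi> x - f x) < e"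
    using l2_norm_diff_triangle[OF \<xi> s2 f2] \<xi>s by simp
  then show ?thesis using f f2 by blast
qed

end

section \<open>Haar systems\<close>

context groupoid
begin

lemma inv_inv: "ginv G (ginv G x) = x"
proof -
  have "ginv G (ginv G x) = gmul G (ginv G (ginv G x)) (gmul G (ginv G x) x)"
    using mul_unit[of "ginv G (ginv G x)"] by (simp add: src_inv rng_inv inv_mul)
  also have "\<dots> = gmul G (gmul G (ginv G (ginv G x)) (ginv G x)) x"
    by (rule mul_assoc[symmetric]) (simp_all add: src_inv rng_inv)
  also have "\<dots> = gmul G (rng G x) x" by (simp add: inv_mul src_inv)
  finally show ?thesis by (simp add: unit_mul)
qed

lemma mul_inv_cancel: "rng G y = rng G x \<Longrightarrow> gmul G x (gmul G (ginv G x) y) = y"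
  using mul_assoc[of x "ginv G x" y] unit_mul[of y] by (simp add: rng_inv src_inv mul_inv)

lemma inv_mul_cancel: "rng G y = src G x \<Longrightarrow> gmul G (ginv G x) (gmul G x y) = y"
  using mul_inv_cancel[of y "ginv G x"] by (simp add: inv_inv rng_inv)

lemma rng_inv_mul: "rng G t = rng G x \<Longrightarrow> rng G (gmul G (ginv G t) x) = src G t"
  by (simp add: rng_mul rng_inv src_inv)

lemma inv_mul_eq:
  assumes "src G a = rng G b"
  shows "ginv G (gmul G a b) = gmul G (ginv G b) (ginv G a)"
proof -
  let ?w = "gmul G (ginv G b) (ginv G a)"
  have r: "rng G ?w = src G b" using assms by (simp add: rng_mul rng_inv src_inv)
  have "gmul G (gmul G a b) ?w = gmul G a (gmul G b ?w)"
    by (rule mul_assoc) (use assms r in simp_all)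
  also have "gmul G b ?w = ginv G a"
    by (rule mul_inv_cancel) (use assms in \<open>simp add: rng_inv\<close>)
  finally have e: "gmul G (gmul G a b) ?w = rng G a" by (simp add: mul_inv)
  have "gmul G (ginv G (gmul G a b)) (gmul G (gmul G a b) ?w) = ?w"
    by (rule inv_mul_cancel) (use assms r in \<open>simp add: src_mul\<close>)
  then have "gmul G (ginv G (gmul G a b)) (rng G a) = ?w" by (simp only: e)
  then show ?thesis
    using mul_unit[of "ginv G (gmul G a b)"] assms by (simp add: src_inv rng_mul)
qed

lemma inv_inv_mul: "rng G t = rng G x \<Longrightarrow> ginv G (gmul G (ginv G t) x) = gmul G (ginv G x) t"
  by (simp add: inv_mul_eq src_inv inv_inv)

lemma inv_mul_mul:
  "src G s = rng G t \<Longrightarrow> rng G s = rng G x \<Longrightarrow>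
    gmul G (ginv G (gmul G s t)) x = gmul G (ginv G t) (gmul G (ginv G s) x)"
  using mul_assoc[of "ginv G t" "ginv G s" x] by (simp add: inv_mul_eq src_inv rng_inv)

end

context topological_groupoid
begin

text \<open>The range of x is x x^-1.\<close>

lemma continuous_rng: "continuous_on UNIV (rng G)"
proof -
  have "continuous_on UNIV (\<lambda>x. (\<lambda>(x, y). gmul G x y) (x, ginv G x))"
    by (rule continuous_on_compose2[OF continuous_mul])
       (auto intro!: continuous_intros continuous_inv simp: rng_inv)
  then show ?thesis by (simp add: mul_inv)
qed

lemma continuous_div: "continuous_on {(t, x). rng G t = rng G x} (\<lambda>(t, x). gmul G (ginv G t) x)"
proof -
  have "continuous_on {(t, x). rng G t = rng G x} (\<lambda>p. (\<lambda>(x, y). gmul G x y) (ginv G (fst p), snd p))"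
    by (rule continuous_on_compose2[OF continuous_mul])
       (auto intro!: continuous_intros continuous_on_compose2[OF continuous_inv] simp: src_inv)
  then show ?thesis by (simp add: case_prod_beta)
qed

end

locale lc_haar_groupoid = haar_groupoid G
  for G :: "'g::{t2_space, second_countable_topology} groupoid_data" +
  assumes lc: "locally_compact_space (euclidean :: 'g topology)"
begin

lemma closed_fibre: "closed (range_fibre G u)"
  unfolding range_fibre_def by (intro closed_Collect_eq continuous_rng continuous_on_const)

lemma closed_composable: "closed {(t, x). rng G t = rng G x}"
proof -
  have "closed {p. rng G (fst p) = rng G (snd p)}"
    by (intro closed_Collect_eq continuous_on_compose2[OF continuous_rng] continuous_intros) auto
  then show ?thesis by (simp add: case_prod_unfold)
qed

lemma continuous_mul_left: "continuous_on (range_fibre G (src G x)) (gmul G x)"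
proof -
  have "continuous_on (range_fibre G (src G x)) (\<lambda>y. (\<lambda>(x, y). gmul G x y) (x, y))"
    by (rule continuous_on_compose2[OF continuous_mul])
       (auto intro!: continuous_intros simp: range_fibre_def)
  then show ?thesis by simp
qed

lemma flip_Cc: "f \<in> Cc \<Longrightarrow> flip G f \<in> Cc"
proof -
  assume f: "f \<in> Cc"
  obtain L where L: "compact L" "\<forall>x. f x \<noteq> 0 \<longrightarrow> x \<in> L" by (rule Cc_supportE[OF f])
  show ?thesis
  proof (rule CcI)
    show "continuous_on UNIV (flip G f)"
      unfolding flip_def[abs_def]
      by (rule continuous_on_compose2[OF Cc_continuous[OF f] continuous_inv]) auto
    show "compact (ginv G ` L)"
      by (rule compact_continuous_image[OF continuous_on_subset[OF continuous_inv] L(1)]) simp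
    fix x assume "flip G f x \<noteq> 0"
    then have "ginv G x \<in> L" using L(2) unfolding flip_def by simp
    then show "x \<in> ginv G ` L" using inv_inv[of x] by (metis image_eqI)
  qed
qed

lemma flip_flip: "flip G (flip G f) = f"
  by (simp add: flip_def fun_eq_iff inv_inv)

lemma invol_eq: "invol G f = (\<lambda>x. cnj (flip G f x))"
  by (simp add: invol_def flip_def fun_eq_iff)

lemma invol_Cc: "f \<in> Cc \<Longrightarrow> invol G f \<in> Cc"
  unfolding invol_eq by (erule Cc_comp[OF flip_Cc]) (auto intro!: continuous_intros)

context
  fixes u assumes u: "u \<in> units G"
begin

lemma space_haar: "space (haar G u) = range_fibre G u"
  using sets_eq_imp_space_eq[OF sets_haar[OF u]] by (simp add: space_restrict_space)

lemma sets_haar_borel: "A \<in> sets (haar G u) \<longleftrightarrow> A \<in> sets borel \<and> A \<subseteq> range_fibre G u"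
  unfolding sets_haar[OF u]
  using borel_closed[OF closed_fibre] by (subst sets_restrict_space_iff) auto

lemma measurable_haar: "measurable (haar G u) N = measurable (restrict_space borel (range_fibre G u)) N"
  by (rule measurable_cong_sets[OF sets_haar[OF u] refl])

lemma haar_continuous_measurable:
  "continuous_on (range_fibre G u) f \<Longrightarrow> f \<in> borel_measurable (haar G u)"
  unfolding measurable_haar by (rule borel_measurable_continuous_on_restrict)

lemma haar_borel_measurable: "f \<in> measurable borel N \<Longrightarrow> f \<in> measurable (haar G u) N"
  unfolding measurable_haar by (rule measurable_restrict_space1)

text \<open>The Haar measure of one fibre, viewed as a Borel measure on the whole groupoid
  concentrated on that fibre, so that the results on locally finite Borel measures apply.\<close>

definition push where "push = distr (haar G u) borel (\<lambda>x. x)"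

lemma id_measurable: "(\<lambda>x. x) \<in> measurable (haar G u) borel"
  by (rule haar_borel_measurable) simp

lemma emeasure_push: "A \<in> sets borel \<Longrightarrow> emeasure push A = emeasure (haar G u) (A \<inter> range_fibre G u)"
  unfolding push_def by (subst emeasure_distr[OF id_measurable]) (auto simp: space_haar)

text \<open>Fibres are closed, so a compact set meets a fibre in a compact set.\<close>

lemma push_locally_finite: "locally_finite_borel push"
proof
  show "locally_compact_space (euclidean :: 'g topology)" by (rule lc)
  show "sets push = sets borel" unfolding push_def by simp
  fix K :: "'g set" assume K: "compact K"
  have "compact (K \<inter> range_fibre G u)" using K closed_fibre by (rule compact_Int_closed)
  then show "emeasure push K < \<infinity>"
    using haar_finite_on_compact[OF u] emeasure_push[of K] borel_closed[OF compact_imp_closed[OF K]]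
    by simp
qed

lemma integral_push: "f \<in> borel_measurable borel \<Longrightarrow> (LINT x|push. f x) = (LINT x|haar G u. f x)"
  for f :: "'g \<Rightarrow> 'b::{banach, second_countable_topology}"
  unfolding push_def by (rule integral_distr[OF id_measurable])

lemma integrable_push: "f \<in> borel_measurable borel \<Longrightarrow> integrable push f \<longleftrightarrow> integrable (haar G u) f"
  for f :: "'g \<Rightarrow> 'b::{banach, second_countable_topology}"
  unfolding push_def by (rule integrable_distr_eq[OF id_measurable])

lemma Cc_measurable_haar: "f \<in> Cc \<Longrightarrow> f \<in> borel_measurable (haar G u)"
  by (intro haar_borel_measurable Cc_borel)

lemma Cc_integrable_haar: "f \<in> Cc \<Longrightarrow> integrable (haar G u) f"
  using locally_finite_borel.Cc_integrable[OF push_locally_finite] integrable_push[OF Cc_borel] by blast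

lemma Cc_sq_int: "f \<in> Cc \<Longrightarrow> f \<in> sq_int (haar G u)"
  unfolding sq_int_def
  using Cc_measurable_haar integrable_Re[OF Cc_integrable_haar[OF Cc_cmod_sq]] by simp

lemma sigma_finite_haar: "sigma_finite_measure (haar G u)"
proof -
  interpret p: locally_finite_borel push by (rule push_locally_finite)
  obtain C :: "nat \<Rightarrow> 'g set" where C: "\<And>n. C n \<in> cozero" "(\<Union>n. C n) = UNIV" using p.exhaustion by metis
  have o: "C n \<in> sets borel" for n using cozero_open[OF C(1)] by simp
  have "emeasure (haar G u) (C n \<inter> range_fibre G u) \<noteq> \<infinity>" for n
    using p.cozero_finite(2)[OF C(1)] emeasure_push[OF o] by (simp add: less_top)
  moreover have "C n \<inter> range_fibre G u \<in> sets (haar G u)" for n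
    unfolding sets_haar_borel using o borel_closed[OF closed_fibre] by auto
  ultimately show ?thesis
    using C(2) by unfold_locales (intro exI[of _ "range (\<lambda>n. C n \<inter> range_fibre G u)"], auto simp: space_haar)
qed

lemma Cc_dense_haar:
  assumes \<xi>: "\<xi> \<in> sq_int (haar G u)" and e: "e > 0"
  shows "\<exists>f\<in>Cc. l2_norm (haar G u) (\<lambda>x. \<xi> x - f x) < e"
proof -
  interpret p: locally_finite_borel push by (rule push_locally_finite)
  \<comment> \<open>Extension by zero off the fibre stays Borel measurable because the fibre is
    closed.\<close>
  define \<xi>' where "\<xi>' x = (if x \<in> range_fibre G u then \<xi> x else 0)" for x
  have fib: "{x. x \<in> range_fibre G u} \<in> sets borel" using borel_closed[OF closed_fibre] by simp
  have m: "\<xi>' \<in> borel_measurable borel"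
  proof -
    have "(\<lambda>x. indicator (range_fibre G u) x *\<^sub>R \<xi> x) \<in> borel_measurable borel"
      using sq_int_measurable[OF \<xi>] fib unfolding measurable_haar
      by (subst (asm) borel_measurable_restrict_space_iff) auto
    also have "(\<lambda>x. indicator (range_fibre G u) x *\<^sub>R \<xi> x) = \<xi>'"
      by (auto simp: \<xi>'_def fun_eq_iff)
    finally show ?thesis .
  qed
  have eq: "\<xi>' x = \<xi> x" if "x \<in> space (haar G u)" for x using that unfolding \<xi>'_def space_haar by simp
  have "\<xi>' \<in> sq_int push"
  proof -
    have "integrable (haar G u) (\<lambda>x. (cmod (\<xi>' x))\<^sup>2)"
      using sq_int_integrable[OF \<xi>] by (rule Bochner_Integration.integrable_cong[THEN iffD1, rotated 2]) (auto simp: eq)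
    then have "integrable push (\<lambda>x. (cmod (\<xi>' x))\<^sup>2)" using m by (subst integrable_push) auto
    then show ?thesis unfolding sq_int_def p.borel_M using m by simp
  qed
  then obtain f where f: "f \<in> Cc" "l2_norm push (\<lambda>x. \<xi>' x - f x) < e" using p.Cc_dense_L2[OF _ e] by blast
  have "(LINT x|push. (cmod (\<xi>' x - f x))\<^sup>2) = (LINT x|haar G u. (cmod (\<xi>' x - f x))\<^sup>2)"
    using m Cc_borel[OF f(1)] by (intro integral_push) measurable
  also have "\<dots> = (LINT x|haar G u. (cmod (\<xi> x - f x))\<^sup>2)"
    by (intro Bochner_Integration.integral_cong) (auto simp: eq)
  finally show ?thesis using f unfolding l2_norm_def by auto
qed

end

lemma units_rng [simp]: "rng G x \<in> units G" "src G x \<in> units G"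
  by (rule rng_unit src_unit)+

lemma mul_left_measurable: "gmul G x \<in> measurable (haar G (src G x)) (haar G (rng G x))"
proof -
  have "gmul G x \<in> measurable (haar G (src G x)) (restrict_space borel (range_fibre G (rng G x)))"
    by (rule measurable_restrict_space2)
       (auto simp: space_haar range_fibre_def rng_mul intro!: haar_continuous_measurable continuous_mul_left[unfolded range_fibre_def])
  then show ?thesis using measurable_cong_sets[OF refl sets_haar[OF units_rng(1)]] by blast
qed

text \<open>The axiom gives equality of the integrals of \<open>Cc\<close> functions; viewed on the
  whole groupoid, both measures are locally finite, and uniqueness makes them equal. Invariance then
  extends to measurable integrands.\<close>

lemma haar_invariant: "distr (haar G (src G x)) (haar G (rng G x)) (gmul G x) = haar G (rng G x)"
proof -
  let ?N = "distr (haar G (src G x)) borel (gmul G x)"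
  have mm: "gmul G x \<in> measurable (haar G (src G x)) borel"
    by (intro haar_continuous_measurable continuous_mul_left) simp
  interpret p: locally_finite_borel "push (rng G x)" by (rule push_locally_finite) simp
  have N: "locally_finite_borel ?N"
  proof
    fix K :: "'g set" assume K: "compact K"
    have Kb: "K \<in> sets borel" using borel_closed[OF compact_imp_closed[OF K]] .
    \<comment> \<open>The preimage of \<open>K\<close> under left translation by \<open>x\<close>
      lies in this translate by x^-1, which is compact and therefore has finite measure.\<close>
    let ?P = "gmul G (ginv G x) ` (K \<inter> range_fibre G (rng G x))"
    have P: "compact ?P"
    proof (rule compact_continuous_image)
      show "continuous_on (K \<inter> range_fibre G (rng G x)) (gmul G (ginv G x))"
        using continuous_mul_left[of "ginv G x"] by (rule continuous_on_subset) (auto simp: src_inv)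
      show "compact (K \<inter> range_fibre G (rng G x))" by (rule compact_Int_closed[OF K closed_fibre])
    qed
    have sub: "?P \<subseteq> range_fibre G (src G x)" by (auto simp: range_fibre_def rng_inv_mul)
    have "emeasure ?N K = emeasure (haar G (src G x)) (gmul G x -` K \<inter> range_fibre G (src G x))"
      using emeasure_distr[OF mm Kb] by (simp add: space_haar)
    also have "\<dots> \<le> emeasure (haar G (src G x)) ?P"
    proof (rule emeasure_mono)
      show "gmul G x -` K \<inter> range_fibre G (src G x) \<subseteq> ?P"
      proof
        fix y assume "y \<in> gmul G x -` K \<inter> range_fibre G (src G x)"
        then have y: "gmul G x y \<in> K" "rng G y = src G x" by (auto simp: range_fibre_def)
        then have "y = gmul G (ginv G x) (gmul G x y)" "gmul G x y \<in> range_fibre G (rng G x)"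
          by (simp_all add: inv_mul_cancel range_fibre_def rng_mul)
        then show "y \<in> ?P" using y(1) by blast
      qed
      show "?P \<in> sets (haar G (src G x))"
        using borel_closed[OF compact_imp_closed[OF P]] sub by (simp add: sets_haar_borel)
    qed
    also have "\<dots> < \<infinity>" by (rule haar_finite_on_compact[OF _ P sub]) simp
    finally show "emeasure ?N K < \<infinity>" .
  qed (use lc in simp_all)
  have "push (rng G x) = ?N"
  proof (rule locally_finite_borel_eqI[OF p.locally_finite_borel_axioms N])
    fix f :: "'g \<Rightarrow> complex" assume f: "f \<in> Cc"
    have "(LINT y|?N. f y) = (LINT y|haar G (src G x). f (gmul G x y))"
      by (rule integral_distr[OF mm Cc_borel[OF f]])
    also have "\<dots> = (LINT y|haar G (rng G x). f y)" by (rule haar_left_invariant[OF f])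
    also have "\<dots> = (LINT y|push (rng G x). f y)" by (intro integral_push[symmetric] Cc_borel f) simp
    finally show "(LINT y|push (rng G x). f y) = (LINT y|?N. f y)" by simp
  qed
  \<comment> \<open>It remains to pass from the measures on the groupoid back to those on the fibre,
    whose Borel sets are Borel in the groupoid.\<close>
  show ?thesis
  proof (rule measure_eqI)
    fix A assume A: "A \<in> sets (distr (haar G (src G x)) (haar G (rng G x)) (gmul G x))"
    then have A': "A \<in> sets borel" "A \<subseteq> range_fibre G (rng G x)" by (simp_all add: sets_haar_borel)
    have "emeasure (distr (haar G (src G x)) (haar G (rng G x)) (gmul G x)) A = emeasure ?N A"
      using A A' by (simp add: emeasure_distr[OF mul_left_measurable] emeasure_distr[OF mm])
    also have "\<dots> = emeasure (push (rng G x)) A" using \<open>push (rng G x) = ?N\<close> by simp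
    also have "\<dots> = emeasure (haar G (rng G x)) A" using A' by (simp add: emeasure_push Int_absorb2)
    finally show "emeasure (distr (haar G (src G x)) (haar G (rng G x)) (gmul G x)) A = emeasure (haar G (rng G x)) A" .
  qed simp
qed

lemma haar_integral_invariant:
  fixes f :: "'g \<Rightarrow> 'b::{banach, second_countable_topology}"
  assumes "f \<in> borel_measurable (haar G (rng G x))"
  shows "(LINT y|haar G (src G x). f (gmul G x y)) = (LINT y|haar G (rng G x). f y)"
  using integral_distr[OF mul_left_measurable assms] by (simp add: haar_invariant)

lemma haar_nn_integral_invariant:
  assumes "f \<in> borel_measurable (haar G (rng G x))"
  shows "(\<integral>\<^sup>+y. f (gmul G x y) \<partial>haar G (src G x)) = (\<integral>\<^sup>+y. f y \<partial>haar G (rng G x))"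
  using nn_integral_distr[OF mul_left_measurable, of f] assms by (simp add: haar_invariant)

end

section \<open>Convolution operators on the fibres\<close>

lemma sq_int_cong: "(\<And>x. x \<in> space M \<Longrightarrow> f x = g x) \<Longrightarrow> f \<in> sq_int M \<longleftrightarrow> g \<in> sq_int M"
  unfolding sq_int_def
  by (simp cong: measurable_cong Bochner_Integration.integrable_cong)

lemma l2_norm_cong: "(\<And>x. x \<in> space M \<Longrightarrow> f x = g x) \<Longrightarrow> l2_norm M f = l2_norm M g"
  unfolding l2_norm_def by (simp cong: Bochner_Integration.integral_cong)

lemma l2_norm_cnj: "l2_norm M (\<lambda>x. cnj (f x)) = l2_norm M f"
  unfolding l2_norm_def by simp

lemma nn_integral_complex_eq:
  "integrable M f \<Longrightarrow> (\<integral>\<^sup>+x. ennreal (cmod (f x)) \<partial>M) = ennreal (LINT x|M. cmod (f x))"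
  by (intro nn_integral_eq_integral integrable_norm) auto

context lc_haar_groupoid
begin

lemma units_ne: "units G \<noteq> {}"
  using units_rng(1) by blast

lemma Cc_fibre_outside:
  assumes "f \<in> Cc"
  obtains K where "compact K" "K \<subseteq> units G" "\<forall>x. rng G x \<notin> K \<longrightarrow> f x = 0"
proof -
  obtain L where L: "compact L" "\<forall>x. f x \<noteq> 0 \<longrightarrow> x \<in> L" by (rule Cc_supportE[OF assms])
  show thesis
  proof (rule that[of "rng G ` L"])
    show "compact (rng G ` L)"
      by (rule compact_continuous_image[OF continuous_on_subset[OF continuous_rng] L(1)]) simp
  qed (use L in auto)
qed

lemma haar_integral_real_continuous:
  fixes g :: "'g \<Rightarrow> real"
  assumes "(\<lambda>x. complex_of_real (g x)) \<in> Cc"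
  shows "continuous_on (units G) (\<lambda>u. LINT x|haar G u. g x)"
  using continuous_on_Re[OF haar_continuous[OF assms]] by simp

text \<open>The integral depends continuously on the unit and vanishes off the compact image of the
  support under the range map.\<close>

lemma haar_integral_cmod_bdd:
  assumes f: "f \<in> Cc" shows "bdd_above ((\<lambda>u. LINT x|haar G u. cmod (f x)) ` units G)"
proof -
  obtain K where K: "compact K" "K \<subseteq> units G" "\<forall>x. rng G x \<notin> K \<longrightarrow> f x = 0"
    by (rule Cc_fibre_outside[OF f])
  have "compact ((\<lambda>u. LINT x|haar G u. cmod (f x)) ` K)"
    by (rule compact_continuous_image[OF continuous_on_subset[OF haar_integral_real_continuous K(2)] K(1)])
       (rule Cc_cmod[OF f])
  then have "bdd_above ((\<lambda>u. LINT x|haar G u. cmod (f x)) ` K)"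
    by (intro bounded_imp_bdd_above compact_imp_bounded)
  then obtain B where B: "\<And>u. u \<in> K \<Longrightarrow> (LINT x|haar G u. cmod (f x)) \<le> B"
    by (auto simp: bdd_above_def)
  have "(LINT x|haar G u. cmod (f x)) \<le> max 0 B" if u: "u \<in> units G" for u
  proof (cases "u \<in> K")
    case True
    show ?thesis using B[OF True] by linarith
  next
    case False
    have "(LINT x|haar G u. cmod (f x)) = (LINT x|haar G u. 0)"
      using K(3) False by (intro Bochner_Integration.integral_cong) (auto simp: space_haar[OF u] range_fibre_def)
    then show ?thesis by simp
  qed
  then show ?thesis by (rule bdd_aboveI2)
qed

lemma ginv_measurable:
  assumes u: "u \<in> units G"
  shows "ginv G \<in> measurable (haar G u) (restrict_space borel (source_fibre G u))"
proof -
  have "ginv G \<in> measurable (haar G u) borel"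
    by (rule haar_borel_measurable[OF u borel_measurable_continuous_onI[OF continuous_inv]])
  then show ?thesis
    by (rule measurable_restrict_space2[rotated])
       (auto simp: space_haar[OF u] range_fibre_def source_fibre_def src_inv)
qed

lemma haar_source_integral:
  fixes f :: "'g \<Rightarrow> 'b::{banach, second_countable_topology}"
  assumes u: "u \<in> units G" and f: "f \<in> borel_measurable (restrict_space borel (source_fibre G u))"
  shows "(LINT x|haar_source G u. f x) = (LINT x|haar G u. f (ginv G x))"
  unfolding haar_source_def by (rule integral_distr[OF ginv_measurable[OF u] f])

text \<open>The measure on a source fibre is an image under inversion, so both suprema can be taken
  over range fibres, where the estimates take place.\<close>

lemma I_norm_eq:
  assumes f: "f \<in> Cc"
  shows "I_norm G f = max (SUP u\<in>units G. LINT x|haar G u. cmod (f x))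
    (SUP u\<in>units G. LINT x|haar G u. cmod (flip G f x))"
proof -
  have [measurable]: "f \<in> borel_measurable borel" by (rule Cc_borel[OF f])
  have "(\<lambda>x. cmod (f x)) \<in> borel_measurable (restrict_space borel (source_fibre G u))" for u
    by (rule measurable_restrict_space1) measurable
  from haar_source_integral[OF _ this]
  have "(SUP u\<in>units G. LINT x|haar_source G u. cmod (f x)) = (SUP u\<in>units G. LINT x|haar G u. cmod (flip G f x))"
    by (intro SUP_cong refl) (simp add: flip_def)
  then show ?thesis unfolding I_norm_def by simp
qed

lemma I_norm_bound:
  assumes f: "f \<in> Cc" and u: "u \<in> units G"
  shows "(LINT x|haar G u. cmod (f x)) \<le> I_norm G f"
    and "(LINT x|haar G u. cmod (flip G f x)) \<le> I_norm G f"
  unfolding I_norm_eq[OF f]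
  using cSUP_upper[OF u haar_integral_cmod_bdd[OF f]] cSUP_upper[OF u haar_integral_cmod_bdd[OF flip_Cc[OF f]]]
  by auto

text \<open>\<open>undefined\<close> merely names some element; its range is a unit, at which the
  bound applies.\<close>

lemma I_norm_nonneg: "f \<in> Cc \<Longrightarrow> 0 \<le> I_norm G f"
  by (rule order_trans[OF _ I_norm_bound(1)[OF _ units_rng(1)[of undefined]]]) simp_all

section \<open>The kernel of right convolution\<close>

definition ker :: "('g \<Rightarrow> complex) \<Rightarrow> 'g \<times> 'g \<Rightarrow> complex"
  where "ker F = (\<lambda>(t, x). F (gmul G (ginv G t) x))"

text \<open>t^-1 x is continuous only on pairs with equal range. That set is closed, so cutting off
  by its indicator gives a Borel function on the product space, and second countability identifies
  the Borel sets of the product with the product sigma-algebra.\<close>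

lemma ker_measurable:
  fixes F :: "'g \<Rightarrow> complex"
  assumes F: "continuous_on UNIV F" and u: "u \<in> units G"
  shows "ker F \<in> borel_measurable (haar G u \<Otimes>\<^sub>M haar G u)"
proof -
  let ?D = "{(t, x). rng G t = rng G x}"
  have "continuous_on ?D (ker F)"
    using continuous_on_compose2[OF F continuous_div] by (simp add: ker_def case_prod_unfold)
  then have "(\<lambda>p. indicator ?D p *\<^sub>R ker F p) \<in> borel_measurable borel"
    by (rule borel_measurable_continuous_on_indicator[rotated])
       (use borel_closed[OF closed_composable] in simp)
  then have b: "(\<lambda>p. indicator ?D p *\<^sub>R ker F p) \<in> borel_measurable (borel \<Otimes>\<^sub>M borel)"
    by (simp add: borel_prod)
  have "(\<lambda>p. p) \<in> measurable (haar G u \<Otimes>\<^sub>M haar G u) (borel \<Otimes>\<^sub>M borel)"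
    using measurable_Pair[OF measurable_compose[OF measurable_fst id_measurable[OF u]]
        measurable_compose[OF measurable_snd id_measurable[OF u]]] by simp
  from measurable_compose[OF this b]
  have "(\<lambda>p. indicator ?D p *\<^sub>R ker F p) \<in> borel_measurable (haar G u \<Otimes>\<^sub>M haar G u)" .
  moreover have "ker F p = indicator ?D p *\<^sub>R ker F p" if "p \<in> space (haar G u \<Otimes>\<^sub>M haar G u)" for p
    using that by (auto simp: space_pair_measure space_haar[OF u] range_fibre_def)
  ultimately show ?thesis by (subst measurable_cong) auto
qed

lemma ker_left_measurable:
  fixes F :: "'g \<Rightarrow> complex"
  assumes "continuous_on UNIV F"
  shows "(\<lambda>x. F (gmul G (ginv G t) x)) \<in> borel_measurable (haar G (rng G t))"
  using measurable_Pair2[OF ker_measurable[OF assms units_rng(1)[of t]], of t]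
  by (simp add: ker_def space_haar range_fibre_def)

lemma ker_right_measurable:
  fixes F :: "'g \<Rightarrow> complex"
  assumes "continuous_on UNIV F"
  shows "(\<lambda>t. F (gmul G (ginv G t) x)) \<in> borel_measurable (haar G (rng G x))"
  using measurable_Pair1[OF ker_measurable[OF assms units_rng(1)[of x]], of x]
  by (simp add: ker_def space_haar range_fibre_def)

text \<open>The substitutions \<open>x = t y\<close> and \<open>t = x y\<close> turn the integrals of the kernel into those of
  \<open>F\<close> and of \<open>F\<close> composed with the inversion.\<close>

lemma nn_integral_ker_left:
  fixes F :: "'g \<Rightarrow> complex"
  assumes "continuous_on UNIV F" and [measurable]: "g \<in> borel_measurable borel"
  shows "(\<integral>\<^sup>+x. g (F (gmul G (ginv G t) x)) \<partial>haar G (rng G t)) = (\<integral>\<^sup>+y. g (F y) \<partial>haar G (src G t))"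
proof -
  have "(\<integral>\<^sup>+x. g (F (gmul G (ginv G t) x)) \<partial>haar G (rng G t))
      = (\<integral>\<^sup>+y. g (F (gmul G (ginv G t) (gmul G t y))) \<partial>haar G (src G t))"
    by (rule haar_nn_integral_invariant[symmetric])
       (rule measurable_compose[OF ker_left_measurable[OF assms(1)] assms(2)])
  also have "\<dots> = (\<integral>\<^sup>+y. g (F y) \<partial>haar G (src G t))"
    by (intro nn_integral_cong) (simp add: space_haar range_fibre_def inv_mul_cancel)
  finally show ?thesis .
qed

lemma nn_integral_ker_right:
  fixes F :: "'g \<Rightarrow> complex"
  assumes "continuous_on UNIV F" and [measurable]: "g \<in> borel_measurable borel"
  shows "(\<integral>\<^sup>+t. g (F (gmul G (ginv G t) x)) \<partial>haar G (rng G x)) = (\<integral>\<^sup>+y. g (flip G F y) \<partial>haar G (src G x))"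
proof -
  have "(\<integral>\<^sup>+t. g (F (gmul G (ginv G t) x)) \<partial>haar G (rng G x))
      = (\<integral>\<^sup>+y. g (F (gmul G (ginv G (gmul G x y)) x)) \<partial>haar G (src G x))"
    by (rule haar_nn_integral_invariant[symmetric])
       (rule measurable_compose[OF ker_right_measurable[OF assms(1)] assms(2)])
  also have "\<dots> = (\<integral>\<^sup>+y. g (flip G F y) \<partial>haar G (src G x))"
  proof (intro nn_integral_cong)
    fix y assume "y \<in> space (haar G (src G x))"
    then have y: "src G x = rng G y" by (simp add: space_haar range_fibre_def)
    have "gmul G (ginv G (gmul G x y)) x = gmul G (ginv G y) (src G x)"
      using inv_mul_mul[OF y, of x] by (simp add: inv_mul)
    also have "\<dots> = ginv G y" using mul_unit[of "ginv G y"] y by (simp add: src_inv)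
    finally show "g (F (gmul G (ginv G (gmul G x y)) x)) = g (flip G F y)" by (simp add: flip_def)
  qed
  finally show ?thesis .
qed

text \<open>After substitution both marginals are integrals over the fibre at the source of the
  fixed variable, one of F and one of its flip; the I-norm bounds either on every fibre.\<close>

lemma schur_ker:
  assumes F: "F \<in> Cc" and u: "u \<in> units G"
  shows "schur_kernel (haar G u) (ker F) (I_norm G F)"
proof -
  note c = Cc_continuous[OF F]
  interpret sigma_finite_measure "haar G u" by (rule sigma_finite_haar[OF u])
  show ?thesis
  proof
    show "ker F \<in> borel_measurable (haar G u \<Otimes>\<^sub>M haar G u)" by (rule ker_measurable[OF c u])
    show "0 \<le> I_norm G F" by (rule I_norm_nonneg[OF F])
    fix t assume "t \<in> space (haar G u)"
    then have t: "u = rng G t" by (simp add: space_haar[OF u] range_fibre_def)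
    have "(\<integral>\<^sup>+x. ennreal (cmod (ker F (t, x))) \<partial>haar G u) = (\<integral>\<^sup>+y. ennreal (cmod (F y)) \<partial>haar G (src G t))"
      using nn_integral_ker_left[OF c, of "\<lambda>z. ennreal (cmod z)" t] by (simp add: ker_def t)
    also have "\<dots> \<le> ennreal (I_norm G F)"
      unfolding nn_integral_complex_eq[OF Cc_integrable_haar[OF units_rng(2) F]]
      by (intro ennreal_leI I_norm_bound F units_rng)
    finally show "(\<integral>\<^sup>+x. ennreal (cmod (ker F (t, x))) \<partial>haar G u) \<le> ennreal (I_norm G F)" .
    have "(\<integral>\<^sup>+x. ennreal (cmod (ker F (x, t))) \<partial>haar G u) = (\<integral>\<^sup>+y. ennreal (cmod (flip G F y)) \<partial>haar G (src G t))"
      using nn_integral_ker_right[OF c, of "\<lambda>z. ennreal (cmod z)" t] by (simp add: ker_def t)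
    also have "\<dots> \<le> ennreal (I_norm G F)"
      unfolding nn_integral_complex_eq[OF Cc_integrable_haar[OF units_rng(2) flip_Cc[OF F]]]
      by (intro ennreal_leI I_norm_bound F units_rng)
    finally show "(\<integral>\<^sup>+x. ennreal (cmod (ker F (x, t))) \<partial>haar G u) \<le> ennreal (I_norm G F)" .
  qed
qed

text \<open>Convolution with a square integrable function therefore converges at every point x and
  not just almost everywhere, so the identities for convolution below hold pointwise.\<close>

lemma ker_right_sq_int:
  assumes F: "F \<in> Cc"
  shows "(\<lambda>t. F (gmul G (ginv G t) x)) \<in> sq_int (haar G (rng G x))"
proof (rule sq_intI_nn_integral(1)[OF ker_right_measurable[OF Cc_continuous[OF F]]])
  have "(\<integral>\<^sup>+t. ennreal ((cmod (F (gmul G (ginv G t) x)))\<^sup>2) \<partial>haar G (rng G x))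
      = (\<integral>\<^sup>+t. ennreal ((cmod (flip G F t))\<^sup>2) \<partial>haar G (src G x))"
    by (rule nn_integral_ker_right[OF Cc_continuous[OF F], of "\<lambda>z. ennreal ((cmod z)\<^sup>2)"]) simp
  also have "\<dots> = ennreal ((l2_norm (haar G (src G x)) (flip G F))\<^sup>2)"
    by (intro nn_integral_l2_norm Cc_sq_int flip_Cc F units_rng)
  finally show "(\<integral>\<^sup>+t. ennreal ((cmod (F (gmul G (ginv G t) x)))\<^sup>2) \<partial>haar G (rng G x))
    \<le> ennreal ((l2_norm (haar G (src G x)) (flip G F))\<^sup>2)" by simp
qed (rule l2_norm_nonneg)

lemma conv_eq_op:
  assumes F: "F \<in> Cc" and u: "u \<in> units G" and x: "x \<in> space (haar G u)"
  shows "conv G \<xi> F x = schur_kernel.op (haar G u) (ker F) \<xi> x"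
  using x unfolding schur_kernel.op_def[OF schur_ker[OF F u]] conv_def
  by (simp add: ker_def space_haar[OF u] range_fibre_def)

lemma conv_sq_int:
  assumes F: "F \<in> Cc" and u: "u \<in> units G" and \<xi>: "\<xi> \<in> sq_int (haar G u)"
  shows "conv G \<xi> F \<in> sq_int (haar G u)"
  using schur_kernel.op_sq_int[OF schur_ker[OF F u] \<xi>] conv_eq_op[OF F u]
  by (subst sq_int_cong) auto

lemma conv_bound:
  assumes F: "F \<in> Cc" and u: "u \<in> units G" and \<xi>: "\<xi> \<in> sq_int (haar G u)"
  shows "l2_norm (haar G u) (conv G \<xi> F) \<le> I_norm G F * l2_norm (haar G u) \<xi>"
  using schur_kernel.op_bound[OF schur_ker[OF F u] \<xi>] conv_eq_op[OF F u]
  by (subst l2_norm_cong) auto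

lemma conv_integrable:
  assumes F: "F \<in> Cc" and \<xi>: "\<xi> \<in> sq_int (haar G (rng G x))"
  shows "integrable (haar G (rng G x)) (\<lambda>t. \<xi> t * F (gmul G (ginv G t) x))"
  by (rule sq_int_mult_integrable[OF \<xi> ker_right_sq_int[OF F]])

lemma conv_diff:
  assumes F: "F \<in> Cc" and \<xi>: "\<xi> \<in> sq_int (haar G (rng G x))" and \<eta>: "\<eta> \<in> sq_int (haar G (rng G x))"
  shows "conv G (\<lambda>t. \<xi> t - \<eta> t) F x = conv G \<xi> F x - conv G \<eta> F x"
  unfolding conv_def using conv_integrable[OF F \<xi>] conv_integrable[OF F \<eta>]
  by (simp add: left_diff_distrib)

lemma conv_scale: "conv G (\<lambda>t. c * \<xi> t) F x = c * conv G \<xi> F x"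
  unfolding conv_def by (simp add: mult.assoc)

lemma conv_add_right:
  assumes F: "F \<in> Cc" "H \<in> Cc" and \<xi>: "\<xi> \<in> sq_int (haar G (rng G x))"
  shows "conv G \<xi> (\<lambda>t. F t + H t) x = conv G \<xi> F x + conv G \<xi> H x"
  unfolding conv_def using conv_integrable[OF F(1) \<xi>] conv_integrable[OF F(2) \<xi>]
  by (simp add: distrib_left)

lemma conv_scale_right: "conv G \<xi> (\<lambda>t. c * F t) x = c * conv G \<xi> F x"
  unfolding conv_def by (simp add: mult.left_commute[of _ c])

lemma conv_cnj: "conv G (\<lambda>t. cnj (\<xi> t)) (\<lambda>t. cnj (F t)) x = cnj (conv G \<xi> F x)"
  unfolding conv_def by (simp flip: Bochner_Integration.integral_cnj)

text \<open>Stated bilinearly, without conjugation, so that it yields both the adjoint formula and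
  associativity.\<close>

lemma conv_dual:
  assumes F: "F \<in> Cc" and u: "u \<in> units G" and \<xi>: "\<xi> \<in> sq_int (haar G u)" and \<eta>: "\<eta> \<in> sq_int (haar G u)"
  shows "(LINT x|haar G u. conv G \<xi> F x * \<eta> x)
    = (LINT t|haar G u. \<xi> t * (LINT x|haar G u. F (gmul G (ginv G t) x) * \<eta> x))"
proof -
  have "(LINT x|haar G u. conv G \<xi> F x * \<eta> x)
      = (LINT x|haar G u. schur_kernel.op (haar G u) (ker F) \<xi> x * \<eta> x)"
    using conv_eq_op[OF F u] by (intro Bochner_Integration.integral_cong) auto
  also have "\<dots> = (LINT t|haar G u. \<xi> t * (LINT x|haar G u. ker F (t, x) * \<eta> x))"
    by (rule schur_kernel.op_dual[OF schur_ker[OF F u] \<xi> \<eta>])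
  finally show ?thesis by (simp add: ker_def)
qed

lemma conv_adjoint:
  assumes F: "F \<in> Cc" and u: "u \<in> units G" and \<xi>: "\<xi> \<in> sq_int (haar G u)" and \<eta>: "\<eta> \<in> sq_int (haar G u)"
  shows "l2_inner (haar G u) (conv G \<xi> F) \<eta> = l2_inner (haar G u) \<xi> (conv G \<eta> (invol G F))"
proof -
  let ?cF = "\<lambda>x. cnj (F x)"
  have cF: "?cF \<in> Cc" using F by (rule Cc_comp) (auto intro!: continuous_intros)
  have "l2_inner (haar G u) (conv G \<xi> F) \<eta> = (LINT x|haar G u. conv G (\<lambda>t. cnj (\<xi> t)) ?cF x * \<eta> x)"
    unfolding l2_inner_def conv_cnj ..
  also have "\<dots> = (LINT t|haar G u. cnj (\<xi> t) * (LINT x|haar G u. cnj (F (gmul G (ginv G t) x)) * \<eta> x))"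
    by (rule conv_dual[OF cF u sq_int_cnj[OF \<xi>] \<eta>])
  also have "\<dots> = l2_inner (haar G u) \<xi> (conv G \<eta> (invol G F))"
    unfolding l2_inner_def
  proof (intro Bochner_Integration.integral_cong refl)
    fix t assume "t \<in> space (haar G u)"
    then have t: "rng G t = u" by (simp add: space_haar[OF u] range_fibre_def)
    \<comment> \<open>Because (t^-1 x)^-1 = x^-1 t, the conjugate transpose of the kernel of F is
      the kernel of its involution.\<close>
    have "(LINT x|haar G u. cnj (F (gmul G (ginv G t) x)) * \<eta> x) = conv G \<eta> (invol G F) t"
      unfolding conv_def t
      by (intro Bochner_Integration.integral_cong)
         (auto simp: space_haar[OF u] range_fibre_def invol_def inv_inv_mul t)
    then show "cnj (\<xi> t) * (LINT x|haar G u. cnj (F (gmul G (ginv G t) x)) * \<eta> x)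
        = cnj (\<xi> t) * conv G \<eta> (invol G F) t" by simp
  qed
  finally show ?thesis .
qed

text \<open>\<open>conv_dual\<close> with y \<mapsto> H (y^-1 x) as second function exchanges the
  integrals; in the inner one left translation by t then produces the convolution of F and H at t^-1
  x.\<close>

lemma conv_assoc:
  assumes F: "F \<in> Cc" and H: "H \<in> Cc" and \<xi>: "\<xi> \<in> sq_int (haar G (rng G x))"
  shows "conv G (conv G \<xi> F) H x = conv G \<xi> (conv G F H) x"
proof -
  let ?u = "rng G x" and ?\<eta> = "\<lambda>t. H (gmul G (ginv G t) x)"
  have "conv G (conv G \<xi> F) H x = (LINT t|haar G ?u. \<xi> t * (LINT y|haar G ?u. F (gmul G (ginv G t) y) * ?\<eta> y))"
    unfolding conv_def[of G "conv G \<xi> F"]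
    by (rule conv_dual[OF F units_rng(1) \<xi> ker_right_sq_int[OF H]])
  also have "\<dots> = (LINT t|haar G ?u. \<xi> t * conv G F H (gmul G (ginv G t) x))"
  proof (intro Bochner_Integration.integral_cong refl)
    fix t assume "t \<in> space (haar G ?u)"
    then have t: "rng G t = rng G x" by (simp add: space_haar range_fibre_def)
    have m: "(\<lambda>y. F (gmul G (ginv G t) y) * ?\<eta> y) \<in> borel_measurable (haar G (rng G t))"
      using ker_left_measurable[OF Cc_continuous[OF F], of t]
        ker_right_measurable[OF Cc_continuous[OF H], of x] t by simp
    have "(LINT y|haar G ?u. F (gmul G (ginv G t) y) * ?\<eta> y)
        = (LINT y|haar G (src G t). F (gmul G (ginv G t) (gmul G t y)) * ?\<eta> (gmul G t y))"
      using haar_integral_invariant[OF m] t by simp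
    also have "\<dots> = (LINT y|haar G (src G t). F y * H (gmul G (ginv G y) (gmul G (ginv G t) x)))"
      by (intro Bochner_Integration.integral_cong)
         (auto simp: space_haar range_fibre_def inv_mul_cancel inv_mul_mul t)
    also have "\<dots> = conv G F H (gmul G (ginv G t) x)"
      unfolding conv_def rng_inv_mul[OF t] ..
    finally show "\<xi> t * (LINT y|haar G ?u. F (gmul G (ginv G t) y) * ?\<eta> y)
      = \<xi> t * conv G F H (gmul G (ginv G t) x)" by simp
  qed
  also have "\<dots> = conv G \<xi> (conv G F H) x" unfolding conv_def[of G \<xi>] ..
  finally show ?thesis .
qed

end

section \<open>Convolution within \<open>Cc\<close>\<close>

context lc_haar_groupoid
begin

lemma continuous_src: "continuous_on UNIV (src G)"
proof -
  have "continuous_on UNIV (\<lambda>x. rng G (ginv G x))"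
    by (rule continuous_on_compose2[OF continuous_rng continuous_inv]) simp
  then show ?thesis by (simp add: rng_inv)
qed

text \<open>A nonzero value at x requires t with f t and F (t^-1 x) nonzero, so x = t (t^-1 x) is a
  product of points of the supports. The composable pairs of such points form a compact set.\<close>

lemma conv_support:
  assumes f: "f \<in> Cc" and F: "F \<in> Cc"
  obtains L where "compact L" "\<forall>x. conv G f F x \<noteq> 0 \<longrightarrow> x \<in> L"
proof -
  obtain A where A: "compact A" "\<forall>x. f x \<noteq> 0 \<longrightarrow> x \<in> A" by (rule Cc_supportE[OF f])
  obtain B where B: "compact B" "\<forall>x. F x \<noteq> 0 \<longrightarrow> x \<in> B" by (rule Cc_supportE[OF F])
  let ?D = "{p. src G (fst p) = rng G (snd p)}"
  have D: "closed ?D"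
    by (intro closed_Collect_eq continuous_on_compose2[OF continuous_rng] continuous_on_compose2[OF continuous_src]
        continuous_intros) auto
  have c: "compact (A \<times> B \<inter> ?D)" by (rule compact_Int_closed[OF compact_Times[OF A(1) B(1)] D])
  have "continuous_on (A \<times> B \<inter> ?D) (\<lambda>(x, y). gmul G x y)"
    by (rule continuous_on_subset[OF continuous_mul]) auto
  from compact_continuous_image[OF this c]
  have L: "compact ((\<lambda>(x, y). gmul G x y) ` (A \<times> B \<inter> ?D))" .
  show thesis
  proof (rule that[OF L], intro allI impI)
    fix x assume nz: "conv G f F x \<noteq> 0"
    have "\<exists>t. rng G t = rng G x \<and> f t * F (gmul G (ginv G t) x) \<noteq> 0"
    proof (rule ccontr)
      assume "\<not> ?thesis"
      then have "conv G f F x = (LINT t|haar G (rng G x). 0)"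
        unfolding conv_def
        by (intro Bochner_Integration.integral_cong refl) (auto simp: space_haar range_fibre_def)
      then show False using nz by simp
    qed
    then obtain t where t: "rng G t = rng G x" "f t \<noteq> 0" "F (gmul G (ginv G t) x) \<noteq> 0" by auto
    have "x = (\<lambda>(x, y). gmul G x y) (t, gmul G (ginv G t) x)" using t(1) by (simp add: mul_inv_cancel)
    moreover have "(t, gmul G (ginv G t) x) \<in> A \<times> B \<inter> ?D" using t A B by (simp add: rng_inv_mul)
    ultimately show "x \<in> (\<lambda>(x, y). gmul G x y) ` (A \<times> B \<inter> ?D)" by (rule image_eqI)
  qed
qed

text \<open>Near \<open>x\<^sub>0\<close> the integrand is uniformly close to \<open>f g\<close>, where \<open>g\<close> is a continuous
  extension of \<open>t \<mapsto> F (t\<^sup>-\<^sup>1 x\<^sub>0)\<close> off the fibre of \<open>x\<^sub>0\<close>, and integrals of \<open>f g\<close> vary continuously.\<close>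

lemma conv_continuous:
  assumes f: "f \<in> Cc" and F: "F \<in> Cc"
  shows "continuous_on UNIV (conv G f F)"
  unfolding continuous_on_eq_continuous_at[OF open_UNIV] isCont_def
proof (intro ballI tendstoI)
  fix x0 :: 'g and e :: real assume e: "e > 0"
  obtain A where A: "compact A" "\<forall>x. f x \<noteq> 0 \<longrightarrow> x \<in> A" by (rule Cc_supportE[OF f])
  have S: "compact (A \<inter> range_fibre G (rng G x0))" by (rule compact_Int_closed[OF A(1) closed_fibre])
  have div: "continuous_on {p. rng G (fst p) = rng G (snd p)} (\<lambda>p. F (gmul G (ginv G (fst p)) (snd p)))"
    using continuous_on_compose2[OF Cc_continuous[OF F] continuous_div] by (simp add: case_prod_unfold)
  have "continuous_on (A \<inter> range_fibre G (rng G x0)) (\<lambda>t. F (gmul G (ginv G (fst (t, x0))) (snd (t, x0))))"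
    by (rule continuous_on_compose2[OF div]) (auto intro!: continuous_intros simp: range_fibre_def)
  then have "continuous_on (A \<inter> range_fibre G (rng G x0)) (\<lambda>t. F (gmul G (ginv G t) x0))" by simp
  then obtain g where g: "continuous_on UNIV g"
    "\<And>t. t \<in> A \<inter> range_fibre G (rng G x0) \<Longrightarrow> g t = F (gmul G (ginv G t) x0)"
    using tietze_complex[OF lc S] by blast
  define h where "h t = f t * g t" for t
  have h: "h \<in> Cc" unfolding h_def[abs_def] by (rule Cc_mult[OF f g(1)])
  \<comment> \<open>\<open>k\<close> is 1 wherever f is nonzero, so a uniform bound on the error of
    the integrands integrates to a multiple of the integral of \<open>k\<close>.\<close>
  obtain k where k: "\<And>x. 0 \<le> k x" "\<And>x. x \<in> A \<Longrightarrow> k x = 1" "(\<lambda>x. complex_of_real (k x)) \<in> Cc"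
    using urysohn_Cc[OF lc A(1) open_UNIV] by (metis subset_UNIV)
  have kint: "integrable (haar G (rng G x)) k" for x
    using integrable_Re[OF Cc_integrable_haar[OF units_rng(1) k(3)]] by simp
  have contk: "continuous_on UNIV (\<lambda>x. LINT t|haar G (rng G x). k t)"
    by (rule continuous_on_compose2[OF haar_integral_real_continuous[OF k(3)] continuous_rng]) auto
  have conth: "continuous_on UNIV (\<lambda>x. LINT t|haar G (rng G x). h t)"
    by (rule continuous_on_compose2[OF haar_continuous[OF h] continuous_rng]) auto
  \<comment> \<open>By continuity the integral of \<open>k\<close> stays below \<open>B\<close> on
    the fibres near that of \<open>x0\<close>; \<open>d\<close> is then chosen so that d B =
    e/2.\<close>
  define B where "B = (LINT t|haar G (rng G x0). k t) + 1"
  have B: "B > 0" unfolding B_def using k(1) by (simp add: add_nonneg_pos)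
  define d where "d = e / (2 * B)"
  have d: "d > 0" unfolding d_def using e B by simp
  \<comment> \<open>\<open>Q\<close> below consists of the pairs (x, t) that have different ranges
    or have error below \<open>d\<close>. It is open and contains {x0} \<times> A, since the error
    vanishes on the fibre of \<open>x0\<close>; the tube lemma yields one neighbourhood of
    \<open>x0\<close> that serves all t in \<open>A\<close>.\<close>
  let ?D = "{p. rng G (fst p) = rng G (snd p)} :: ('g \<times> 'g) set"
  let ?q = "\<lambda>p. cmod (f (snd p) * F (gmul G (ginv G (snd p)) (fst p)) - h (snd p))"
  have cD: "closed ?D"
    by (intro closed_Collect_eq continuous_on_compose2[OF continuous_rng] continuous_intros) auto
  have "continuous_on ?D (\<lambda>p. F (gmul G (ginv G (fst (snd p, fst p))) (snd (snd p, fst p))))"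
    by (rule continuous_on_compose2[OF div]) (auto intro!: continuous_intros)
  then have "continuous_on ?D ?q"
    by (intro continuous_intros continuous_on_compose2[OF Cc_continuous[OF f]]
        continuous_on_compose2[OF Cc_continuous[OF h]]) auto
  then have "closed (?D \<inter> ?q -` {d..})" by (rule continuous_closed_preimage[OF _ cD closed_atLeast])
  moreover define Q where "Q = - (?D \<inter> ?q -` {d..})"
  ultimately have W: "open Q" by (simp only: open_Compl)
  have "{x0} \<times> A \<subseteq> Q"
    unfolding Q_def using g(2) d by (auto simp: h_def range_fibre_def)
  then obtain X where X: "x0 \<in> X" "open X" "X \<times> A \<subseteq> Q"
    using Elementary_Topology.tube_lemma[OF A(1) W] by blast
  have x0: "conv G f F x0 = (LINT t|haar G (rng G x0). h t)"
    unfolding conv_def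
  proof (intro Bochner_Integration.integral_cong refl)
    fix t assume "t \<in> space (haar G (rng G x0))"
    then show "f t * F (gmul G (ginv G t) x0) = h t"
      using A(2) g(2) unfolding h_def by (cases "f t = 0") (auto simp: space_haar)
  qed
  have near: "cmod (conv G f F x - (LINT t|haar G (rng G x). h t)) \<le> d * (LINT t|haar G (rng G x). k t)"
    if x: "x \<in> X" for x
  proof -
    have i1: "integrable (haar G (rng G x)) (\<lambda>t. f t * F (gmul G (ginv G t) x))"
      by (intro conv_integrable F Cc_sq_int f units_rng)
    have i2: "integrable (haar G (rng G x)) h" by (intro Cc_integrable_haar h units_rng)
    have "conv G f F x - (LINT t|haar G (rng G x). h t)
        = (LINT t|haar G (rng G x). f t * F (gmul G (ginv G t) x) - h t)"
      unfolding conv_def using i1 i2 by simp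
    also have "cmod \<dots> \<le> (LINT t|haar G (rng G x). cmod (f t * F (gmul G (ginv G t) x) - h t))"
      by (rule integral_norm_bound)
    also have "\<dots> \<le> (LINT t|haar G (rng G x). d * k t)"
    proof (rule integral_mono)
      fix t assume "t \<in> space (haar G (rng G x))"
      then have t: "rng G t = rng G x" by (simp add: space_haar range_fibre_def)
      show "cmod (f t * F (gmul G (ginv G t) x) - h t) \<le> d * k t"
      proof (cases "t \<in> A")
        case True
        then have "(x, t) \<in> Q" using X(3) x by blast
        then have "(x, t) \<in> - (?D \<inter> ?q -` {d..})" unfolding Q_def .
        then have "cmod (f t * F (gmul G (ginv G t) x) - h t) < d" using t by auto
        then show ?thesis using k(2)[OF True] by simp
      next
        case False
        then have "f t = 0" using A(2) by blast
        then show ?thesis using d k(1)[of t] by (simp add: h_def)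
      qed
    qed (use i1 i2 kint in auto)
    finally show ?thesis by simp
  qed
  have ev1: "\<forall>\<^sub>F x in at x0. x \<in> X" using X(1,2) by (auto simp: eventually_at_topological)
  have "((\<lambda>x. LINT t|haar G (rng G x). k t) \<longlongrightarrow> (LINT t|haar G (rng G x0). k t)) (at x0)"
    using contk by (simp add: continuous_on_def)
  then have ev2: "\<forall>\<^sub>F x in at x0. (LINT t|haar G (rng G x). k t) < B"
    unfolding B_def by (rule order_tendstoD(2)) simp
  have "((\<lambda>x. LINT t|haar G (rng G x). h t) \<longlongrightarrow> (LINT t|haar G (rng G x0). h t)) (at x0)"
    using conth by (simp add: continuous_on_def)
  then have ev3: "\<forall>\<^sub>F x in at x0. dist (LINT t|haar G (rng G x). h t) (LINT t|haar G (rng G x0). h t) < e/2"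
    by (rule tendstoD) (use e in simp)
  show "\<forall>\<^sub>F x in at x0. dist (conv G f F x) (conv G f F x0) < e"
    using ev1 ev2 ev3
  proof eventually_elim
    fix x assume x: "x \<in> X" "(LINT t|haar G (rng G x). k t) < B"
      "dist (LINT t|haar G (rng G x). h t) (LINT t|haar G (rng G x0). h t) < e/2"
    have "cmod (conv G f F x - (LINT t|haar G (rng G x). h t)) \<le> d * B"
      using near[OF x(1)] mult_left_mono[OF less_imp_le[OF x(2)] less_imp_le[OF d]] by linarith
    also have "d * B = e / 2" unfolding d_def using B by simp
    finally show "dist (conv G f F x) (conv G f F x0) < e"
      using dist_triangle[of "conv G f F x" "conv G f F x0" "LINT t|haar G (rng G x). h t"] x(3)
      unfolding x0 by (simp add: dist_norm)
  qed
qed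

lemma conv_Cc:
  assumes f: "f \<in> Cc" and F: "F \<in> Cc" shows "conv G f F \<in> Cc"
proof -
  obtain L where L: "compact L" "\<forall>x. conv G f F x \<noteq> 0 \<longrightarrow> x \<in> L" by (rule conv_support[OF f F])
  show ?thesis by (rule CcI[OF conv_continuous[OF f F] L(1)]) (use L in auto)
qed

text \<open>Left translation replaces t by x t, and (x t)^-1 x = t^-1. Composed with
  \<open>R\<close>, which reverses products as well, inversion thus gives a homomorphism.\<close>

lemma flip_conv:
  assumes F: "F \<in> Cc" and H: "H \<in> Cc"
  shows "flip G (conv G F H) = conv G (flip G H) (flip G F)"
proof
  fix x
  have m: "(\<lambda>t. flip G H t * flip G F (gmul G (ginv G t) x)) \<in> borel_measurable (haar G (rng G x))"
    using conv_integrable[OF flip_Cc[OF F], of "flip G H" x] Cc_sq_int[OF units_rng(1) flip_Cc[OF H]]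
    by (auto intro: borel_measurable_integrable)
  have "conv G (flip G H) (flip G F) x
      = (LINT t|haar G (src G x). flip G H (gmul G x t) * flip G F (gmul G (ginv G (gmul G x t)) x))"
    unfolding conv_def by (rule haar_integral_invariant[OF m, symmetric])
  also have "\<dots> = (LINT t|haar G (src G x). F t * H (gmul G (ginv G t) (ginv G x)))"
  proof (intro Bochner_Integration.integral_cong refl)
    fix t assume "t \<in> space (haar G (src G x))"
    then have t: "src G x = rng G t" by (simp add: space_haar range_fibre_def)
    have "gmul G (ginv G (gmul G x t)) x = gmul G (ginv G t) (src G x)"
      using inv_mul_mul[OF t, of x] by (simp add: inv_mul)
    also have "\<dots> = ginv G t" using mul_unit[of "ginv G t"] t by (simp add: src_inv)
    finally have "flip G F (gmul G (ginv G (gmul G x t)) x) = F t" by (simp add: flip_def inv_inv)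
    moreover have "flip G H (gmul G x t) = H (gmul G (ginv G t) (ginv G x))"
      using t by (simp add: flip_def inv_mul_eq)
    ultimately show "flip G H (gmul G x t) * flip G F (gmul G (ginv G (gmul G x t)) x)
      = F t * H (gmul G (ginv G t) (ginv G x))" by simp
  qed
  also have "\<dots> = flip G (conv G F H) x" by (simp add: flip_def conv_def rng_inv)
  finally show "flip G (conv G F H) x = conv G (flip G H) (flip G F) x" by simp
qed

end

section \<open>Continuous sections\<close>

context lc_haar_groupoid
begin

definition sections :: "('g \<Rightarrow> complex) set"
  where "sections = {\<xi>. continuous_section G \<xi> \<and> vanishing_section G \<xi>}"

lemma sections_sq_int: "\<xi> \<in> sections \<Longrightarrow> u \<in> units G \<Longrightarrow> \<xi> \<in> sq_int (haar G u)"
  unfolding sections_def continuous_section_def by blast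

lemma sections_approx:
  assumes "\<xi> \<in> sections" "u \<in> units G" "e > 0"
  obtains f V where "f \<in> Cc" "open V" "u \<in> V"
    "\<forall>v\<in>V \<inter> units G. l2_norm (haar G v) (\<lambda>x. \<xi> x - f x) < e"
proof -
  have "\<exists>f\<in>Cc. \<exists>V. open V \<and> u \<in> V \<and> (\<forall>v\<in>V \<inter> units G. l2_norm (haar G v) (\<lambda>x. \<xi> x - f x) < e)"
    using assms by (simp add: sections_def continuous_section_def)
  then obtain f V where "f \<in> Cc" "open V" "u \<in> V"
    "\<forall>v\<in>V \<inter> units G. l2_norm (haar G v) (\<lambda>x. \<xi> x - f x) < e" by (elim bexE exE conjE)
  then show thesis by (intro that[of f V]) simp_all
qed

lemma sections_vanish:
  assumes "\<xi> \<in> sections" "e > 0"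
  obtains K where "compact K" "K \<subseteq> units G"
    "\<forall>u\<in>units G - K. l2_norm (haar G u) \<xi> < e"
proof -
  have "\<exists>K. compact K \<and> K \<subseteq> units G \<and> (\<forall>u\<in>units G - K. l2_norm (haar G u) \<xi> < e)"
    using assms by (simp add: sections_def vanishing_section_def)
  then obtain K where "compact K" "K \<subseteq> units G" "\<forall>u\<in>units G - K. l2_norm (haar G u) \<xi> < e"
    by (elim exE conjE)
  then show thesis by (intro that[of K]) simp_all
qed

lemma sectionsI:
  assumes "\<And>u. u \<in> units G \<Longrightarrow> \<xi> \<in> sq_int (haar G u)"
    and "\<And>u e. u \<in> units G \<Longrightarrow> e > 0 \<Longrightarrow> \<exists>f\<in>Cc. \<exists>V. open V \<and> u \<in> V \<and>
       (\<forall>v\<in>V \<inter> units G. l2_norm (haar G v) (\<lambda>x. \<xi> x - f x) < e)"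
    and "\<And>e. e > 0 \<Longrightarrow> \<exists>K. compact K \<and> K \<subseteq> units G \<and> (\<forall>u\<in>units G - K. l2_norm (haar G u) \<xi> < e)"
  shows "\<xi> \<in> sections"
  unfolding sections_def continuous_section_def vanishing_section_def
  by (intro CollectI conjI ballI allI impI assms)

lemma l2_norm_zero_fibre:
  assumes "u \<in> units G" "\<And>x. rng G x = u \<Longrightarrow> f x = 0"
  shows "l2_norm (haar G u) f = 0"
proof -
  have "l2_norm (haar G u) f = l2_norm (haar G u) (\<lambda>x. 0)"
    by (rule l2_norm_cong) (use assms in \<open>simp add: space_haar range_fibre_def\<close>)
  then show ?thesis by (simp add: l2_norm_def)
qed

lemma Cc_sections:
  assumes f: "f \<in> Cc" shows "f \<in> sections"
proof (rule sectionsI)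
  fix u assume u: "u \<in> units G"
  show "f \<in> sq_int (haar G u)" by (rule Cc_sq_int[OF u f])
  fix e :: real assume "e > 0"
  then show "\<exists>f'\<in>Cc. \<exists>V. open V \<and> u \<in> V \<and> (\<forall>v\<in>V \<inter> units G. l2_norm (haar G v) (\<lambda>x. f x - f' x) < e)"
    by (intro bexI[OF _ f] exI[of _ UNIV]) (simp add: l2_norm_def)
next
  fix e :: real assume "e > 0"
  obtain K where K: "compact K" "K \<subseteq> units G" "\<forall>x. rng G x \<notin> K \<longrightarrow> f x = 0"
    by (rule Cc_fibre_outside[OF f])
  then have "\<forall>u\<in>units G - K. l2_norm (haar G u) f < e"
    using l2_norm_zero_fibre[of _ f] \<open>e > 0\<close> by auto
  then show "\<exists>K. compact K \<and> K \<subseteq> units G \<and> (\<forall>u\<in>units G - K. l2_norm (haar G u) f < e)"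
    using K by blast
qed

lemma Cc_norm_bdd:
  assumes f: "f \<in> Cc"
  obtains B where "\<forall>u\<in>units G. l2_norm (haar G u) f \<le> B"
proof -
  obtain B where B: "\<And>u. u \<in> units G \<Longrightarrow> (LINT x|haar G u. cmod (complex_of_real ((cmod (f x))\<^sup>2))) \<le> B"
    using haar_integral_cmod_bdd[OF Cc_cmod_sq[OF f]] by (auto simp: bdd_above_def)
  have "l2_norm (haar G u) f \<le> sqrt B" if "u \<in> units G" for u
    unfolding l2_norm_def using B[OF that] by (simp add: norm_power)
  then show thesis by (intro that ballI)
qed

text \<open>Off a compact set of units the norms are below 1. Near each unit they exceed those of
  some \<open>Cc\<close> function by less than 1, and finitely many such neighbourhoods cover the
  compact set.\<close>

lemma sections_bdd:
  assumes \<xi>: "\<xi> \<in> sections"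
  shows "bdd_above ((\<lambda>u. l2_norm (haar G u) \<xi>) ` units G)"
proof -
  obtain K where K': "compact K" "K \<subseteq> units G"
    "\<forall>u\<in>units G - K. l2_norm (haar G u) \<xi> < 1"
    by (rule sections_vanish[OF \<xi> zero_less_one])
  note K = K'(1,2) K'(3)[rule_format, OF DiffI]
  have "\<exists>V B. open V \<and> u \<in> V \<and> (\<forall>v\<in>V \<inter> units G. l2_norm (haar G v) \<xi> \<le> B)" if u: "u \<in> units G" for u
  proof -
    obtain f V where f': "f \<in> Cc" "open V" "u \<in> V"
      "\<forall>v\<in>V \<inter> units G. l2_norm (haar G v) (\<lambda>x. \<xi> x - f x) < 1"
      by (rule sections_approx[OF \<xi> u zero_less_one])
    note f = f'(1-3) f'(4)[rule_format, OF IntI]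
    obtain B where B': "\<forall>u\<in>units G. l2_norm (haar G u) f \<le> B" by (rule Cc_norm_bdd[OF f(1)])
    note B = B'[rule_format]
    have "l2_norm (haar G v) \<xi> \<le> B + 1" if v: "v \<in> V" "v \<in> units G" for v
      using l2_norm_triangle_sub[OF sections_sq_int[OF \<xi> v(2)] Cc_sq_int[OF v(2) f(1)]] B[OF v(2)] f(4)[OF v]
      by linarith
    then show ?thesis using f by blast
  qed
  then obtain V B where VB: "\<And>u. u \<in> units G \<Longrightarrow> open (V u)" "\<And>u. u \<in> units G \<Longrightarrow> u \<in> V u"
    "\<And>u v. u \<in> units G \<Longrightarrow> v \<in> V u \<Longrightarrow> v \<in> units G \<Longrightarrow> l2_norm (haar G v) \<xi> \<le> B u"
  proof -
    have "\<forall>u\<in>units G. \<exists>V B. open V \<and> u \<in> V \<and> (\<forall>v\<in>V \<inter> units G. l2_norm (haar G v) \<xi> \<le> B)"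
      using \<open>\<And>u. u \<in> units G \<Longrightarrow> \<exists>V B. open V \<and> u \<in> V \<and> (\<forall>v\<in>V \<inter> units G. l2_norm (haar G v) \<xi> \<le> B)\<close> by simp
    then obtain V B where "\<forall>u\<in>units G. open (V u) \<and> u \<in> V u \<and> (\<forall>v\<in>V u \<inter> units G. l2_norm (haar G v) \<xi> \<le> B u)"
      unfolding bchoice_iff by (elim exE)
    then show thesis by (intro that[of V B]) simp_all
  qed
  have cover: "K \<subseteq> (\<Union>u\<in>K. V u)" using VB(2) K(2) by blast
  obtain C where C: "C \<subseteq> K" "finite C" "K \<subseteq> (\<Union>u\<in>C. V u)"
    by (rule compactE_image[OF K(1) VB(1)[OF subsetD[OF K(2)]] cover])
  have "l2_norm (haar G v) \<xi> \<le> 1 + (\<Sum>u\<in>C. \<bar>B u\<bar>)" if v: "v \<in> units G" for v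
  proof (cases "v \<in> K")
    case True
    then obtain u where u: "u \<in> C" "v \<in> V u" using C(3) by blast
    have "l2_norm (haar G v) \<xi> \<le> \<bar>B u\<bar>" using VB(3)[OF _ u(2) v] u C(1) K(2) by force
    also have "\<dots> \<le> (\<Sum>u\<in>C. \<bar>B u\<bar>)" by (rule member_le_sum[OF u(1)]) (use C(2) in auto)
    finally show ?thesis by simp
  next
    case False
    then show ?thesis using K(3)[OF v False] sum_nonneg[of C "\<lambda>u. \<bar>B u\<bar>"] by linarith
  qed
  then show ?thesis by (rule bdd_aboveI2)
qed

lemma sections_add:
  assumes \<xi>: "\<xi> \<in> sections" and \<eta>: "\<eta> \<in> sections"
  shows "(\<lambda>x. \<xi> x + \<eta> x) \<in> sections"
proof (rule sectionsI)
  fix u assume u: "u \<in> units G"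
  show "(\<lambda>x. \<xi> x + \<eta> x) \<in> sq_int (haar G u)" by (intro sq_int_add sections_sq_int \<xi> \<eta> u)
  fix e :: real assume e: "e > 0"
  obtain f V where f': "f \<in> Cc" "open V" "u \<in> V"
    "\<forall>v\<in>V \<inter> units G. l2_norm (haar G v) (\<lambda>x. \<xi> x - f x) < e/2"
    by (rule sections_approx[OF \<xi> u half_gt_zero[OF e]])
  note f = f'(1-3) f'(4)[rule_format, OF IntI]
  obtain g W where g': "g \<in> Cc" "open W" "u \<in> W"
    "\<forall>v\<in>W \<inter> units G. l2_norm (haar G v) (\<lambda>x. \<eta> x - g x) < e/2"
    by (rule sections_approx[OF \<eta> u half_gt_zero[OF e]])
  note g = g'(1-3) g'(4)[rule_format, OF IntI]
  have "l2_norm (haar G v) (\<lambda>x. \<xi> x + \<eta> x - (f x + g x)) < e" if v: "v \<in> V \<inter> W" "v \<in> units G" for v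
  proof -
    have "l2_norm (haar G v) (\<lambda>x. (\<xi> x - f x) + (\<eta> x - g x)) \<le>
        l2_norm (haar G v) (\<lambda>x. \<xi> x - f x) + l2_norm (haar G v) (\<lambda>x. \<eta> x - g x)"
      by (intro l2_norm_add sq_int_diff sections_sq_int \<xi> \<eta> Cc_sq_int f g v)
    then show ?thesis using f(4)[of v] g(4)[of v] v by (simp add: algebra_simps)
  qed
  then show "\<exists>f'\<in>Cc. \<exists>V. open V \<and> u \<in> V \<and> (\<forall>v\<in>V \<inter> units G. l2_norm (haar G v) (\<lambda>x. \<xi> x + \<eta> x - f' x) < e)"
    using f g by (intro bexI[OF _ Cc_add[OF f(1) g(1)]] exI[of _ "V \<inter> W"]) auto
next
  fix e :: real assume e: "e > 0"
  obtain K where K': "compact K" "K \<subseteq> units G"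
    "\<forall>u\<in>units G - K. l2_norm (haar G u) \<xi> < e/2"
    by (rule sections_vanish[OF \<xi> half_gt_zero[OF e]])
  note K = K'(1,2) K'(3)[rule_format, OF DiffI]
  obtain L where L': "compact L" "L \<subseteq> units G"
    "\<forall>u\<in>units G - L. l2_norm (haar G u) \<eta> < e/2"
    by (rule sections_vanish[OF \<eta> half_gt_zero[OF e]])
  note L = L'(1,2) L'(3)[rule_format, OF DiffI]
  have "l2_norm (haar G u) (\<lambda>x. \<xi> x + \<eta> x) < e" if "u \<in> units G" "u \<notin> K \<union> L" for u
    using l2_norm_add[OF sections_sq_int[OF \<xi> that(1)] sections_sq_int[OF \<eta> that(1)]]
      K(3)[OF that(1)] L(3)[OF that(1)] that(2) by simp
  then show "\<exists>K. compact K \<and> K \<subseteq> units G \<and> (\<forall>u\<in>units G - K. l2_norm (haar G u) (\<lambda>x. \<xi> x + \<eta> x) < e)"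
    using K L by (intro exI[of _ "K \<union> L"]) auto
qed

lemma l2_norm_act:
  assumes v: "v \<in> units G"
  shows "l2_norm (haar G v) (\<lambda>x. \<xi> x * b (rng G x)) = cmod (b v) * l2_norm (haar G v) \<xi>"
proof -
  have "(LINT x|haar G v. (cmod (\<xi> x * b (rng G x)))\<^sup>2) = (LINT x|haar G v. (cmod (b v))\<^sup>2 * (cmod (\<xi> x))\<^sup>2)"
    by (intro Bochner_Integration.integral_cong)
       (auto simp: space_haar[OF v] range_fibre_def norm_mult power_mult_distrib)
  then show ?thesis unfolding l2_norm_def by (simp add: real_sqrt_mult)
qed

lemma sq_int_act:
  assumes v: "v \<in> units G" and \<xi>: "\<xi> \<in> sq_int (haar G v)"
  shows "(\<lambda>x. \<xi> x * b (rng G x)) \<in> sq_int (haar G v)"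
  using sq_int_scale[OF \<xi>, of "b v"]
  by (subst sq_int_cong[where g="\<lambda>x. b v * \<xi> x"]) (auto simp: space_haar[OF v] range_fibre_def)

lemma Cc_act:
  assumes f: "f \<in> Cc" and b: "continuous_on (units G) b"
  shows "(\<lambda>x. f x * b (rng G x)) \<in> Cc"
  by (rule Cc_mult[OF f]) (rule continuous_on_compose2[OF b continuous_rng], auto)

text \<open>Boundedness and continuity of b are assumed instead of decay at infinity, so that
  constant b covers multiplication by scalars.\<close>

lemma sections_act:
  assumes \<xi>: "\<xi> \<in> sections" and b: "continuous_on (units G) b"
    and bd: "\<And>v. v \<in> units G \<Longrightarrow> cmod (b v) \<le> B"
  shows "(\<lambda>x. \<xi> x * b (rng G x)) \<in> sections"
proof (rule sectionsI)
  have B0: "0 \<le> B" using bd[OF units_rng(1)[of undefined]] norm_ge_zero order_trans by blast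
  { fix u assume u: "u \<in> units G"
    show "(\<lambda>x. \<xi> x * b (rng G x)) \<in> sq_int (haar G u)" by (intro sq_int_act sections_sq_int \<xi> u)
    fix e :: real assume e: "e > 0"
    have e': "e / (B + 1) > 0" using e B0 by simp
    obtain f V where f': "f \<in> Cc" "open V" "u \<in> V"
      "\<forall>v\<in>V \<inter> units G. l2_norm (haar G v) (\<lambda>x. \<xi> x - f x) < e / (B + 1)"
      by (rule sections_approx[OF \<xi> u e'])
    note f = f'(1-3) f'(4)[rule_format, OF IntI]
    have "l2_norm (haar G v) (\<lambda>x. \<xi> x * b (rng G x) - f x * b (rng G x)) < e" if v: "v \<in> V \<inter> units G" for v
    proof -
      have "l2_norm (haar G v) (\<lambda>x. \<xi> x * b (rng G x) - f x * b (rng G x))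
          = cmod (b v) * l2_norm (haar G v) (\<lambda>x. \<xi> x - f x)"
        using l2_norm_act[of v "\<lambda>x. \<xi> x - f x" b] v by (simp add: left_diff_distrib)
      also have "\<dots> \<le> B * (e / (B + 1))"
        using bd[of v] f(4)[of v] v B0 by (intro mult_mono) (auto simp: l2_norm_nonneg)
      also have "\<dots> < e" using e B0 by (simp add: field_simps)
      finally show ?thesis .
    qed
    then show "\<exists>f'\<in>Cc. \<exists>V. open V \<and> u \<in> V \<and>
        (\<forall>v\<in>V \<inter> units G. l2_norm (haar G v) (\<lambda>x. \<xi> x * b (rng G x) - f' x) < e)"
      using f by (intro bexI[OF _ Cc_act[OF f(1) b]] exI[of _ V]) auto }
  fix e :: real assume e: "e > 0"
  have e': "e / (B + 1) > 0" using e B0 by simp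
  obtain K where K': "compact K" "K \<subseteq> units G"
    "\<forall>u\<in>units G - K. l2_norm (haar G u) \<xi> < e / (B + 1)"
    by (rule sections_vanish[OF \<xi> e'])
  note K = K'(1,2) K'(3)[rule_format, OF DiffI]
  have "l2_norm (haar G u) (\<lambda>x. \<xi> x * b (rng G x)) < e" if u: "u \<in> units G - K" for u
  proof -
    have "cmod (b u) * l2_norm (haar G u) \<xi> \<le> B * (e / (B + 1))"
      using bd[of u] K(3)[of u] u B0 by (intro mult_mono) (auto simp: l2_norm_nonneg)
    also have "\<dots> < e" using e B0 by (simp add: field_simps)
    finally show ?thesis using l2_norm_act[of u \<xi> b] u by simp
  qed
  then show "\<exists>K. compact K \<and> K \<subseteq> units G \<and> (\<forall>u\<in>units G - K. l2_norm (haar G u) (\<lambda>x. \<xi> x * b (rng G x)) < e)"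
    using K by blast
qed

lemma C0_units_bounded:
  assumes b: "b \<in> C0_units G"
  obtains B where "\<forall>v\<in>units G. cmod (b v) \<le> B"
proof -
  have c: "continuous_on (units G) b" using b unfolding C0_units_def by blast
  have "\<exists>K. compact K \<and> K \<subseteq> units G \<and> (\<forall>u\<in>units G - K. cmod (b u) < 1)"
    using b by (simp add: C0_units_def)
  then obtain K where K': "compact K" "K \<subseteq> units G" "\<forall>u\<in>units G - K. cmod (b u) < 1"
    by (elim exE conjE)
  then have K: "compact K" "K \<subseteq> units G" "\<And>u. u \<in> units G \<Longrightarrow> u \<notin> K \<Longrightarrow> cmod (b u) < 1" by simp_all
  have "bounded (b ` K)"
    by (intro compact_imp_bounded compact_continuous_image continuous_on_subset[OF c K(2)] K(1))
  then obtain B where B: "\<And>v. v \<in> K \<Longrightarrow> cmod (b v) \<le> B" unfolding bounded_iff by auto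
  have "cmod (b v) \<le> max 1 B" if "v \<in> units G" for v
    using B[of v] K(3)[OF that] by (cases "v \<in> K") auto
  then show thesis by (intro that ballI)
qed

lemma sections_scale: "\<xi> \<in> sections \<Longrightarrow> (\<lambda>x. c * \<xi> x) \<in> sections"
  using sections_act[of \<xi> "\<lambda>_. c" "cmod c"] by (simp add: mult.commute)

lemma sections_diff: "\<xi> \<in> sections \<Longrightarrow> \<eta> \<in> sections \<Longrightarrow> (\<lambda>x. \<xi> x - \<eta> x) \<in> sections"
  using sections_add[of \<xi> "\<lambda>x. (-1) * \<eta> x"] sections_scale[of \<eta> "-1"] by simp

text \<open>Serves both completeness of the module and, with a constant sequence, the passage to
  another representative of a class.\<close>

lemma sections_uniform_limit:
  assumes X: "\<And>n. X n \<in> sections" and l: "\<And>u. u \<in> units G \<Longrightarrow> l \<in> sq_int (haar G u)"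
    and lim: "\<And>e. e > 0 \<Longrightarrow> \<exists>n. \<forall>u\<in>units G. l2_norm (haar G u) (\<lambda>x. X n x - l x) \<le> e"
  shows "l \<in> sections"
proof (rule sectionsI)
  fix e :: real assume e: "e > 0"
  then have e2: "e/2 > 0" by simp
  obtain n where n: "\<And>u. u \<in> units G \<Longrightarrow> l2_norm (haar G u) (\<lambda>x. X n x - l x) \<le> e/2"
    using lim[OF e2] by blast
  { fix u assume u: "u \<in> units G"
    obtain f V where f': "f \<in> Cc" "open V" "u \<in> V"
      "\<forall>v\<in>V \<inter> units G. l2_norm (haar G v) (\<lambda>x. X n x - f x) < e/2"
      by (rule sections_approx[OF X u e2])
    note f = f'(1-3) f'(4)[rule_format, OF IntI]
    have "l2_norm (haar G v) (\<lambda>x. l x - f x) < e" if v: "v \<in> V \<inter> units G" for v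
      using l2_norm_diff_triangle[OF l sections_sq_int[OF X] Cc_sq_int[OF _ f(1)], of v n] n[of v] f(4)[of v] v
        l2_norm_diff_commute[of "haar G v" l "X n"] by simp
    then show "\<exists>f\<in>Cc. \<exists>V. open V \<and> u \<in> V \<and> (\<forall>v\<in>V \<inter> units G. l2_norm (haar G v) (\<lambda>x. l x - f x) < e)"
      using f by blast }
  obtain K where K': "compact K" "K \<subseteq> units G"
    "\<forall>u\<in>units G - K. l2_norm (haar G u) (X n) < e/2"
    by (rule sections_vanish[OF X e2])
  note K = K'(1,2) K'(3)[rule_format, OF DiffI]
  have "l2_norm (haar G u) l < e" if u: "u \<in> units G - K" for u
    using l2_norm_triangle_sub[OF l sections_sq_int[OF X], of u n] n[of u] K(3)[of u] u
      l2_norm_diff_commute[of "haar G u" l "X n"] by simp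
  then show "\<exists>K. compact K \<and> K \<subseteq> units G \<and> (\<forall>u\<in>units G - K. l2_norm (haar G u) l < e)"
    using K by blast
qed (rule l)

text \<open>If f is close to xi near a unit, then the convolution of f with F, again in
  \<open>Cc\<close>, is close to that of xi, the error growing at most by the factor
  \<open>I_norm G F\<close>. Decay at infinity follows from the same bound.\<close>

lemma conv_sections:
  assumes F: "F \<in> Cc" and \<xi>: "\<xi> \<in> sections"
  shows "conv G \<xi> F \<in> sections"
proof (rule sectionsI)
  let ?I = "I_norm G F + 1"
  have I: "I_norm G F \<ge> 0" by (rule I_norm_nonneg[OF F])
  { fix u assume u: "u \<in> units G"
    show "conv G \<xi> F \<in> sq_int (haar G u)" by (intro conv_sq_int F u sections_sq_int \<xi>)
    fix e :: real assume e: "e > 0"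
    have e': "e / ?I > 0" using e I by simp
    obtain f V where f': "f \<in> Cc" "open V" "u \<in> V"
      "\<forall>v\<in>V \<inter> units G. l2_norm (haar G v) (\<lambda>x. \<xi> x - f x) < e / ?I"
      by (rule sections_approx[OF \<xi> u e'])
    note f = f'(1-3) f'(4)[rule_format, OF IntI]
    have "l2_norm (haar G v) (\<lambda>x. conv G \<xi> F x - conv G f F x) < e" if v: "v \<in> V \<inter> units G" for v
    proof -
      have v': "v \<in> units G" using v by simp
      have "l2_norm (haar G v) (\<lambda>x. conv G \<xi> F x - conv G f F x)
          = l2_norm (haar G v) (conv G (\<lambda>x. \<xi> x - f x) F)"
        by (rule l2_norm_cong, rule conv_diff[symmetric, OF F])
           (use sections_sq_int[OF \<xi> v'] Cc_sq_int[OF v' f(1)] in \<open>auto simp: space_haar[OF v'] range_fibre_def\<close>)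
      also have "\<dots> \<le> I_norm G F * l2_norm (haar G v) (\<lambda>x. \<xi> x - f x)"
        by (intro conv_bound F v' sq_int_diff sections_sq_int \<xi> Cc_sq_int f)
      also have "\<dots> \<le> I_norm G F * (e / ?I)"
        using f(4)[of v] v I by (intro mult_left_mono) auto
      also have "\<dots> < e" using e I by (simp add: field_simps)
      finally show ?thesis .
    qed
    then show "\<exists>f\<in>Cc. \<exists>V. open V \<and> u \<in> V \<and> (\<forall>v\<in>V \<inter> units G. l2_norm (haar G v) (\<lambda>x. conv G \<xi> F x - f x) < e)"
      using f by (intro bexI[OF _ conv_Cc[OF f(1) F]] exI[of _ V]) auto }
  fix e :: real assume e: "e > 0"
  have e': "e / ?I > 0" using e I by simp
  obtain K where K': "compact K" "K \<subseteq> units G"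
    "\<forall>u\<in>units G - K. l2_norm (haar G u) \<xi> < e / ?I"
    by (rule sections_vanish[OF \<xi> e'])
  note K = K'(1,2) K'(3)[rule_format, OF DiffI]
  have "l2_norm (haar G u) (conv G \<xi> F) < e" if u: "u \<in> units G - K" for u
  proof -
    have "l2_norm (haar G u) (conv G \<xi> F) \<le> I_norm G F * l2_norm (haar G u) \<xi>"
      using u by (intro conv_bound F sections_sq_int \<xi>) auto
    also have "\<dots> \<le> I_norm G F * (e / ?I)" using K(3)[of u] u I by (intro mult_left_mono) auto
    also have "\<dots> < e" using e I by (simp add: field_simps)
    finally show ?thesis .
  qed
  then show "\<exists>K. compact K \<and> K \<subseteq> units G \<and> (\<forall>u\<in>units G - K. l2_norm (haar G u) (conv G \<xi> F) < e)"
    using K by blast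
qed

end

section \<open>The Hilbert module of classes of sections\<close>

context lc_haar_groupoid
begin

lemma sec_classD:
  "\<eta> \<in> sec_class G \<xi> \<Longrightarrow> u \<in> units G \<Longrightarrow> \<eta> \<in> sq_int (haar G u)"
  "\<eta> \<in> sec_class G \<xi> \<Longrightarrow> u \<in> units G \<Longrightarrow> AE x in haar G u. \<eta> x = \<xi> x"
  unfolding sec_class_def by auto

lemma sec_class_self: "\<xi> \<in> sections \<Longrightarrow> \<xi> \<in> sec_class G \<xi>"
  unfolding sec_class_def using sections_sq_int by auto

lemma sec_class_eqI:
  assumes "\<And>u. u \<in> units G \<Longrightarrow> AE x in haar G u. \<xi> x = \<eta> x"
  shows "sec_class G \<xi> = sec_class G \<eta>"
proof -
  have "(AE x in haar G u. \<zeta> x = \<xi> x) \<longleftrightarrow> (AE x in haar G u. \<zeta> x = \<eta> x)" if "u \<in> units G" for u \<zeta>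
  proof
    assume "AE x in haar G u. \<zeta> x = \<xi> x"
    then show "AE x in haar G u. \<zeta> x = \<eta> x" using assms[OF that] by eventually_elim simp
  next
    assume "AE x in haar G u. \<zeta> x = \<eta> x"
    then show "AE x in haar G u. \<zeta> x = \<xi> x" using assms[OF that] by eventually_elim simp
  qed
  then show ?thesis unfolding sec_class_def by auto
qed

lemma rep_sec_class: "\<xi> \<in> sections \<Longrightarrow> rep (sec_class G \<xi>) \<in> sec_class G \<xi>"
  unfolding rep_def by (rule someI[of _ \<xi>]) (rule sec_class_self)

lemma rep_AE: "\<xi> \<in> sections \<Longrightarrow> u \<in> units G \<Longrightarrow> AE x in haar G u. rep (sec_class G \<xi>) x = \<xi> x"
  by (rule sec_classD(2)[OF rep_sec_class])

lemma l2_norm_AE: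
  assumes "u \<in> units G" "\<xi> \<in> sq_int (haar G u)" "\<eta> \<in> sq_int (haar G u)" "AE x in haar G u. \<xi> x = \<eta> x"
  shows "l2_norm (haar G u) \<xi> = l2_norm (haar G u) \<eta>"
  using assms by (intro l2_norm_cong_AE sq_int_measurable)

lemma sec_class_sections:
  assumes \<xi>: "\<xi> \<in> sections" and \<eta>: "\<eta> \<in> sec_class G \<xi>"
  shows "\<eta> \<in> sections"
\<comment> \<open>The constant sequence has distance 0 from the other representative on every
  fibre.\<close>
proof (rule sections_uniform_limit[of "\<lambda>_. \<xi>"])
  fix u e :: real assume "e > 0"
  have "l2_norm (haar G u) (\<lambda>x. \<xi> x - \<eta> x) = 0" if u: "u \<in> units G" for u
  proof -
    have "l2_norm (haar G u) (\<lambda>x. \<xi> x - \<eta> x) = l2_norm (haar G u) (\<lambda>x. 0)"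
    proof (rule l2_norm_cong_AE)
      show "AE x in haar G u. \<xi> x - \<eta> x = 0" using sec_classD(2)[OF \<eta> u] by eventually_elim simp
      show "(\<lambda>x. \<xi> x - \<eta> x) \<in> borel_measurable (haar G u)"
        by (intro sq_int_measurable sq_int_diff sections_sq_int \<xi> u sec_classD(1)[OF \<eta>])
    qed simp
    then show ?thesis by (simp add: l2_norm_def)
  qed
  then show "\<exists>n::nat. \<forall>u\<in>units G. l2_norm (haar G u) (\<lambda>x. \<xi> x - \<eta> x) \<le> e" using \<open>e > 0\<close> by simp
qed (use \<xi> sec_classD(1)[OF \<eta>] in auto)

abbreviation "E \<equiv> E2 G"

lemma hcarr_E: "hcarr E = sec_class G ` sections"
  unfolding E2_def sections_def by simp

lemma hcarrI: "\<xi> \<in> sections \<Longrightarrow> sec_class G \<xi> \<in> hcarr E"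
  unfolding hcarr_E by (rule imageI)

lemma rep_sections: "A \<in> hcarr E \<Longrightarrow> rep A \<in> sections"
  unfolding hcarr_E using sec_class_sections[OF _ rep_sec_class] by blast

lemma rep_sq_int: "A \<in> hcarr E \<Longrightarrow> u \<in> units G \<Longrightarrow> rep A \<in> sq_int (haar G u)"
  by (rule sections_sq_int[OF rep_sections])

lemma sec_class_rep: "A \<in> hcarr E \<Longrightarrow> sec_class G (rep A) = A"
  unfolding hcarr_E using sec_class_eqI[OF rep_AE] by blast

lemma hadd_E: "hadd E A B = sec_class G (\<lambda>t. rep A t + rep B t)"
  and hscl_E: "hscl E c A = sec_class G (\<lambda>t. c * rep A t)"
  and hact_E: "hact E A b = sec_class G (\<lambda>t. rep A t * b (rng G t))"
  and hcoef_E: "hcoef E = C0_units G"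
  and hinner_E: "hinner E A B = (\<lambda>u\<in>units G. l2_inner (haar G u) (rep A) (rep B))"
  and hnrm_E: "hnrm E A = (SUP u\<in>units G. l2_norm (haar G u) (rep A))"
  by (simp_all add: E2_def)

lemma inner_sec_class:
  assumes "C \<in> hcarr E" "\<xi> \<in> sections" "u \<in> units G"
  shows "l2_inner (haar G u) (rep C) (rep (sec_class G \<xi>)) = l2_inner (haar G u) (rep C) \<xi>"
  by (rule l2_inner_cong_AE)
     (use assms rep_AE rep_sq_int hcarrI sections_sq_int in auto)

lemma norm_sec_class:
  assumes "\<xi> \<in> sections" "u \<in> units G"
  shows "l2_norm (haar G u) (rep (sec_class G \<xi>)) = l2_norm (haar G u) \<xi>"
  by (rule l2_norm_AE) (use assms rep_AE rep_sq_int hcarrI sections_sq_int in auto)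

lemma hnrm_sec_class: "\<xi> \<in> sections \<Longrightarrow> hnrm E (sec_class G \<xi>) = (SUP u\<in>units G. l2_norm (haar G u) \<xi>)"
  unfolding hnrm_E by (intro SUP_cong refl norm_sec_class)

lemma sec_act:
  assumes "\<xi> \<in> sections" "b \<in> C0_units G"
  shows "(\<lambda>t. \<xi> t * b (rng G t)) \<in> sections"
proof -
  obtain B where "\<forall>v\<in>units G. cmod (b v) \<le> B" by (rule C0_units_bounded[OF assms(2)])
  then show ?thesis
    using assms unfolding C0_units_def by (intro sections_act[of _ _ B]) auto
qed

lemma E_sub:
  assumes "A \<in> hcarr E" "B \<in> hcarr E"
  shows "hadd E A (hscl E (-1) B) = sec_class G (\<lambda>t. rep A t - rep B t)"
  unfolding hadd_E hscl_E
proof (rule sec_class_eqI)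
  fix u assume "u \<in> units G"
  from rep_AE[OF sections_scale[OF rep_sections[OF assms(2)], of "-1"] this]
  show "AE t in haar G u. rep A t + rep (sec_class G (\<lambda>t. (-1) * rep B t)) t = rep A t - rep B t"
    by eventually_elim simp
qed

lemma E_complete:
  assumes X: "\<And>n. X n \<in> hcarr E"
    and cauchy: "\<And>e. e > 0 \<Longrightarrow> \<exists>N. \<forall>m\<ge>N. \<forall>n\<ge>N. hnrm E (hadd E (X m) (hscl E (-1) (X n))) < e"
  shows "\<exists>l\<in>hcarr E. (\<lambda>n. hnrm E (hadd E (X n) (hscl E (-1) l))) \<longlonglongrightarrow> 0"
proof -
  let ?x = "\<lambda>n. rep (X n)"
  have x: "?x n \<in> sections" for n by (rule rep_sections[OF X])
  have fibre: "l2_norm (haar G u) (\<lambda>t. ?x m t - ?x n t) \<le> hnrm E (hadd E (X m) (hscl E (-1) (X n)))"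
    if "u \<in> units G" for u m n
    unfolding E_sub[OF X X] hnrm_sec_class[OF sections_diff[OF x x]]
    by (rule cSUP_upper[OF that sections_bdd[OF sections_diff[OF x x]]])
  have "\<exists>l\<in>sq_int (haar G u). (\<lambda>n. l2_norm (haar G u) (\<lambda>t. ?x n t - l t)) \<longlonglongrightarrow> 0"
    if u: "u \<in> units G" for u
  proof (rule l2_complete)
    show "?x n \<in> sq_int (haar G u)" for n by (rule sections_sq_int[OF x u])
    fix e :: real assume "e > 0"
    then obtain N where N: "\<forall>m\<ge>N. \<forall>n\<ge>N. hnrm E (hadd E (X m) (hscl E (-1) (X n))) < e"
      using cauchy by blast
    show "\<exists>N. \<forall>m\<ge>N. \<forall>n\<ge>N. l2_norm (haar G u) (\<lambda>t. ?x m t - ?x n t) < e"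
      by (intro exI[of _ N] allI impI) (rule le_less_trans[OF fibre[OF u]], use N in simp)
  qed
  then have "\<forall>u\<in>units G. \<exists>l. l \<in> sq_int (haar G u) \<and> (\<lambda>n. l2_norm (haar G u) (\<lambda>t. ?x n t - l t)) \<longlonglongrightarrow> 0"
    by blast
  then obtain L where L: "\<forall>u\<in>units G. L u \<in> sq_int (haar G u) \<and> (\<lambda>n. l2_norm (haar G u) (\<lambda>t. ?x n t - L u t)) \<longlonglongrightarrow> 0"
    unfolding bchoice_iff by (elim exE)
  \<comment> \<open>Fibres are disjoint, so limits chosen separately in each of them are
    restrictions of one function.\<close>
  define l where "l t = L (rng G t) t" for t
  have lL: "l t = L u t" if "u \<in> units G" "t \<in> space (haar G u)" for u t
    using that by (simp add: l_def space_haar range_fibre_def)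
  have l_sq: "l \<in> sq_int (haar G u)" if "u \<in> units G" for u
    using L that lL[OF that] by (subst sq_int_cong[where g="L u"]) auto
  have l_lim: "(\<lambda>n. l2_norm (haar G u) (\<lambda>t. ?x n t - l t)) \<longlonglongrightarrow> 0" if u: "u \<in> units G" for u
  proof -
    have "l2_norm (haar G u) (\<lambda>t. ?x n t - l t) = l2_norm (haar G u) (\<lambda>t. ?x n t - L u t)" for n
      by (rule l2_norm_cong) (simp add: lL[OF u])
    then show ?thesis using L u by simp
  qed
  have unif: "\<exists>N. \<forall>n\<ge>N. \<forall>u\<in>units G. l2_norm (haar G u) (\<lambda>t. ?x n t - l t) \<le> e" if e: "e > 0" for e
  proof -
    obtain N where N: "\<forall>m\<ge>N. \<forall>n\<ge>N. hnrm E (hadd E (X m) (hscl E (-1) (X n))) < e"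
      using cauchy[OF e] by blast
    have "l2_norm (haar G u) (\<lambda>t. ?x n t - l t) \<le> e" if n: "n \<ge> N" and u: "u \<in> units G" for n u
    proof -
      \<comment> \<open>Letting m tend to infinity keeps the bound e, which is the same for all
        units; this uniformity makes the limit a section.\<close>
      have "(\<lambda>m. e + l2_norm (haar G u) (\<lambda>t. ?x m t - l t)) \<longlonglongrightarrow> e + 0"
        by (intro tendsto_add tendsto_const l_lim u)
      moreover have "l2_norm (haar G u) (\<lambda>t. ?x n t - l t) \<le> e + l2_norm (haar G u) (\<lambda>t. ?x m t - l t)"
        if "m \<ge> N" for m
        using l2_norm_diff_triangle[OF sections_sq_int[OF x u] sections_sq_int[OF x u] l_sq[OF u], of n m]
          fibre[OF u, of n m] N n that by (smt (verit))
      ultimately show ?thesis using LIMSEQ_le_const[of _ "e + 0"] by auto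
    qed
    then show ?thesis by blast
  qed
  have l: "l \<in> sections"
    by (rule sections_uniform_limit[of ?x l, OF x l_sq]) (use unif in blast)+
  have sub: "hnrm E (hadd E (X n) (hscl E (-1) (sec_class G l)))
      = (SUP u\<in>units G. l2_norm (haar G u) (\<lambda>t. ?x n t - l t))" for n
  proof -
    have "hadd E (X n) (hscl E (-1) (sec_class G l)) = sec_class G (\<lambda>t. ?x n t - l t)"
      unfolding E_sub[OF X hcarrI[OF l]]
    proof (rule sec_class_eqI)
      fix u assume "u \<in> units G"
      from rep_AE[OF l this] show "AE t in haar G u. ?x n t - rep (sec_class G l) t = ?x n t - l t"
        by eventually_elim simp
    qed
    then show ?thesis by (simp add: hnrm_sec_class[OF sections_diff[OF x l]])
  qed
  have "(\<lambda>n. hnrm E (hadd E (X n) (hscl E (-1) (sec_class G l)))) \<longlonglongrightarrow> 0"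
  proof (rule LIMSEQ_I)
    fix e :: real assume e: "e > 0"
    obtain N where N: "\<forall>n\<ge>N. \<forall>u\<in>units G. l2_norm (haar G u) (\<lambda>t. ?x n t - l t) \<le> e/2"
      using unif[of "e/2"] e by auto
    have "norm (hnrm E (hadd E (X n) (hscl E (-1) (sec_class G l))) - 0) < e" if n: "n \<ge> N" for n
    proof -
      have "(SUP u\<in>units G. l2_norm (haar G u) (\<lambda>t. ?x n t - l t)) \<le> e/2"
        by (rule cSUP_least[OF units_ne]) (use N n in blast)
      moreover have "0 \<le> (SUP u\<in>units G. l2_norm (haar G u) (\<lambda>t. ?x n t - l t))"
        by (rule cSUP_upper2[OF sections_bdd[OF sections_diff[OF x l]] units_rng(1)[of undefined] l2_norm_nonneg])
      ultimately show ?thesis unfolding sub using e by simp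
    qed
    then show "\<exists>N. \<forall>n\<ge>N. norm (hnrm E (hadd E (X n) (hscl E (-1) (sec_class G l))) - 0) < e" by blast
  qed
  then show ?thesis using hcarrI[OF l] by blast
qed

lemma E_module: "pointwise_hilbert_module E (units G)"
proof (rule pointwise_hilbert_module.intro)
  show "units G \<noteq> {}" by (rule units_ne)
  show "hcarr E \<noteq> {}" using hcarrI[OF Cc_sections[OF Cc_zero]] by blast
  fix A assume A: "A \<in> hcarr E"
  note a = rep_sections[OF A]
  have nrm: "sqrt (Re (hinner E A A u)) = l2_norm (haar G u) (rep A)" if "u \<in> units G" for u
    using that by (simp add: hinner_E l2_norm_eq)
  show "bdd_above ((\<lambda>u. sqrt (Re (hinner E A A u))) ` units G)"
    using sections_bdd[OF a] by (simp add: nrm cong: image_cong_simp)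
  show "hnrm E A = (SUP u\<in>units G. sqrt (Re (hinner E A A u)))"
    unfolding hnrm_E by (intro SUP_cong refl) (simp add: nrm)
  { fix b assume b: "b \<in> hcoef E"
    then have s: "(\<lambda>t. rep A t * b (rng G t)) \<in> sections" by (intro sec_act a) (simp add: hcoef_E)
    show "hact E A b \<in> hcarr E" unfolding hact_E by (rule hcarrI[OF s])
    fix C u assume C: "C \<in> hcarr E" and u: "u \<in> units G"
    have "l2_inner (haar G u) (rep C) (rep (hact E A b)) = l2_inner (haar G u) (rep C) (\<lambda>t. rep A t * b (rng G t))"
      unfolding hact_E by (rule inner_sec_class[OF C s u])
    also have "\<dots> = (LINT t|haar G u. cnj (rep C t) * rep A t * b u)"
      unfolding l2_inner_def
      by (intro Bochner_Integration.integral_cong) (auto simp: space_haar[OF u] range_fibre_def)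
    also have "\<dots> = l2_inner (haar G u) (rep C) (rep A) * b u" unfolding l2_inner_def by simp
    finally show "hinner E C (hact E A b) u = hinner E C A u * b u" using u by (simp add: hinner_E) }
  fix B assume B: "B \<in> hcarr E"
  note b = rep_sections[OF B]
  show "hinner E A B \<in> extensional (units G)" unfolding hinner_E by simp
  assume eq: "\<And>C u. C \<in> hcarr E \<Longrightarrow> u \<in> units G \<Longrightarrow> hinner E C A u = hinner E C B u"
  let ?d = "\<lambda>t. rep A t - rep B t"
  have d: "?d \<in> sections" by (rule sections_diff[OF a b])
  have "AE t in haar G u. rep A t = rep B t" if u: "u \<in> units G" for u
  proof -
    \<comment> \<open>Testing against the difference itself shows that it has norm 0 on each
      fibre.\<close>
    let ?D = "sec_class G ?d"
    have D: "?D \<in> hcarr E" by (rule hcarrI[OF d])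
    have q: "rep ?D \<in> sq_int (haar G u)" "rep A \<in> sq_int (haar G u)" "rep B \<in> sq_int (haar G u)"
      by (intro rep_sq_int D A B u)+
    have "l2_inner (haar G u) (rep ?D) (rep A) = l2_inner (haar G u) (rep ?D) (rep B)"
      using eq[OF D u] u by (simp add: hinner_E)
    then have "l2_inner (haar G u) (rep ?D) ?d = 0"
      using sq_int_mult_integrable[OF sq_int_cnj[OF q(1)] q(2)] sq_int_mult_integrable[OF sq_int_cnj[OF q(1)] q(3)]
      unfolding l2_inner_def by (simp add: right_diff_distrib)
    moreover have "l2_inner (haar G u) (rep ?D) ?d = l2_inner (haar G u) ?d ?d"
      by (rule l2_inner_cong_AE) (use rep_AE[OF d u] q sections_sq_int[OF d u] in auto)
    ultimately have "l2_norm (haar G u) ?d = 0" by (simp add: l2_norm_eq)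
    from l2_norm_0_AE[OF sections_sq_int[OF d u] this] show ?thesis by eventually_elim simp
  qed
  then show "A = B" using sec_class_eqI[of "rep A" "rep B"] sec_class_rep[OF A] sec_class_rep[OF B] by metis
next
  fix u assume u: "u \<in> units G"
  show "semi_inner (hcarr E) (hadd E) (hscl E) (\<lambda>x y. hinner E x y u)"
  proof
    fix A c assume A: "A \<in> hcarr E"
    note a = rep_sections[OF A]
    show "hscl E c A \<in> hcarr E" unfolding hscl_E by (rule hcarrI[OF sections_scale[OF a]])
    show "0 \<le> Re (hinner E A A u)" using u by (simp add: hinner_E l2_inner_self)
    fix B assume B: "B \<in> hcarr E"
    note b = rep_sections[OF B]
    show "hadd E A B \<in> hcarr E" unfolding hadd_E by (rule hcarrI[OF sections_add[OF a b]])
    show "hinner E B A u = cnj (hinner E A B u)"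
      using semi_inner.ip_cnj[OF semi_inner_l2 rep_sq_int[OF A u] rep_sq_int[OF B u]] u by (simp add: hinner_E)
    show "hinner E B (hscl E c A) u = c * hinner E B A u"
      using inner_sec_class[OF B sections_scale[OF a] u]
        semi_inner.ip_scl[OF semi_inner_l2 rep_sq_int[OF A u] rep_sq_int[OF B u]] u
      by (simp add: hinner_E hscl_E)
    fix C assume C: "C \<in> hcarr E"
    show "hinner E C (hadd E A B) u = hinner E C A u + hinner E C B u"
      using inner_sec_class[OF C sections_add[OF a b] u]
        l2_inner_add[OF rep_sq_int[OF A u] rep_sq_int[OF B u] rep_sq_int[OF C u]] u
      by (simp add: hinner_E hadd_E)
  qed
next
  fix X :: "nat \<Rightarrow> ('g \<Rightarrow> complex) set"
  assume "\<And>n. X n \<in> hcarr E"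
    "\<And>e. e > 0 \<Longrightarrow> \<exists>N. \<forall>m\<ge>N. \<forall>n\<ge>N. hnrm E (hadd E (X m) (hscl E (-1) (X n))) < e"
  then show "\<exists>l\<in>hcarr E. (\<lambda>n. hnrm E (hadd E (X n) (hscl E (-1) l))) \<longlonglongrightarrow> 0"
    by (rule E_complete)
qed

sublocale E: pointwise_hilbert_module E "units G"
  by (rule E_module)

end

section \<open>Right convolution\<close>

context lc_haar_groupoid
begin

definition R :: "('g \<Rightarrow> complex) \<Rightarrow> ('g \<Rightarrow> complex) set \<Rightarrow> ('g \<Rightarrow> complex) set"
  where "R F = (\<lambda>A\<in>hcarr E. sec_class G (conv G (rep A) F))"

text \<open>The convolution integrates over a fibre, on which the two functions differ only on a
  null set; hence its values agree at every point and \<open>R\<close> is independent of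
  representatives.\<close>

lemma conv_cong_AE:
  assumes F: "F \<in> Cc" and \<xi>: "\<xi> \<in> sections" and \<eta>: "\<eta> \<in> sections"
    and eq: "\<And>u. u \<in> units G \<Longrightarrow> AE x in haar G u. \<xi> x = \<eta> x"
  shows "conv G \<xi> F x = conv G \<eta> F x"
  unfolding conv_def
proof (rule integral_cong_AE)
  show "AE t in haar G (rng G x). \<xi> t * F (gmul G (ginv G t) x) = \<eta> t * F (gmul G (ginv G t) x)"
    using eq[OF units_rng(1)] by eventually_elim simp
qed (intro borel_measurable_integrable conv_integrable F sections_sq_int \<xi> \<eta> units_rng)+

lemma R_sec_class:
  assumes F: "F \<in> Cc" and \<xi>: "\<xi> \<in> sections"
  shows "R F (sec_class G \<xi>) = sec_class G (conv G \<xi> F)"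
proof -
  have "conv G (rep (sec_class G \<xi>)) F = conv G \<xi> F"
    by (rule ext, rule conv_cong_AE[OF F rep_sections[OF hcarrI[OF \<xi>]] \<xi> rep_AE[OF \<xi>]])
  then show ?thesis unfolding R_def by (simp add: hcarrI \<xi>)
qed

lemma R_apply: "A \<in> hcarr E \<Longrightarrow> R F A = sec_class G (conv G (rep A) F)"
  unfolding R_def by simp

lemma R_PiE: "F \<in> Cc \<Longrightarrow> R F \<in> hcarr E \<rightarrow>\<^sub>E hcarr E"
  unfolding R_def using hcarrI[OF conv_sections[OF _ rep_sections]] by auto

lemma R_adjoint:
  assumes F: "F \<in> Cc" shows "is_adjoint E (R F) (R (invol G F))"
  unfolding is_adjoint_def
proof (intro conjI ballI)
  show "R (invol G F) \<in> hcarr E \<rightarrow>\<^sub>E hcarr E" by (rule R_PiE[OF invol_Cc[OF F]])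
  fix A B assume A: "A \<in> hcarr E" and B: "B \<in> hcarr E"
  have a: "conv G (rep A) F \<in> sections" by (rule conv_sections[OF F rep_sections[OF A]])
  have b: "conv G (rep B) (invol G F) \<in> sections" by (rule conv_sections[OF invol_Cc[OF F] rep_sections[OF B]])
  show "hinner E (R F A) B = hinner E A (R (invol G F) B)"
    unfolding hinner_E
  proof (rule restrict_ext)
    fix u assume u: "u \<in> units G"
    have "l2_inner (haar G u) (rep (R F A)) (rep B) = l2_inner (haar G u) (conv G (rep A) F) (rep B)"
      unfolding R_apply[OF A]
      by (rule l2_inner_cong_AE)
         (use rep_AE[OF a u] rep_sq_int[OF hcarrI[OF a] u] rep_sq_int[OF B u] sections_sq_int[OF a u] in auto)
    also have "\<dots> = l2_inner (haar G u) (rep A) (conv G (rep B) (invol G F))"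
      by (rule conv_adjoint[OF F u rep_sq_int[OF A u] rep_sq_int[OF B u]])
    also have "\<dots> = l2_inner (haar G u) (rep A) (rep (R (invol G F) B))"
      unfolding R_apply[OF B] by (rule inner_sec_class[OF A b u, symmetric])
    finally show "l2_inner (haar G u) (rep (R F A)) (rep B) = l2_inner (haar G u) (rep A) (rep (R (invol G F) B))" .
  qed
qed

lemma l2_norm_le_hnrm: "A \<in> hcarr E \<Longrightarrow> u \<in> units G \<Longrightarrow> l2_norm (haar G u) (rep A) \<le> hnrm E A"
  unfolding hnrm_E by (rule cSUP_upper[OF _ sections_bdd[OF rep_sections]])

text \<open>The constant is left open because it is used with the I-norm and again with the supremum
  of the fibre norms.\<close>

lemma R_le:
  assumes F: "F \<in> Cc" and A: "A \<in> hcarr E" and c: "0 \<le> c"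
    and le: "\<And>u. u \<in> units G \<Longrightarrow> l2_norm (haar G u) (conv G (rep A) F) \<le> c * l2_norm (haar G u) (rep A)"
  shows "hnrm E (R F A) \<le> c * hnrm E A"
  unfolding R_apply[OF A] hnrm_sec_class[OF conv_sections[OF F rep_sections[OF A]]]
proof (rule cSUP_least[OF units_ne])
  fix u assume u: "u \<in> units G"
  show "l2_norm (haar G u) (conv G (rep A) F) \<le> c * hnrm E A"
    using le[OF u] mult_left_mono[OF l2_norm_le_hnrm[OF A u] c] by (rule order_trans)
qed

lemma R_bound: "F \<in> Cc \<Longrightarrow> A \<in> hcarr E \<Longrightarrow> hnrm E (R F A) \<le> I_norm G F * hnrm E A"
  by (intro R_le conv_bound rep_sq_int I_norm_nonneg)

lemma R_adjointable: "F \<in> Cc \<Longrightarrow> R F \<in> adjointable E"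
  by (rule E.adjointableI[OF R_PiE R_adjoint R_bound])

lemma acarr_adj_ops: "acarr (adj_ops E) = adjointable E"
  by (simp add: adj_ops_def)

text \<open>The units are the fixed points of the continuous range map.\<close>

lemma closed_units: "closed (units G)"
proof -
  have "units G = {x. rng G x = x}" by (auto simp: unit_rng) (metis units_rng(1))
  then show ?thesis by (simp add: closed_Collect_eq[OF continuous_rng continuous_on_id])
qed

lemma C0_units_Cc:
  assumes h: "h \<in> Cc" shows "restrict h (units G) \<in> C0_units G"
proof -
  obtain L where L: "compact L" "\<forall>x. h x \<noteq> 0 \<longrightarrow> x \<in> L" by (rule Cc_supportE[OF h])
  have "continuous_on (units G) (restrict h (units G))"
    using continuous_on_subset[OF Cc_continuous[OF h], of "units G"] by (simp cong: continuous_on_cong)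
  moreover have "compact (L \<inter> units G)" by (rule compact_Int_closed[OF L(1) closed_units])
  moreover have "\<exists>K. compact K \<and> K \<subseteq> units G \<and> (\<forall>u\<in>units G - K. cmod (restrict h (units G) u) < e)"
    if e: "e > 0" for e
  proof (intro exI[of _ "L \<inter> units G"] conjI ballI)
    fix u assume u: "u \<in> units G - L \<inter> units G"
    then have "h u = 0" using L(2) by blast
    then show "cmod (restrict h (units G) u) < e" using u e by simp
  qed (use \<open>compact (L \<inter> units G)\<close> in auto)
  ultimately show ?thesis unfolding C0_units_def by simp
qed

text \<open>An adjointable operator is local, being a module map: its value over \<open>u\<close> is controlled by
  its argument near \<open>u\<close>, where the argument is close to an element of \<open>Cc\<close>.\<close>

lemma adjointable_zero_on_Cc:
  assumes D: "D \<in> adjointable E" and zero: "\<And>f. f \<in> Cc \<Longrightarrow> hnrm E (D (sec_class G f)) = 0"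
    and A: "A \<in> hcarr E"
  shows "hnrm E (D A) = 0"
proof -
  have DA: "D A \<in> hcarr E" by (rule E.adj_carr[OF D A])
  have small: "sqrt (Re (hinner E (D A) (D A) u)) \<le> E.opn D * e" if u: "u \<in> units G" and e: "e > 0" for u e
  proof -
    obtain f V where f: "f \<in> Cc" "open V" "u \<in> V"
      "\<forall>v\<in>V \<inter> units G. l2_norm (haar G v) (\<lambda>x. rep A x - f x) < e"
      by (rule sections_approx[OF rep_sections[OF A] u e])
    \<comment> \<open>A cutoff equal to 1 at \<open>u\<close> and vanishing off \<open>V\<close>
      makes the local approximation global; restricted to the units it is a coefficient, so
      \<open>D\<close> commutes with it.\<close>
    obtain h :: "'g \<Rightarrow> real" where h: "\<And>x. 0 \<le> h x" "\<And>x. h x \<le> 1" "\<And>x. x \<in> {u} \<Longrightarrow> h x = 1"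
      "\<And>x. h x \<noteq> 0 \<Longrightarrow> x \<in> V" "(\<lambda>x. complex_of_real (h x)) \<in> Cc"
      using urysohn_Cc[OF lc compact_sing f(2), of u] f(3) by (metis empty_subsetI insert_subset)
    define b where "b = restrict (\<lambda>x. complex_of_real (h x)) (units G)"
    have b: "b \<in> C0_units G" unfolding b_def by (rule C0_units_Cc[OF h(5)])
    have bu: "b u = 1" using h(3)[of u] u by (simp add: b_def)
    let ?z = "\<lambda>x. rep A x - f x"
    let ?Z = "sec_class G ?z" and ?f = "sec_class G f"
    have fs: "f \<in> sections" by (rule Cc_sections[OF f(1)])
    have z: "?z \<in> sections" by (rule sections_diff[OF rep_sections[OF A] fs])
    have carr: "?Z \<in> hcarr E" "?f \<in> hcarr E" by (rule hcarrI[OF z] hcarrI[OF fs])+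
    have "?Z = hadd E A (hscl E (-1) ?f)"
      unfolding E_sub[OF A carr(2)]
    proof (rule sec_class_eqI)
      fix u assume "u \<in> units G"
      from rep_AE[OF fs this] show "AE x in haar G u. rep A x - f x = rep A x - rep ?f x"
        by eventually_elim simp
    qed
    then have "D ?Z = hadd E (D A) (hscl E (-1) (D ?f))" using E.adj_sub[OF D A carr(2)] by simp
    moreover have Df: "D ?f \<in> hcarr E" by (rule E.adj_carr[OF D carr(2)])
    \<comment> \<open>\<open>D\<close> sends the class of f to an element of norm 0, so subtracting
      f from the argument does not change the value.\<close>
    ultimately have DZ: "D ?Z = D A"
      using E.nrm_zero_inner[OF Df _ _ zero[OF f(1)]]
      by (intro E.nondegenerate) (auto simp: DA E.closed E.inner_add E.inner_scl)
    have Zb: "hact E ?Z b \<in> hcarr E" using E.act_closed[OF carr(1)] b by (simp add: hcoef_E)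
    have bc: "b \<in> hcoef E" using b by (simp add: hcoef_E)
    have "hnrm E (hact E ?Z b) \<le> e"
    proof -
      have eq: "hact E ?Z b = sec_class G (\<lambda>x. ?z x * b (rng G x))"
        unfolding hact_E
      proof (rule sec_class_eqI)
        fix u assume "u \<in> units G"
        from rep_AE[OF z this] show "AE x in haar G u. rep ?Z x * b (rng G x) = ?z x * b (rng G x)"
          by eventually_elim simp
      qed
      show ?thesis
        unfolding eq hnrm_sec_class[OF sec_act[OF z b]]
      proof (rule cSUP_least[OF units_ne])
        fix v assume v: "v \<in> units G"
        have "cmod (b v) * l2_norm (haar G v) ?z \<le> e"
        proof (cases "v \<in> V")
          case True
          then have "l2_norm (haar G v) ?z \<le> e" using f(4) v by (intro less_imp_le) blast
          moreover have "cmod (b v) \<le> 1" using h(1,2) v by (simp add: b_def)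
          ultimately show ?thesis
            using mult_mono[of "cmod (b v)" 1 "l2_norm (haar G v) ?z" e] by (simp add: l2_norm_nonneg)
        next
          case False
          then have "h v = 0" using h(4) by blast
          then show ?thesis using v e by (simp add: b_def)
        qed
        then show "l2_norm (haar G v) (\<lambda>x. ?z x * b (rng G x)) \<le> e"
          using l2_norm_act[OF v, of ?z b] by simp
      qed
    qed
    then have "hnrm E (D (hact E ?Z b)) \<le> E.opn D * e"
      using E.opn_bound[OF D Zb] mult_left_mono[OF _ E.opn_nonneg[OF D]] order_trans by blast
    moreover have "D (hact E ?Z b) = hact E (D A) b" using E.adj_act[OF D carr(1) bc] DZ by simp
    \<comment> \<open>The cutoff is 1 at \<open>u\<close>, so it leaves the inner product over
      \<open>u\<close> unchanged in both arguments.\<close>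
    moreover have "hinner E (hact E (D A) b) (hact E (D A) b) u = hinner E (D A) (D A) u"
    proof -
      have DAb: "hact E (D A) b \<in> hcarr E" by (rule E.act_closed[OF DA bc])
      have "hinner E (hact E (D A) b) (hact E (D A) b) u = hinner E (hact E (D A) b) (D A) u"
        using E.inner_act[OF DA DAb bc u] bu by simp
      also have "\<dots> = cnj (hinner E (D A) (hact E (D A) b) u)" by (rule E.inner_cnj[OF u DA DAb])
      also have "\<dots> = cnj (hinner E (D A) (D A) u)" using E.inner_act[OF DA DA bc u] bu by simp
      also have "\<dots> = hinner E (D A) (D A) u" by (rule E.inner_cnj[OF u DA DA, symmetric])
      finally show ?thesis .
    qed
    ultimately show ?thesis
      using E.fn_le_nrm[OF E.act_closed[OF DA bc] u] by simp
  qed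
  have "sqrt (Re (hinner E (D A) (D A) u)) \<le> 0" if u: "u \<in> units G" for u
  proof (rule field_le_epsilon)
    fix e :: real assume e: "e > 0"
    have p: "E.opn D + 1 > 0" using E.opn_nonneg[OF D] by simp
    have "sqrt (Re (hinner E (D A) (D A) u)) \<le> E.opn D * (e / (E.opn D + 1))"
      using e p by (intro small u) simp
    also have "\<dots> \<le> 0 + e" using e p E.opn_nonneg[OF D] by (simp add: field_simps)
    finally show "sqrt (Re (hinner E (D A) (D A) u)) \<le> 0 + e" .
  qed
  then have "hnrm E (D A) \<le> 0" by (rule E.nrm_le[OF DA])
  then show ?thesis using E.nrm_nonneg[OF DA] by simp
qed

text \<open>The difference of \<open>T\<close> and \<open>R F\<close> is adjointable and annihilates
  the classes of \<open>Cc\<close> functions.\<close>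

lemma R_unique:
  assumes F: "F \<in> Cc" and T: "T \<in> adjointable E"
    and eq: "\<And>f. f \<in> Cc \<Longrightarrow> T (sec_class G f) = sec_class G (conv G f F)"
  shows "T = R F"
proof (rule extensionalityI[of _ "hcarr E"])
  note RA = R_adjointable[OF F]
  show "T \<in> extensional (hcarr E)" "R F \<in> extensional (hcarr E)"
    using E.adj_PiE[OF T] E.adj_PiE[OF RA] by (auto simp: PiE_def)
  fix A assume A: "A \<in> hcarr E"
  have "hnrm E (adiff (adj_ops E) T (R F) A) = 0"
  proof (rule adjointable_zero_on_Cc[OF E.adiff_closed[OF T RA] _ A])
    fix f :: "'g \<Rightarrow> complex" assume f: "f \<in> Cc"
    note c = hcarrI[OF Cc_sections[OF f]]
    show "hnrm E (adiff (adj_ops E) T (R F) (sec_class G f)) = 0"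
      unfolding E.adiff_apply[OF c] eq[OF f] R_sec_class[OF F Cc_sections[OF f]]
      by (rule E.nrm_sub_self[OF hcarrI[OF conv_sections[OF F Cc_sections[OF f]]]])
  qed
  then show "T A = R F A"
    unfolding E.adiff_apply[OF A] by (rule E.sub_eq[OF E.adj_carr[OF T A] E.adj_carr[OF RA A]])
qed

lemma Cc_red_simps:
  "acarr (Cc_red G) = Cc" "aadd (Cc_red G) = (\<lambda>f g x. f x + g x)" "ascl (Cc_red G) = (\<lambda>c f x. c * f x)"
  "amul (Cc_red G) = conv G" "astar (Cc_red G) = invol G" "anrm (Cc_red G) = red_norm G"
  by (simp_all add: Cc_red_def)

lemma R_aadd:
  assumes F: "F \<in> Cc" and H: "H \<in> Cc"
  shows "R (\<lambda>x. F x + H x) = aadd (adj_ops E) (R F) (R H)"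
proof -
  have "sec_class G (conv G (rep A) (\<lambda>x. F x + H x)) = hadd E (R F A) (R H A)" if A: "A \<in> hcarr E" for A
    unfolding hadd_E R_apply[OF A]
  proof (rule sec_class_eqI)
    fix u assume u: "u \<in> units G"
    have c: "conv G (rep A) (\<lambda>x. F x + H x) t = conv G (rep A) F t + conv G (rep A) H t" for t
      by (rule conv_add_right[OF F H rep_sq_int[OF A units_rng(1)]])
    show "AE t in haar G u. conv G (rep A) (\<lambda>x. F x + H x) t
        = rep (sec_class G (conv G (rep A) F)) t + rep (sec_class G (conv G (rep A) H)) t"
      using rep_AE[OF conv_sections[OF F rep_sections[OF A]] u] rep_AE[OF conv_sections[OF H rep_sections[OF A]] u]
      by eventually_elim (simp add: c)
  qed
  then show ?thesis by (auto simp: R_def adj_ops_def fun_eq_iff)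
qed

lemma R_ascl:
  assumes F: "F \<in> Cc"
  shows "R (\<lambda>x. c * F x) = ascl (adj_ops E) c (R F)"
proof -
  have "sec_class G (conv G (rep A) (\<lambda>x. c * F x)) = hscl E c (R F A)" if A: "A \<in> hcarr E" for A
    unfolding hscl_E R_apply[OF A]
  proof (rule sec_class_eqI)
    fix u assume u: "u \<in> units G"
    show "AE t in haar G u. conv G (rep A) (\<lambda>x. c * F x) t = c * rep (sec_class G (conv G (rep A) F)) t"
      using rep_AE[OF conv_sections[OF F rep_sections[OF A]] u]
      by eventually_elim (simp add: conv_scale_right)
  qed
  then show ?thesis by (auto simp: R_def adj_ops_def fun_eq_iff)
qed

text \<open>Associativity applies F first and H afterwards, which is where the order of the product
  is reversed.\<close>

lemma R_conv:
  assumes F: "F \<in> Cc" and H: "H \<in> Cc"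
  shows "R (conv G F H) = amul (adj_ops E) (R H) (R F)"
proof -
  have "sec_class G (conv G (rep A) (conv G F H)) = R H (R F A)" if A: "A \<in> hcarr E" for A
  proof -
    have "conv G (conv G (rep A) F) H = conv G (rep A) (conv G F H)"
      by (rule ext, rule conv_assoc[OF F H rep_sq_int[OF A units_rng(1)]])
    then show ?thesis
      unfolding R_apply[OF A] R_sec_class[OF H conv_sections[OF F rep_sections[OF A]]] by simp
  qed
  then show ?thesis by (auto simp: R_def adj_ops_def compose_def fun_eq_iff)
qed

lemma R_star_antihom: "star_antihom (Cc_red G) (adj_ops E) R"
  unfolding star_antihom_def star_linear_def Cc_red_simps acarr_adj_ops
  using R_adjointable R_aadd R_ascl R_conv E.astar_eqI[OF R_adjointable R_adjoint] by auto

end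

section \<open>The reduced norm\<close>

context lc_haar_groupoid
begin

text \<open>Inversion is its own inverse and is measurable in both directions between the two
  fibres, and \<open>haar_source\<close> is by definition an image measure under it.\<close>

lemma
  assumes u: "u \<in> units G"
  shows sq_int_flip: "\<xi> \<in> sq_int (haar_source G u) \<Longrightarrow> flip G \<xi> \<in> sq_int (haar G u)"
    and flip_sq_int: "flip G \<xi> \<in> sq_int (haar G u) \<Longrightarrow> \<xi> \<in> sq_int (haar_source G u)"
    and l2_norm_flip: "\<xi> \<in> sq_int (haar_source G u) \<Longrightarrow>
      l2_norm (haar_source G u) \<xi> = l2_norm (haar G u) (flip G \<xi>)"
proof -
  note m = ginv_measurable[OF u]
  have inv_meas: "ginv G \<in> measurable (haar_source G u) (haar G u)"
  proof -
    have "ginv G \<in> measurable (restrict_space borel (source_fibre G u)) (restrict_space borel (range_fibre G u))"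
      by (rule measurable_restrict_space2)
         (auto simp: range_fibre_def source_fibre_def rng_inv space_restrict_space
           intro!: measurable_restrict_space1 borel_measurable_continuous_onI continuous_inv)
    moreover have "measurable (haar_source G u) (haar G u)
        = measurable (restrict_space borel (source_fibre G u)) (restrict_space borel (range_fibre G u))"
      by (rule measurable_cong_sets) (simp_all add: haar_source_def sets_haar[OF u])
    ultimately show ?thesis by simp
  qed
  have bm: "borel_measurable (haar_source G u) = borel_measurable (restrict_space borel (source_fibre G u))"
    by (rule measurable_cong_sets) (simp_all add: haar_source_def)
  have meas: "\<xi> \<in> borel_measurable (haar_source G u) \<longleftrightarrow> flip G \<xi> \<in> borel_measurable (haar G u)"
    for \<xi> :: "'g \<Rightarrow> complex"
  proof
    assume "\<xi> \<in> borel_measurable (haar_source G u)"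
    from measurable_compose[OF m this[unfolded bm]] show "flip G \<xi> \<in> borel_measurable (haar G u)"
      by (simp add: flip_def[abs_def])
  next
    assume "flip G \<xi> \<in> borel_measurable (haar G u)"
    from measurable_compose[OF inv_meas this] show "\<xi> \<in> borel_measurable (haar_source G u)"
      by (simp add: flip_def inv_inv)
  qed
  have int: "integrable (haar_source G u) (\<lambda>x. (cmod (\<xi> x))\<^sup>2) \<longleftrightarrow> integrable (haar G u) (\<lambda>x. (cmod (flip G \<xi> x))\<^sup>2)"
    and eq: "(LINT x|haar_source G u. (cmod (\<xi> x))\<^sup>2) = (LINT x|haar G u. (cmod (flip G \<xi> x))\<^sup>2)"
    if \<xi>: "\<xi> \<in> borel_measurable (haar_source G u)" for \<xi> :: "'g \<Rightarrow> complex"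
  proof -
    have mm: "(\<lambda>x. (cmod (\<xi> x))\<^sup>2) \<in> borel_measurable (restrict_space borel (source_fibre G u))"
      using \<xi> unfolding bm by measurable
    show "integrable (haar_source G u) (\<lambda>x. (cmod (\<xi> x))\<^sup>2) \<longleftrightarrow> integrable (haar G u) (\<lambda>x. (cmod (flip G \<xi> x))\<^sup>2)"
      unfolding haar_source_def flip_def by (rule integrable_distr_eq[OF m mm])
    show "(LINT x|haar_source G u. (cmod (\<xi> x))\<^sup>2) = (LINT x|haar G u. (cmod (flip G \<xi> x))\<^sup>2)"
      unfolding flip_def by (rule haar_source_integral[OF u mm])
  qed
  show "\<xi> \<in> sq_int (haar_source G u) \<Longrightarrow> flip G \<xi> \<in> sq_int (haar G u)"
    "flip G \<xi> \<in> sq_int (haar G u) \<Longrightarrow> \<xi> \<in> sq_int (haar_source G u)"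
    "\<xi> \<in> sq_int (haar_source G u) \<Longrightarrow> l2_norm (haar_source G u) \<xi> = l2_norm (haar G u) (flip G \<xi>)"
    using meas[of \<xi>] int[of \<xi>] eq[of \<xi>] by (auto simp: sq_int_def l2_norm_def)
qed

text \<open>At x^-1 the regular representation integrates F t against xi (t^-1 x^-1), the value of
  the flipped vector at x t; the substitution y = x t gives the convolution.\<close>

lemma reg_rep_flip:
  assumes F: "F \<in> Cc" and u: "u \<in> units G" and \<xi>: "flip G \<xi> \<in> sq_int (haar G u)" and x: "rng G x = u"
  shows "flip G (reg_rep G F \<xi>) x = conv G (flip G \<xi>) (flip G F) x"
proof -
  have m: "(\<lambda>y. F (gmul G (ginv G x) y) * flip G \<xi> y) \<in> borel_measurable (haar G (rng G x))"
    using ker_left_measurable[OF Cc_continuous[OF F], of x] sq_int_measurable[OF \<xi>] x by simp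
  have "flip G (reg_rep G F \<xi>) x = (LINT t|haar G (src G x). F t * \<xi> (gmul G (ginv G t) (ginv G x)))"
    by (simp add: flip_def reg_rep_def rng_inv)
  also have "\<dots> = (LINT t|haar G (src G x). F (gmul G (ginv G x) (gmul G x t)) * flip G \<xi> (gmul G x t))"
    by (intro Bochner_Integration.integral_cong)
       (auto simp: space_haar range_fibre_def flip_def inv_mul_eq inv_mul_cancel)
  also have "\<dots> = (LINT y|haar G (rng G x). F (gmul G (ginv G x) y) * flip G \<xi> y)"
    by (rule haar_integral_invariant[OF m])
  also have "\<dots> = conv G (flip G \<xi>) (flip G F) x"
    unfolding conv_def
    by (intro Bochner_Integration.integral_cong)
       (auto simp: space_haar range_fibre_def flip_def inv_inv_mul mult.commute)
  finally show ?thesis .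
qed

section \<open>Norms on single fibres and the norm of right convolution\<close>

definition fibre_norm :: "'g \<Rightarrow> ('g \<Rightarrow> complex) \<Rightarrow> real"
  where "fibre_norm u F = l2_opnorm (haar G u) (\<lambda>\<xi>. conv G \<xi> F)"

text \<open>Flipping maps the unit ball of the source fibre onto that of the range fibre and
  preserves the norms of the images, so both suprema run over the same set of numbers.\<close>

lemma l2_opnorm_reg_rep:
  assumes F: "F \<in> Cc" and u: "u \<in> units G"
  shows "l2_opnorm (haar_source G u) (reg_rep G F) = fibre_norm u (flip G F)"
proof -
  have n: "l2_norm (haar_source G u) (reg_rep G F \<xi>) = l2_norm (haar G u) (conv G (flip G \<xi>) (flip G F))"
    if \<xi>: "\<xi> \<in> sq_int (haar_source G u)" for \<xi>
  proof -
    have f: "flip G \<xi> \<in> sq_int (haar G u)" by (rule sq_int_flip[OF u \<xi>])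
    have e: "flip G (reg_rep G F \<xi>) x = conv G (flip G \<xi>) (flip G F) x" if "x \<in> space (haar G u)" for x
      using that reg_rep_flip[OF F u f] by (simp add: space_haar[OF u] range_fibre_def)
    have "flip G (reg_rep G F \<xi>) \<in> sq_int (haar G u)"
      using conv_sq_int[OF flip_Cc[OF F] u f] e by (subst sq_int_cong) auto
    then have "l2_norm (haar_source G u) (reg_rep G F \<xi>) = l2_norm (haar G u) (flip G (reg_rep G F \<xi>))"
      by (intro l2_norm_flip[OF u] flip_sq_int[OF u])
    also have "\<dots> = l2_norm (haar G u) (conv G (flip G \<xi>) (flip G F))" by (rule l2_norm_cong) (rule e)
    finally show ?thesis .
  qed
  let ?S = "{\<xi> \<in> sq_int (haar_source G u). l2_norm (haar_source G u) \<xi> \<le> 1}"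
  let ?H = "{\<xi> \<in> sq_int (haar G u). l2_norm (haar G u) \<xi> \<le> 1}"
  have SH: "flip G ` ?S = ?H"
  proof (intro set_eqI iffI)
    fix \<eta> assume "\<eta> \<in> flip G ` ?S"
    then show "\<eta> \<in> ?H" using sq_int_flip[OF u] l2_norm_flip[OF u] by auto
  next
    fix \<eta> assume \<eta>: "\<eta> \<in> ?H"
    then have "flip G \<eta> \<in> sq_int (haar_source G u)" using flip_sq_int[OF u, of "flip G \<eta>"] by (simp add: flip_flip)
    then have "flip G \<eta> \<in> ?S" using \<eta> l2_norm_flip[OF u, of "flip G \<eta>"] by (simp add: flip_flip)
    then show "\<eta> \<in> flip G ` ?S" using flip_flip[of \<eta>] by (metis image_eqI)
  qed
  have "(\<lambda>\<xi>. l2_norm (haar G u) (conv G \<xi> (flip G F))) ` ?H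
      = (\<lambda>\<xi>. l2_norm (haar G u) (conv G (flip G \<xi>) (flip G F))) ` ?S"
    unfolding SH[symmetric] image_image ..
  also have "\<dots> = (\<lambda>\<xi>. l2_norm (haar_source G u) (reg_rep G F \<xi>)) ` ?S"
    by (intro image_cong refl) (simp add: n)
  finally show ?thesis unfolding fibre_norm_def l2_opnorm_def by simp
qed

lemma sq_int_zero: "(\<lambda>x. 0) \<in> sq_int M" "l2_norm M (\<lambda>x. 0) = 0"
  by (simp_all add: sq_int_def l2_norm_def)

context
  fixes u assumes u: "u \<in> units G"
begin

lemma fibre_norm_upper:
  assumes F: "F \<in> Cc" and \<xi>: "\<xi> \<in> sq_int (haar G u)" "l2_norm (haar G u) \<xi> \<le> 1"
  shows "l2_norm (haar G u) (conv G \<xi> F) \<le> fibre_norm u F"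
proof -
  have "l2_norm (haar G u) (conv G \<eta> F) \<le> I_norm G F" if "\<eta> \<in> sq_int (haar G u)" "l2_norm (haar G u) \<eta> \<le> 1" for \<eta>
    using conv_bound[OF F u that(1)] mult_left_mono[OF that(2) I_norm_nonneg[OF F]] by simp
  then have "bdd_above ((\<lambda>\<xi>. l2_norm (haar G u) (conv G \<xi> F)) ` {\<xi> \<in> sq_int (haar G u). l2_norm (haar G u) \<xi> \<le> 1})"
    by (intro bdd_aboveI2) auto
  then show ?thesis unfolding fibre_norm_def l2_opnorm_def by (rule cSUP_upper[rotated]) (use \<xi> in simp)
qed

lemma fibre_norm_least:
  assumes "\<And>\<xi>. \<xi> \<in> sq_int (haar G u) \<Longrightarrow> l2_norm (haar G u) \<xi> \<le> 1 \<Longrightarrow> l2_norm (haar G u) (conv G \<xi> F) \<le> c"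
  shows "fibre_norm u F \<le> c"
  unfolding fibre_norm_def l2_opnorm_def
proof (rule cSUP_least)
  show "{\<xi> \<in> sq_int (haar G u). l2_norm (haar G u) \<xi> \<le> 1} \<noteq> {}"
    using sq_int_zero[of "haar G u"] by (auto intro!: exI[of _ "\<lambda>x. 0"])
qed (use assms in auto)

lemma fibre_norm_nonneg: "F \<in> Cc \<Longrightarrow> 0 \<le> fibre_norm u F"
  using order_trans[OF l2_norm_nonneg fibre_norm_upper[OF _ sq_int_zero(1)]] by (simp add: sq_int_zero)

lemma fibre_norm_bound:
  assumes F: "F \<in> Cc" and \<xi>: "\<xi> \<in> sq_int (haar G u)"
  shows "l2_norm (haar G u) (conv G \<xi> F) \<le> fibre_norm u F * l2_norm (haar G u) \<xi>"
proof (cases "l2_norm (haar G u) \<xi> = 0")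
  case True
  then show ?thesis using conv_bound[OF F u \<xi>] by simp
next
  case False
  let ?n = "l2_norm (haar G u) \<xi>"
  have n: "?n > 0" using False l2_norm_nonneg[of "haar G u" \<xi>] by simp
  let ?\<eta> = "\<lambda>x. of_real (1 / ?n) * \<xi> x"
  have "l2_norm (haar G u) ?\<eta> = 1" using l2_norm_scale[OF \<xi>, of "of_real (1 / ?n)"] n by (simp add: norm_divide)
  then have "l2_norm (haar G u) (conv G ?\<eta> F) \<le> fibre_norm u F"
    by (intro fibre_norm_upper F sq_int_scale \<xi>) simp
  moreover have "conv G ?\<eta> F = (\<lambda>x. of_real (1 / ?n) * conv G \<xi> F x)" by (rule ext) (rule conv_scale)
  moreover have "l2_norm (haar G u) (\<lambda>x. of_real (1 / ?n) * conv G \<xi> F x) = (1 / ?n) * l2_norm (haar G u) (conv G \<xi> F)"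
    using l2_norm_scale[OF conv_sq_int[OF F u \<xi>], of "of_real (1 / ?n)"] n by (simp add: norm_divide)
  ultimately have "(1 / ?n) * l2_norm (haar G u) (conv G \<xi> F) \<le> fibre_norm u F" by (simp only:)
  then show ?thesis using n by (simp add: pos_divide_le_eq)
qed

text \<open>With c the convolution of eta by the involution of F, the squared norm of c is the inner
  product of the convolution of c by F with eta; the bound for F then allows one factor to be
  cancelled.\<close>

lemma fibre_norm_invol:
  assumes F: "F \<in> Cc" shows "fibre_norm u (invol G F) \<le> fibre_norm u F"
proof (rule fibre_norm_least)
  fix \<eta> assume \<eta>: "\<eta> \<in> sq_int (haar G u)" "l2_norm (haar G u) \<eta> \<le> 1"
  let ?c = "conv G \<eta> (invol G F)"
  have c: "?c \<in> sq_int (haar G u)" by (rule conv_sq_int[OF invol_Cc[OF F] u \<eta>(1)])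
  have "(l2_norm (haar G u) ?c)\<^sup>2 = Re (l2_inner (haar G u) (conv G ?c F) \<eta>)"
    unfolding conv_adjoint[OF F u c \<eta>(1)] l2_inner_self by simp
  also have "\<dots> \<le> l2_norm (haar G u) (conv G ?c F) * l2_norm (haar G u) \<eta>"
    by (rule order_trans[OF complex_Re_le_cmod l2_cauchy_schwarz[OF conv_sq_int[OF F u c] \<eta>(1)]])
  also have "\<dots> \<le> (fibre_norm u F * l2_norm (haar G u) ?c) * 1"
    by (intro mult_mono fibre_norm_bound F c \<eta> mult_nonneg_nonneg fibre_norm_nonneg l2_norm_nonneg)
  finally show "l2_norm (haar G u) ?c \<le> fibre_norm u F"
    using fibre_norm_nonneg[OF F] l2_norm_nonneg[of "haar G u" ?c]
    by (cases "l2_norm (haar G u) ?c = 0") (auto simp: power2_eq_square)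
qed

text \<open>Conjugating the vector together with the function conjugates the result, which has the
  same norm.\<close>

lemma fibre_norm_cnj:
  assumes F: "F \<in> Cc" shows "fibre_norm u (\<lambda>x. cnj (F x)) \<le> fibre_norm u F"
proof (rule fibre_norm_least)
  fix \<eta> assume \<eta>: "\<eta> \<in> sq_int (haar G u)" "l2_norm (haar G u) \<eta> \<le> 1"
  have "conv G \<eta> (\<lambda>x. cnj (F x)) = (\<lambda>x. cnj (conv G (\<lambda>t. cnj (\<eta> t)) F x))"
    using conv_cnj[of "\<lambda>t. cnj (\<eta> t)" F] by (auto simp: fun_eq_iff)
  then show "l2_norm (haar G u) (conv G \<eta> (\<lambda>x. cnj (F x))) \<le> fibre_norm u F"
    using fibre_norm_upper[OF F sq_int_cnj[OF \<eta>(1)]] \<eta>(2) by (simp add: l2_norm_cnj)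
qed

text \<open>The inversion is the composition of the involution, under which operator norms are
  invariant, with complex conjugation.\<close>

lemma fibre_norm_flip:
  assumes F: "F \<in> Cc" shows "fibre_norm u (flip G F) = fibre_norm u F"
proof -
  have *: "fibre_norm u (flip G F) \<le> fibre_norm u F" if F: "F \<in> Cc" for F
  proof -
    have "flip G F = (\<lambda>x. cnj (invol G F x))" by (simp add: invol_eq)
    then show ?thesis
      using fibre_norm_cnj[OF invol_Cc[OF F]] fibre_norm_invol[OF F] by (simp add: order_trans)
  qed
  show ?thesis using *[OF F] *[OF flip_Cc[OF F]] by (simp add: flip_flip)
qed

end

lemma fibre_norm_bdd: "F \<in> Cc \<Longrightarrow> bdd_above ((\<lambda>u. fibre_norm u F) ` units G)"
proof (rule bdd_aboveI2)
  fix u assume F: "F \<in> Cc" and u: "u \<in> units G"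
  show "fibre_norm u F \<le> I_norm G F"
  proof (rule fibre_norm_least[OF u])
    fix \<xi> assume "\<xi> \<in> sq_int (haar G u)" "l2_norm (haar G u) \<xi> \<le> 1"
    then show "l2_norm (haar G u) (conv G \<xi> F) \<le> I_norm G F"
      using conv_bound[OF F u, of \<xi>] mult_left_mono[of "l2_norm (haar G u) \<xi>" 1 "I_norm G F"] I_norm_nonneg[OF F] by simp
  qed
qed

lemma red_norm_eq: "F \<in> Cc \<Longrightarrow> red_norm G F = (SUP u\<in>units G. fibre_norm u F)"
  unfolding red_norm_def by (intro SUP_cong refl) (simp add: l2_opnorm_reg_rep fibre_norm_flip)

lemma red_norm_flip: "F \<in> Cc \<Longrightarrow> red_norm G (flip G F) = red_norm G F"
  by (simp add: red_norm_eq flip_Cc fibre_norm_flip cong: SUP_cong_simp)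

lemma Cc_norm_continuous:
  assumes f: "f \<in> Cc" shows "continuous_on (units G) (\<lambda>u. l2_norm (haar G u) f)"
  unfolding l2_norm_def
  by (intro continuous_on_real_sqrt haar_integral_real_continuous Cc_cmod_sq f)

text \<open>A vector in one fibre of norm at most 1 is approximated by an element of \<open>Cc\<close>, which is
  scaled down to a section of norm at most 1 in every fibre.\<close>

lemma fibre_norm_le_opn:
  assumes F: "F \<in> Cc" and u: "u \<in> units G"
  shows "fibre_norm u F \<le> E.opn (R F)"
proof (rule fibre_norm_least[OF u], rule field_le_epsilon)
  fix \<eta> and e :: real
  assume \<eta>: "\<eta> \<in> sq_int (haar G u)" "l2_norm (haar G u) \<eta> \<le> 1" and e: "e > 0"
  let ?I = "I_norm G F"
  have I: "0 \<le> ?I" by (rule I_norm_nonneg[OF F])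
  \<comment> \<open>On the fibre of \<open>u\<close> the final section differs from eta by at most 2
    d, one d for the approximation and one for the scaling; convolution multiplies this by at most
    \<open>?I\<close>. The summand 1 keeps the denominator positive.\<close>
  define d where "d = e / (2 * (?I + 1))"
  have d: "d > 0" unfolding d_def using e I by simp
  obtain f where f: "f \<in> Cc" "l2_norm (haar G u) (\<lambda>x. \<eta> x - f x) < d"
    using Cc_dense_haar[OF u \<eta>(1) d] by blast
  \<comment> \<open>Dividing by the maximum with 1, rather than by the norm itself, is possible
    where the section vanishes and depends continuously on the unit.\<close>
  define c where "c v = max 1 (l2_norm (haar G v) f)" for v
  have c: "c v \<ge> 1" "c v > 0" for v unfolding c_def by auto
  define b where "b v = complex_of_real (1 / c v)" for v
  have cb: "continuous_on (units G) b"
    unfolding b_def c_def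
    by (intro continuous_intros continuous_on_max Cc_norm_continuous f) (auto simp: max_def)
  let ?g = "\<lambda>x. f x * b (rng G x)"
  have g: "?g \<in> Cc" by (rule Cc_act[OF f(1) cb])
  have gs: "?g \<in> sections" by (rule Cc_sections[OF g])
  have "l2_norm (haar G v) ?g \<le> 1" if "v \<in> units G" for v
  proof -
    have "l2_norm (haar G v) ?g = cmod (b v) * l2_norm (haar G v) f" by (rule l2_norm_act[OF that])
    also have "cmod (b v) = 1 / c v" using c(2)[of v] by (simp add: b_def norm_divide)
    also have "(1 / c v) * l2_norm (haar G v) f \<le> 1"
      using c(2)[of v] by (simp add: pos_divide_le_eq) (simp add: c_def)
    finally show ?thesis .
  qed
  then have "hnrm E (sec_class G ?g) \<le> 1"
    unfolding hnrm_sec_class[OF gs] by (intro cSUP_least units_ne)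
  then have "hnrm E (R F (sec_class G ?g)) \<le> E.opn (R F)"
    by (rule E.opn_upper[OF R_adjointable[OF F] hcarrI[OF gs]])
  then have gF: "l2_norm (haar G u) (conv G ?g F) \<le> E.opn (R F)"
    using l2_norm_le_hnrm[OF hcarrI[OF conv_sections[OF F gs]] u]
    by (simp add: R_sec_class[OF F gs] norm_sec_class[OF conv_sections[OF F gs] u])
  note q = \<eta>(1) Cc_sq_int[OF u f(1)] Cc_sq_int[OF u g]
  have "l2_norm (haar G u) (\<lambda>x. f x - ?g x) = l2_norm (haar G u) (\<lambda>x. f x * (1 - b (rng G x)))"
    by (simp add: algebra_simps)
  also have "\<dots> = cmod (1 - b u) * l2_norm (haar G u) f"
    by (rule l2_norm_act[OF u, where b="\<lambda>v. 1 - b v"])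
  also have "cmod (1 - b u) = 1 - 1 / c u"
  proof -
    have "1 - b u = complex_of_real (1 - 1 / c u)" unfolding b_def by simp
    then show ?thesis using c(1)[of u] by (simp only: norm_of_real) (simp add: field_simps)
  qed
  \<comment> \<open>Scaling affects only a norm above 1 and removes just its excess over 1; since
    eta has norm at most 1 and f is within \<open>d\<close> of it, the excess is at most
    \<open>d\<close>.\<close>
  also have "(1 - 1 / c u) * l2_norm (haar G u) f \<le> d"
  proof (cases "l2_norm (haar G u) f \<le> 1")
    case True
    then show ?thesis using d by (simp add: c_def)
  next
    case False
    then have "c u = l2_norm (haar G u) f" by (simp add: c_def)
    then have "(1 - 1 / c u) * l2_norm (haar G u) f = l2_norm (haar G u) f - 1" using c(2)[of u] by (simp add: field_simps)
    also have "\<dots> \<le> d"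
      using l2_norm_triangle_sub[OF q(2) q(1)] \<eta>(2) f(2) l2_norm_diff_commute[of "haar G u" f \<eta>] by simp
    finally show ?thesis .
  qed
  finally have "l2_norm (haar G u) (\<lambda>x. \<eta> x - ?g x) \<le> 2 * d"
    using l2_norm_diff_triangle[OF q] f(2) by simp
  then have "l2_norm (haar G u) (conv G (\<lambda>x. \<eta> x - ?g x) F) \<le> ?I * (2 * d)"
    using conv_bound[OF F u sq_int_diff[OF q(1) q(3)]] mult_left_mono[OF _ I] order_trans by blast
  also have "\<dots> \<le> e" unfolding d_def using e I by (simp add: field_simps)
  finally have de: "l2_norm (haar G u) (conv G (\<lambda>x. \<eta> x - ?g x) F) \<le> e" .
  have "l2_norm (haar G u) (\<lambda>x. conv G \<eta> F x - conv G ?g F x) = l2_norm (haar G u) (conv G (\<lambda>x. \<eta> x - ?g x) F)"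
    by (rule l2_norm_cong, rule conv_diff[symmetric, OF F]) (use q in \<open>auto simp: space_haar[OF u] range_fibre_def\<close>)
  then show "l2_norm (haar G u) (conv G \<eta> F) \<le> E.opn (R F) + e"
    using l2_norm_triangle_sub[OF conv_sq_int[OF F u q(1)] conv_sq_int[OF F u q(3)]] gF de by simp
qed

text \<open>One inequality holds on each fibre separately, because sections are measured by the
  supremum of their fibre norms; the other is \<open>fibre_norm_le_opn\<close>.\<close>

lemma opn_R:
  assumes F: "F \<in> Cc" shows "E.opn (R F) = red_norm G F"
  unfolding red_norm_eq[OF F]
proof (rule antisym)
  let ?N = "SUP u\<in>units G. fibre_norm u F"
  have N: "fibre_norm u F \<le> ?N" if "u \<in> units G" for u
    by (rule cSUP_upper[OF that fibre_norm_bdd[OF F]])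
  have N0: "0 \<le> ?N"
    using N[OF units_rng(1)] fibre_norm_nonneg[OF units_rng(1) F] by (rule order_trans[rotated])
  show "E.opn (R F) \<le> ?N"
  proof (rule E.opn_le[OF N0], rule R_le[OF F _ N0])
    fix A u assume A: "A \<in> hcarr E" and u: "u \<in> units G"
    show "l2_norm (haar G u) (conv G (rep A) F) \<le> ?N * l2_norm (haar G u) (rep A)"
      using fibre_norm_bound[OF u F rep_sq_int[OF A u]] mult_right_mono[OF N[OF u] l2_norm_nonneg]
      by (rule order_trans)
  qed
  show "?N \<le> E.opn (R F)" by (rule cSUP_least[OF units_ne fibre_norm_le_opn[OF F]])
qed

text \<open>Two reversals of products cancel, and inversion commutes with the linear operations and
  the involution.\<close>

lemma R_star_hom_flip: "star_hom (Cc_red G) (adj_ops E) (\<lambda>F. R (flip G F))"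
proof -
  have "flip G (\<lambda>x. F x + H x) = (\<lambda>x. flip G F x + flip G H x)" for F H
    by (simp add: flip_def fun_eq_iff)
  moreover have "flip G (\<lambda>x. c * F x) = (\<lambda>x. c * flip G F x)" for c F by (simp add: flip_def fun_eq_iff)
  moreover have "flip G (invol G F) = invol G (flip G F)" for F by (simp add: flip_def invol_def fun_eq_iff)
  ultimately show ?thesis
    using R_star_antihom flip_Cc flip_conv
    unfolding star_hom_def star_antihom_def star_linear_def Cc_red_simps by auto
qed

lemma isometric_R: "isometric_star_map (adj_ops E) (Cc_red G) R"
  by unfold_locales
     (use R_star_antihom in \<open>auto simp: Cc_red_simps star_antihom_def opn_R Cc_add Cc_cmult conv_Cc invol_Cc\<close>)

lemma isometric_R_flip: "isometric_star_map (adj_ops E) (Cc_red G) (\<lambda>F. R (flip G F))"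
  by unfold_locales
     (use R_star_hom_flip in \<open>auto simp: Cc_red_simps star_hom_def opn_R red_norm_flip flip_Cc Cc_add Cc_cmult conv_Cc invol_Cc\<close>)

end

theorem proposition8:
  fixes G :: "'g::{t2_space, second_countable_topology} groupoid_data"
  assumes "locally_compact_space (euclidean :: 'g topology)"
    and "haar_groupoid G"
  shows "\<exists>R :: ('g \<Rightarrow> complex) \<Rightarrow> ('g \<Rightarrow> complex) set \<Rightarrow> ('g \<Rightarrow> complex) set.
    (\<forall>F\<in>Cc.
       (\<forall>f\<in>Cc. conv G f F \<in> Cc) \<and>
       R F \<in> acarr (adj_ops (E2 G)) \<and>
       (\<forall>f\<in>Cc. sec_class G f \<in> hcarr (E2 G) \<and>
                 R F (sec_class G f) = sec_class G (conv G f F)) \<and>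
       (\<forall>T\<in>acarr (adj_ops (E2 G)).
          (\<forall>f\<in>Cc. T (sec_class G f) = sec_class G (conv G f F)) \<longrightarrow> T = R F) \<and>
       anrm (adj_ops (E2 G)) (R F) \<le> I_norm G F) \<and>
    star_antihom (Cc_red G) (adj_ops (E2 G)) R \<and>
    (\<exists>\<Psi>. star_antiiso (cstar_red G) (closure_alg (adj_ops (E2 G)) (R ` Cc)) \<Psi> \<and>
       (\<forall>F\<in>Cc. \<Psi> (completion_embed (Cc_red G) F) = R F)) \<and>
    (\<exists>\<Phi>. star_iso (cstar_red G) (closure_alg (adj_ops (E2 G)) (R ` Cc)) \<Phi> \<and>
       (\<forall>F\<in>Cc. \<Phi> (completion_embed (Cc_red G) F) = R (flip G F)))"
proof -
  interpret lc_haar_groupoid G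
    by (rule lc_haar_groupoid.intro[OF assms(2)]) (rule lc_haar_groupoid_axioms.intro[OF assms(1)])
  interpret \<Psi>: isometric_star_map "adj_ops (E2 G)" "Cc_red G" R by (rule isometric_R)
  interpret \<Phi>: isometric_star_map "adj_ops (E2 G)" "Cc_red G" "\<lambda>F. R (flip G F)" by (rule isometric_R_flip)
  \<comment> \<open>Inversion only permutes \<open>Cc\<close>, so \<open>R\<close> and its
    composition with \<open>flip\<close> have the same image and hence the same closure.\<close>
  have "flip G ` Cc = Cc"
  proof (intro set_eqI iffI)
    fix f :: "'g \<Rightarrow> complex" assume "f \<in> Cc"
    then have "flip G f \<in> Cc" by (rule flip_Cc)
    then show "f \<in> flip G ` Cc" using flip_flip[of f] by (metis image_eqI)
  qed (auto simp: flip_Cc)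
  then have "(\<lambda>F. R (flip G F)) ` Cc = R ` Cc" by (metis image_image)
  then have "star_iso (cstar_red G) (closure_alg (adj_ops (E2 G)) (R ` Cc)) \<Phi>.ext"
    using \<Phi>.ext_star_iso[OF R_star_hom_flip] by (simp add: cstar_red_def Cc_red_simps)
  moreover have "star_antiiso (cstar_red G) (closure_alg (adj_ops (E2 G)) (R ` Cc)) \<Psi>.ext"
    using \<Psi>.ext_star_antiiso[OF R_star_antihom] by (simp add: cstar_red_def Cc_red_simps)
  moreover have "E.opn (R F) \<le> I_norm G F" if "F \<in> Cc" for F
    by (rule E.opn_le[OF I_norm_nonneg[OF that] R_bound[OF that]])
  ultimately show ?thesis
    using \<Psi>.ext_embed \<Phi>.ext_embed conv_Cc R_adjointable hcarrI[OF Cc_sections] R_sec_class[OF _ Cc_sections]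
      R_unique R_star_antihom
    by (intro exI[of _ R] conjI ballI exI[of _ \<Psi>.ext] exI[of _ \<Phi>.ext] impI)
       (auto simp: acarr_adj_ops Cc_red_simps)
qed

end
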